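(* Let $n\ge 3$ and let $\mathbf{a}=(a_1,\dots,a_n)\in\mathcal{D}\subset\mathbb{C}^n$, and suppose that $a_1^2+a_2^2+\cdots+a_n^2-a_1a_2\cdots a_n=\mu$. Then $$\sum_{\gamma\in\mathcal{A}}\mathfrak{h}_\mu(\gamma)=1,$$ where the series converges absolutely and $$\mathfrak{h}_\mu(\gamma)=1-\left(1+\frac{2\mu}{n(n-1)(\sigma(\gamma)-\mu)}\right)\sqrt{1-\frac{4}{(\phi(\gamma))^2}}.$$ In particular, when $\mu=0$, $$\sum_{\gamma\in\mathcal{A}}h(\phi(\gamma))=1,$$ where the sum converges absolutely and $h(z)=1-\sqrt{1-\frac{4}{z^2}}$ for $z\ne 0$.
   Context: $\Gamma_n=\langle b_1,\dots,b_n\mid b_i^2=\mathrm{Id}\rangle$ (free product of $n$ copies of $\mathbb{Z}/2$) acts on $\mathbb{C}^n$ by $b_i(x_1,\dots,x_n)=(x_1,\dots,x_{i-1},\prod_{j\ne i}x_j-x_i,x_{i+1},\dots,x_n)$. $\Delta$ is the Cayley graph of $\Gamma_n$: its vertex set is $V(\Delta)=\Gamma_n$, and $g,h$ are joined by an edge labeled $i$ iff $g=hb_i$; it is an $n$-regular tree. For $1\le i<j\le n$, $\mathcal{A}_{ij}$ is the set of bi-infinite geodesics in $\Delta$ whose edges are alternately labeled $i$ and $j$, and $\mathcal{A}=\bigsqcup_{i<j}\mathcal{A}_{ij}$ is the set of alternating geodesics. For $\mathbf{a}\in\mathbb{C}^n$ let $\Phi_{\mathbf{a}}:V(\Delta)\to\mathbb{C}^n$,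 $\Phi_{\mathbf{a}}(g)=g^{-1}(\mathbf{a})$. For $\gamma\in\mathcal{A}_{ij}$ and any vertex $g$ of $\gamma$ with $\Phi_{\mathbf{a}}(g)=(x_1,\dots,x_n)$, put $\phi(\gamma)=\phi_{\mathbf{a}}(\gamma)=\prod_{k\ne i,j}x_k$ and $\sigma(\gamma)=\sum_{k\ne i,j}x_k^2$ (these do not depend on the choice of $g$). $\mathcal{D}$ is the set of $\mathbf{a}\in\mathbb{C}^n$ such that (i) $\phi_{\mathbf{a}}(\gamma)\notin[-2,2]$ for all $\gamma\in\mathcal{A}$, and (ii) $\{\gamma\in\mathcal{A}:|\phi_{\mathbf{a}}(\gamma)|\le K\}$ is finite for some $K>2$. Square roots are taken to have non-negative real part. *)

theory Defs
  imports "HOL-Analysis.Analysis" "HOL-Algebra.Group_Action"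
begin

text \<open>
  The free product of copies of Z/2 indexed by the type \<open>'n\<close>, in normal form: its elements are
  the words over \<open>'n\<close> in which neighbouring letters differ, and multiplication is concatenation
  followed by cancellation of equal neighbours.  The lemmas \<open>Gam_universal\<close> and \<open>Gam_unique\<close>
  state that this is the group presented by generators \<open>gen i\<close> with relations \<open>gen i\<^sup>2 = 1\<close>.
\<close>

definition cancel_Cons :: "'n \<Rightarrow> 'n list \<Rightarrow> 'n list" where
  "cancel_Cons i w = (case w of [] \<Rightarrow> [i] | j # v \<Rightarrow> if i = j then v else i # w)"

definition Gam :: "'n list monoid" where
  "Gam = \<lparr>carrier = {w. distinct_adj w}, mult = (\<lambda>u v. foldr cancel_Cons u v), one = []\<rparr>"

definition gen :: "'n \<Rightarrow> 'n list" where
  "gen i = [i]"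

lemma cancel_Cons_closed: "distinct_adj w \<Longrightarrow> distinct_adj (cancel_Cons i w)"
  by (auto simp: cancel_Cons_def distinct_adj_Cons split: list.splits)

lemma cancel_Cons_twice: "distinct_adj w \<Longrightarrow> cancel_Cons i (cancel_Cons i w) = w"
  by (auto simp: cancel_Cons_def distinct_adj_Cons split: list.splits)

lemma cancel_Cons_reduced: "distinct_adj (i # w) \<Longrightarrow> cancel_Cons i w = i # w"
  by (auto simp: cancel_Cons_def split: list.splits)

lemma foldr_cancel_Cons_closed: "distinct_adj v \<Longrightarrow> distinct_adj (foldr cancel_Cons u v)"
  by (induction u) (auto intro: cancel_Cons_closed)

lemma foldr_cancel_Cons_Nil: "distinct_adj w \<Longrightarrow> foldr cancel_Cons w [] = w"
proof (induction w)
  case (Cons i w)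
  then show ?case
    using distinct_adj_ConsD[of i w] by (simp add: cancel_Cons_reduced)
qed simp

text \<open>Any family of involutions extends to an action of words that respects multiplication.\<close>

lemma foldr_cancel_Cons1:
  assumes inv: "\<And>i x. P x \<Longrightarrow> P (f i x) \<and> f i (f i x) = x" and x: "P x"
  shows "foldr f (cancel_Cons i w) x = f i (foldr f w x)"
proof -
  have P: "P (foldr f v x)" for v
    using x by (induction v) (auto simp: inv)
  show ?thesis
    by (auto simp: cancel_Cons_def inv P split: list.splits)
qed

lemma foldr_mult:
  assumes inv: "\<And>i x. P x \<Longrightarrow> P (f i x) \<and> f i (f i x) = x" and x: "P x"
  shows "foldr f (foldr cancel_Cons u v) x = foldr f u (foldr f v x)"
proof (induction u)
  case (Cons i u)
  then show ?case
    using foldr_cancel_Cons1[of P f x i "foldr cancel_Cons u v", OF inv x] by simp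
qed simp

lemma foldr_rev_cancel:
  assumes inv: "\<And>i x. P x \<Longrightarrow> P (f i x) \<and> f i (f i x) = x" and x: "P x"
  shows "foldr f (rev u) (foldr f u x) = x"
proof (induction u)
  case (Cons i u)
  have "P (foldr f v x)" for v
    using x by (induction v) (auto simp: inv)
  with Cons show ?case
    by (simp add: inv)
qed simp

lemma group_Gam: "group (Gam :: 'n list monoid)"
proof (rule groupI)
  fix u v w :: "'n list"
  assume "u \<in> carrier Gam" "v \<in> carrier Gam" "w \<in> carrier Gam"
  then show "u \<otimes>\<^bsub>Gam\<^esub> v \<otimes>\<^bsub>Gam\<^esub> w = u \<otimes>\<^bsub>Gam\<^esub> (v \<otimes>\<^bsub>Gam\<^esub> w)"
    using foldr_mult[of distinct_adj cancel_Cons w u v]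
    by (simp add: Gam_def cancel_Cons_closed cancel_Cons_twice)
next
  fix u :: "'n list"
  assume u: "u \<in> carrier Gam"
  then have "foldr cancel_Cons (rev u) (foldr cancel_Cons u []) = []"
    by (intro foldr_rev_cancel[of distinct_adj]) (auto simp: cancel_Cons_closed cancel_Cons_twice)
  then show "\<exists>v\<in>carrier Gam. v \<otimes>\<^bsub>Gam\<^esub> u = \<one>\<^bsub>Gam\<^esub>"
    using u by (intro bexI[of _ "rev u"]) (auto simp: Gam_def foldr_cancel_Cons_Nil)
qed (auto simp: Gam_def foldr_cancel_Cons_closed)

interpretation Gam: group "Gam :: 'n list monoid"
  by (rule group_Gam)

lemma gen_closed [simp]: "gen i \<in> carrier Gam"
  by (simp add: gen_def Gam_def)

lemma gen_gen [simp]: "gen i \<otimes>\<^bsub>Gam\<^esub> gen i = \<one>\<^bsub>Gam\<^esub>"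
  by (simp add: gen_def Gam_def cancel_Cons_def)

lemma gen_neq_one [simp]: "gen i \<noteq> \<one>\<^bsub>Gam\<^esub>"
  by (simp add: gen_def Gam_def)

lemma gen_inject [simp]: "gen i = gen j \<longleftrightarrow> i = j"
  by (simp add: gen_def)

lemma (in group) Gam_universal:
  assumes f: "\<And>i. f i \<in> carrier G" "\<And>i. f i \<otimes> f i = \<one>"
  shows "\<exists>h\<in>hom Gam G. \<forall>i. h (gen i) = f i"
proof -
  define h where "h w = foldr (\<lambda>i x. f i \<otimes> x) w \<one>" for w
  have inv: "x \<in> carrier G \<Longrightarrow> f i \<otimes> x \<in> carrier G \<and> f i \<otimes> (f i \<otimes> x) = x" for i x
    using f by (simp add: m_assoc[symmetric])
  have closed: "h w \<in> carrier G" for w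
    unfolding h_def using f by (induction w) auto
  have app: "foldr (\<lambda>i x. f i \<otimes> x) u y = h u \<otimes> y" if "y \<in> carrier G" for u y
    using that f closed unfolding h_def by (induction u) (auto simp: m_assoc)
  have "h (foldr cancel_Cons u v) = h u \<otimes> h v" for u v
    using foldr_mult[of "\<lambda>x. x \<in> carrier G" "\<lambda>i x. f i \<otimes> x" \<one> u v] inv
      app[OF closed, of u v] by (simp add: h_def)
  then have "h \<in> hom Gam G"
    using closed by (auto simp: hom_def Gam_def)
  moreover have "h (gen i) = f i" for i
    using f by (simp add: h_def gen_def)
  ultimately show ?thesis by blast
qed

lemma (in group) Gam_unique:
  assumes h: "h \<in> hom Gam G" "h' \<in> hom Gam G" "\<And>i. h (gen i) = h' (gen i)"
    and w: "w \<in> carrier Gam"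
  shows "h w = h' w"
  using w
proof (induction w)
  case Nil
  show ?case
    using hom_one[OF h(1) group_Gam is_group] hom_one[OF h(2) group_Gam is_group]
    by (simp add: Gam_def)
next
  case (Cons i w)
  have w: "w \<in> carrier Gam" and eq: "i # w = gen i \<otimes>\<^bsub>Gam\<^esub> w"
    using Cons.prems by (auto simp: Gam_def gen_def cancel_Cons_reduced dest: distinct_adj_ConsD)
  show ?case
    unfolding eq using h w Cons.IH[OF w] by (simp add: hom_mult)
qed


definition vieta :: "'n::finite \<Rightarrow> complex ^ 'n \<Rightarrow> complex ^ 'n" where
  "vieta i x = (\<chi> k. if k = i then (\<Prod>j\<in>UNIV - {i}. x $ j) - x $ i else x $ k)"

definition act :: "'n::finite list \<Rightarrow> complex ^ 'n \<Rightarrow> complex ^ 'n" where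
  "act w x = foldr vieta w x"

lemma vieta_vieta [simp]: "vieta i (vieta i x) = x"
proof -
  have "(\<Prod>j\<in>UNIV - {i}. vieta i x $ j) = (\<Prod>j\<in>UNIV - {i}. x $ j)"
    by (rule prod.cong) (auto simp: vieta_def)
  then show ?thesis
    unfolding vieta_def[of i "vieta i x"] by (auto simp: vec_eq_iff) (auto simp: vieta_def)
qed

lemma act_gen [simp]: "act (gen i) = vieta i"
  by (simp add: act_def gen_def fun_eq_iff)

lemma act_one [simp]: "act \<one>\<^bsub>Gam\<^esub> x = x"
  by (simp add: act_def Gam_def)

lemma act_mult: "act (u \<otimes>\<^bsub>Gam\<^esub> v) x = act u (act v x)"
  using foldr_mult[of "\<lambda>_. True" vieta x u v] by (simp add: act_def Gam_def)

lemma group_action_act: "group_action Gam UNIV (act :: 'n::finite list \<Rightarrow> _)"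
proof -
  have "bij (act w)" if w: "w \<in> carrier Gam" for w :: "'n list"
  proof (rule o_bij[of "act (inv\<^bsub>Gam\<^esub> w)"])
    show "act (inv\<^bsub>Gam\<^esub> w) \<circ> act w = id" "act w \<circ> act (inv\<^bsub>Gam\<^esub> w) = id"
      using w by (simp_all add: fun_eq_iff act_mult[symmetric])
  qed
  then have "act \<in> hom Gam (BijGroup (UNIV :: (complex ^ 'n) set))"
    by (auto simp: hom_def BijGroup_def Bij_def compose_def fun_eq_iff act_mult)
  then show ?thesis
    by (simp add: group_action_def group_hom_def group_hom_axioms_def group_Gam group_BijGroup)
qed


definition cayley_edge :: "'n \<Rightarrow> 'n list \<Rightarrow> 'n list \<Rightarrow> bool" where
  "cayley_edge i g h \<longleftrightarrow> g \<in> carrier Gam \<and> h \<in> carrier Gam \<and> g = h \<otimes>\<^bsub>Gam\<^esub> gen i"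

definition cayley_dist :: "'n list \<Rightarrow> 'n list \<Rightarrow> nat" where
  "cayley_dist g h =
    (LEAST m. \<exists>p. p 0 = g \<and> p m = h \<and> (\<forall>k<m. \<exists>i. cayley_edge i (p k) (p (Suc k))))"

definition geodesic_line :: "(int \<Rightarrow> 'n list) \<Rightarrow> bool" where
  "geodesic_line p \<longleftrightarrow>
    range p \<subseteq> carrier Gam \<and> (\<forall>s t. cayley_dist (p s) (p t) = nat \<bar>s - t\<bar>)"

text \<open>
  A geodesic is an unparametrized subgraph and is represented by its vertex set.  Nothing is lost:
  since vertices at distance at least 2 are not adjacent, a geodesic is the subgraph induced
  on its vertices.  Both parities are covered, because \<open>p\<close> may be shifted by 1; in particular
  \<open>alt_geodesics_at i j = alt_geodesics_at j i\<close>.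
\<close>

definition alt_geodesics_at :: "'n \<Rightarrow> 'n \<Rightarrow> 'n list set set" where
  "alt_geodesics_at i j = {range p | p. i \<noteq> j \<and> geodesic_line p \<and>
     (\<forall>s. cayley_edge (if even s then i else j) (p s) (p (s + 1)))}"

definition alt_geodesics :: "'n list set set" where
  "alt_geodesics = (\<Union>i j. alt_geodesics_at i j)"

definition Phi :: "complex ^ 'n::finite \<Rightarrow> 'n list \<Rightarrow> complex ^ 'n" where
  "Phi a g = act (inv\<^bsub>Gam\<^esub> g) a"

text \<open>That the next two descriptions determine a unique value is \<open>phi_eq\<close> and \<open>sigma_eq\<close> below.\<close>

definition phi :: "complex ^ 'n::finite \<Rightarrow> 'n list set \<Rightarrow> complex" where
  "phi a \<gamma> = (THE z. \<exists>i j. \<gamma> \<in> alt_geodesics_at i j \<and>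
     (\<exists>g\<in>\<gamma>. z = (\<Prod>k\<in>UNIV - {i, j}. Phi a g $ k)))"

definition sigma :: "complex ^ 'n::finite \<Rightarrow> 'n list set \<Rightarrow> complex" where
  "sigma a \<gamma> = (THE z. \<exists>i j. \<gamma> \<in> alt_geodesics_at i j \<and>
     (\<exists>g\<in>\<gamma>. z = (\<Sum>k\<in>UNIV - {i, j}. (Phi a g $ k)\<^sup>2)))"

definition domD :: "(complex ^ 'n::finite) set" where
  "domD = {a. (\<forall>\<gamma>\<in>alt_geodesics. phi a \<gamma> \<notin> complex_of_real ` {-2..2}) \<and>
     (\<exists>K>2. finite {\<gamma>\<in>alt_geodesics. cmod (phi a \<gamma>) \<le> K})}"

text \<open>
  For \<open>\<phi> \<notin> [-2,2]\<close> the number \<open>1 - 4/\<phi>\<^sup>2\<close> is not a non-positive real, so it has exactly one square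
  root with non-negative real part, and this is \<open>csqrt\<close>.
\<close>

definition h_fun :: "complex \<Rightarrow> complex" where
  "h_fun z = 1 - csqrt (1 - 4 / z\<^sup>2)"

definition h_mu :: "complex \<Rightarrow> complex ^ 'n::finite \<Rightarrow> 'n list set \<Rightarrow> complex" where
  "h_mu \<mu> a \<gamma> =
    1 - (1 + 2 * \<mu> / (of_nat CARD('n) * (of_nat CARD('n) - 1) * (sigma a \<gamma> - \<mu>)))
          * csqrt (1 - 4 / (phi a \<gamma>)\<^sup>2)"


lemma cayley_edge_sym: "cayley_edge i g h \<Longrightarrow> cayley_edge i h g"
  by (auto simp: cayley_edge_def Gam.m_assoc)

lemma alt_geodesics_at_subset: "alt_geodesics_at i j \<subseteq> alt_geodesics_at j i"
proof
  fix \<gamma> :: "'a list set"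
  assume "\<gamma> \<in> alt_geodesics_at i j"
  then obtain p where p: "\<gamma> = range p" "i \<noteq> j" "geodesic_line p"
    "\<And>s. cayley_edge (if even s then i else j) (p s) (p (s + 1))"
    by (auto simp: alt_geodesics_at_def)
  define q where "q s = p (s + 1)" for s
  have "p s \<in> range q" for s
    using rangeI[of q "s - 1"] by (simp add: q_def)
  then have "range q = \<gamma>"
    unfolding p(1) by (auto simp: q_def)
  moreover have "geodesic_line q"
    using p(3) by (auto simp: geodesic_line_def q_def)
  moreover have "cayley_edge (if even s then j else i) (q s) (q (s + 1))" for s
    using p(4)[of "s + 1"] by (auto simp: q_def)
  ultimately show "\<gamma> \<in> alt_geodesics_at j i"
    using p(2) unfolding alt_geodesics_at_def by blast
qed

lemma alt_geodesics_at_commute: "alt_geodesics_at i j = alt_geodesics_at j i"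
  by (intro equalityI alt_geodesics_at_subset)

lemma cayley_dist_edge: "cayley_edge i g h \<Longrightarrow> cayley_dist g h \<le> 1"
  unfolding cayley_dist_def
  by (rule Least_le, rule exI[of _ "\<lambda>k. if k = 0 then g else h"]) auto

lemma alt_geodesic_label:
  assumes \<gamma>: "\<gamma> \<in> alt_geodesics_at i j" and e: "cayley_edge k g h" "g \<in> \<gamma>" "h \<in> \<gamma>"
  shows "k \<in> {i, j}"
proof -
  obtain p where p: "\<gamma> = range p" "geodesic_line p"
    "\<And>s. cayley_edge (if even s then i else j) (p s) (p (s + 1))"
    using \<gamma> by (auto simp: alt_geodesics_at_def)
  obtain s t where st: "g = p s" "h = p t"
    using e p(1) by auto
  have "nat \<bar>s - t\<bar> \<le> 1"
    using cayley_dist_edge[OF e(1)] p(2) st by (simp add: geodesic_line_def)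
  moreover have "g \<noteq> h"
    using e(1) by (auto simp: cayley_edge_def Gam.r_cancel_one')
  ultimately have "t = s + 1 \<or> s = t + 1"
    using st by (cases "s = t") auto
  then have "\<exists>l\<in>{i, j}. cayley_edge l g h"
    using p(3)[of s] p(3)[of t] st cayley_edge_sym[of _ h g] by (auto split: if_splits)
  then show ?thesis
    using e(1) by (auto simp: cayley_edge_def)
qed

lemma alt_geodesics_at_disjoint:
  assumes "\<gamma> \<in> alt_geodesics_at i j" "\<gamma> \<in> alt_geodesics_at i' j'"
  shows "{i, j} = {i', j'}"
proof -
  have sub: "{i, j} \<subseteq> {i', j'}"
    if \<gamma>: "\<gamma> \<in> alt_geodesics_at i j" "\<gamma> \<in> alt_geodesics_at i' j'" for i j i' j' :: 'a
  proof -
    obtain p :: "int \<Rightarrow> 'a list" where p: "\<gamma> = range p"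
      "\<And>s. cayley_edge (if even s then i else j) (p s) (p (s + 1))"
      using \<gamma>(1) by (auto simp: alt_geodesics_at_def)
    have "cayley_edge i (p 0) (p 1)" "cayley_edge j (p 1) (p 2)"
      using p(2)[of 0] p(2)[of 1] by simp_all
    then show ?thesis
      using alt_geodesic_label[OF \<gamma>(2)] p(1) by blast
  qed
  show ?thesis
    using sub[OF assms] sub[OF assms(2,1)] by blast
qed

lemma Phi_edge:
  assumes "cayley_edge i g h"
  shows "Phi a g = vieta i (Phi a h)"
proof -
  have "inv\<^bsub>Gam\<^esub> (gen i) = gen i"
    by (rule Gam.inv_equality) auto
  then show ?thesis
    using assms by (auto simp: cayley_edge_def Phi_def Gam.inv_mult_group act_mult)
qed

lemma Phi_alt_geodesic:
  fixes \<gamma> :: "'a::finite list set"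
  assumes \<gamma>: "\<gamma> \<in> alt_geodesics_at i j" and g: "g \<in> \<gamma>" "h \<in> \<gamma>" and k: "k \<notin> {i, j}"
  shows "Phi a g $ k = Phi a h $ k"
proof -
  obtain p :: "int \<Rightarrow> 'a list" where p: "\<gamma> = range p"
    "\<And>s. cayley_edge (if even s then i else j) (p s) (p (s + 1))"
    using \<gamma> by (auto simp: alt_geodesics_at_def)
  have step: "Phi a (p s) $ k = Phi a (p (s + 1)) $ k" for s
    using Phi_edge[OF p(2)[of s], of a] k by (auto simp: vieta_def)
  have "Phi a (p s) $ k = Phi a (p 0) $ k" for s
  proof (induction s rule: int_induct[of _ 0])
    case (step2 s)
    then show ?case using step[of "s - 1"] by simp
  qed (use step in simp_all)
  then show ?thesis
    using g p(1) by (metis imageE)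
qed

lemma phi_eq:
  assumes "\<gamma> \<in> alt_geodesics_at i j" "g \<in> \<gamma>"
  shows "phi a \<gamma> = (\<Prod>k\<in>UNIV - {i, j}. Phi a g $ k)"
  unfolding phi_def
proof (rule the_equality)
  fix z
  assume "\<exists>i j. \<gamma> \<in> alt_geodesics_at i j \<and> (\<exists>g\<in>\<gamma>. z = (\<Prod>k\<in>UNIV - {i, j}. Phi a g $ k))"
  then obtain i' j' g' where *: "\<gamma> \<in> alt_geodesics_at i' j'" "g' \<in> \<gamma>"
    "z = (\<Prod>k\<in>UNIV - {i', j'}. Phi a g' $ k)"
    by blast
  show "z = (\<Prod>k\<in>UNIV - {i, j}. Phi a g $ k)"
    unfolding *(3) alt_geodesics_at_disjoint[OF *(1) assms(1)]
    by (rule prod.cong) (auto intro!: Phi_alt_geodesic[OF assms(1) *(2) assms(2)])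
qed (use assms in blast)

lemma sigma_eq:
  assumes "\<gamma> \<in> alt_geodesics_at i j" "g \<in> \<gamma>"
  shows "sigma a \<gamma> = (\<Sum>k\<in>UNIV - {i, j}. (Phi a g $ k)\<^sup>2)"
  unfolding sigma_def
proof (rule the_equality)
  fix z
  assume "\<exists>i j. \<gamma> \<in> alt_geodesics_at i j \<and> (\<exists>g\<in>\<gamma>. z = (\<Sum>k\<in>UNIV - {i, j}. (Phi a g $ k)\<^sup>2))"
  then obtain i' j' g' where *: "\<gamma> \<in> alt_geodesics_at i' j'" "g' \<in> \<gamma>"
    "z = (\<Sum>k\<in>UNIV - {i', j'}. (Phi a g' $ k)\<^sup>2)"
    by blast
  show "z = (\<Sum>k\<in>UNIV - {i, j}. (Phi a g $ k)\<^sup>2)"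
    unfolding *(3) alt_geodesics_at_disjoint[OF *(1) assms(1)]
    by (rule sum.cong) (auto intro!: arg_cong[where f = "\<lambda>z. z\<^sup>2"]
        Phi_alt_geodesic[OF assms(1) *(2) assms(2)])
qed (use assms in blast)

end

theory Submission
  imports Defs
begin

text \<open>
  Reduced words are the vertices of the tree.  At every vertex \<open>\<Sum>\<^sub>i x\<^sub>i\<^sup>2 = \<mu> + \<Prod>\<^sub>i x\<^sub>i\<close>, which says that
  the weights \<open>x\<^sub>i / \<Prod>\<^sub>j\<^sub>\<noteq>\<^sub>i x\<^sub>j - \<mu> / (n \<Prod>\<^sub>k x\<^sub>k)\<close> of the edges at that vertex add up to 1, and across an
  edge \<open>x\<^sub>i \<rightarrow> x\<^sub>i'\<close> the two weights add up to \<open>1 - \<mu> / (n x\<^sub>i x\<^sub>i')\<close>.  Hence the total weight leaving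
  a ball around the root is 1 plus \<open>\<mu> / n\<close> times the sum of \<open>1 / (x\<^sub>i x\<^sub>i')\<close> over its inner edges.
  Every edge leaving the ball continues exactly one alternating geodesic, determined by its last two
  letters, and along the two ends of a geodesic the weights tend to \<open>(1 - sqrt (1 - 4 / \<phi>\<^sup>2)) / 2\<close>,
  because the coordinates satisfy \<open>y\<^sub>k\<^sub>+\<^sub>2 = \<phi> y\<^sub>k\<^sub>+\<^sub>1 - y\<^sub>k\<close>.  The inner edges, distributed evenly over the
  \<open>n - 1\<close> geodesics through them, give a telescoping sum along each geodesic, which produces the
  term with \<open>\<sigma>\<close>.

  The limit is taken by dominated convergence.  Far from the root all coordinates grow outwards:
  otherwise two coordinates shrink at a fork, or a shrinking path is so long that it barely shrinks
  somewhere, and then \<open>\<bar>\<phi>\<bar> \<le> K\<close> for a geodesic far away.  Growth makes \<open>ln (\<bar>\<phi>\<bar> / 2)\<close> superadditive,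
  so that it is bounded below by a positive multiple of the size of an integer vector, and distinct
  geodesics have distinct vectors.
\<close>

section \<open>Two-term linear recurrences\<close>

text \<open>Condition (i) makes the recurrence along every geodesic hyperbolic: one characteristic
  root \<open>L\<close> has modulus above 1. The limit of the weights still needs the ray not to
  start on the contracting eigenline. A ray starting there would tend to 0, and so would \<phi> on
  the geodesics that meet it and carry a third label; but (i) and (ii) together bound |\<phi>| below
  by some \<epsilon> > 0. The invariant quadratic form of the recurrence, which vanishes exactly on
  the eigenlines, equals \<mu> - \<sigma>, so the same argument shows that no denominator
  \<open>\<sigma> - \<mu>\<close> is 0. The obstacle to growth is the finitely many geodesics with
  |\<phi>| \<le> K. They are infinite, so leaving out a ball does not remove them, and where
  |\<phi>| is small a single crossing need not gain anything. But growth by the factor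
  |\<open>L\<close>| sets in after finitely many steps, and since only finitely many geodesics are
  based near the root, one rate \<delta> serves them all. Hence the case distinctions on whether the
  base of a geodesic is shorter than \<open>m0\<close>.\<close>

fun lin_rec :: "complex \<Rightarrow> complex \<Rightarrow> complex \<Rightarrow> nat \<Rightarrow> complex" where
  "lin_rec t y z 0 = y"
| "lin_rec t y z (Suc 0) = z"
| "lin_rec t y z (Suc (Suc k)) = t * lin_rec t y z (Suc k) - lin_rec t y z k"

definition big_root :: "complex \<Rightarrow> complex" where
  "big_root t = t * (1 + csqrt (1 - 4 / t\<^sup>2)) / 2"

section \<open>Characteristic roots of the recurrence\<close>

context
  fixes t s L :: complex
  assumes t: "t \<notin> complex_of_real ` {-2..2}"
    and s_def: "s = csqrt (1 - 4 / t\<^sup>2)"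
    and L_def: "L = big_root t"
begin

lemma trace_nonzero: "t \<noteq> 0"
  using t by (auto intro!: image_eqI[of _ _ 0])

text \<open>If the real part vanished, \<open>1 - 4 / t\<^sup>2\<close> would be a non-positive
  real, hence \<open>t\<^sup>2\<close> a real number in \<open>[0, 4]\<close> and \<open>t\<close>
  in the excluded segment. The strict sign is what separates the moduli of the two roots.\<close>

lemma Re_csqrt_pos: "Re s > 0"
proof (rule ccontr)
  assume "\<not> Re s > 0"
  moreover have "Re s \<ge> 0"
    unfolding s_def using csqrt_principal[of "1 - 4 / t\<^sup>2"] by auto
  ultimately have "s = \<i> * complex_of_real (Im s)"
    by (simp add: complex_eq_iff)
  then have "s\<^sup>2 = - complex_of_real ((Im s)\<^sup>2)"
    by (metis i_squared mult_minus1 of_real_power power_mult_distrib power2_i)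
  then have "1 - 4 / t\<^sup>2 = - complex_of_real ((Im s)\<^sup>2)"
    by (simp add: s_def)
  then have eq: "t\<^sup>2 * complex_of_real (1 + (Im s)\<^sup>2) = 4"
    using trace_nonzero by (simp add: field_simps add_eq_0_iff)
  define r where "r = 4 / (1 + (Im s)\<^sup>2)"
  have pos: "1 + (Im s)\<^sup>2 > 0" by (simp add: add_pos_nonneg)
  have r: "0 \<le> r" "r \<le> 4"
    using pos by (auto simp: r_def field_simps)
  have "t\<^sup>2 = complex_of_real r"
    using eq pos unfolding r_def of_real_divide
    by (metis less_irrefl nonzero_eq_divide_eq of_real_eq_0_iff of_real_numeral)
  then have "t\<^sup>2 = (complex_of_real (sqrt r))\<^sup>2"
    using r by (metis of_real_power real_sqrt_pow2)
  then have "t = complex_of_real (sqrt r) \<or> t = complex_of_real (- sqrt r)"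
    by (simp add: power2_eq_iff)
  moreover have "sqrt r \<le> 2"
    using r by (simp add: real_le_lsqrt)
  moreover have "sqrt r \<ge> 0" using r by simp
  ultimately show False
    using t by (metis atLeastAtMost_iff image_eqI minus_le_iff neg_le_0_iff_le neg_le_iff_le order_trans zero_le_numeral)
qed

text \<open>The roots are \<open>t * (1 + s) / 2\<close> and \<open>t * (1 - s) / 2\<close>, with
  product 1. As \<open>s\<close> has positive real part, it is closer to 1 than to -1, so the first
  root has the larger modulus, which therefore exceeds 1.\<close>

lemma big_root_nonzero: "L \<noteq> 0"
  and inverse_big_root: "1 / L = t * (1 - s) / 2"
  and big_root_sum: "L + 1 / L = t"
  and big_root_diff: "L - 1 / L = t * s"
  and norm_big_root: "cmod L > 1"
proof -
  have s2: "s\<^sup>2 = 1 - 4 / t\<^sup>2" by (simp add: s_def)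
  have l: "L = t * (1 + s) / 2" by (simp add: L_def big_root_def s_def)
  have "L * (t * (1 - s) / 2) = t\<^sup>2 * (1 - s\<^sup>2) / 4"
    unfolding l by (simp add: field_simps power2_eq_square)
  also have "\<dots> = 1"
    using trace_nonzero by (simp add: s2)
  finally have p: "L * (t * (1 - s) / 2) = 1" .
  show nz: "L \<noteq> 0" using p by auto
  show inv: "1 / L = t * (1 - s) / 2"
    using p nz by (simp add: field_simps)
  show "L + 1 / L = t" "L - 1 / L = t * s"
    unfolding inv unfolding l by (simp_all add: field_simps)
  have "(cmod (1 - s))\<^sup>2 < (cmod (1 + s))\<^sup>2"
    using Re_csqrt_pos unfolding cmod_power2 by (simp add: power2_eq_square algebra_simps)
  then have "cmod (1 - s) < cmod (1 + s)"
    by (simp add: power2_less_imp_less)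
  then have "cmod (t * (1 - s) / 2) < cmod L"
    unfolding l using trace_nonzero by (simp add: norm_mult norm_divide)
  then have less: "cmod (1 / L) < cmod L" by (simp add: inv)
  show "cmod L > 1"
  proof (rule ccontr)
    assume "\<not> cmod L > 1"
    then have "1 \<le> cmod (1 / L)" using nz by (simp add: norm_divide field_simps)
    with less \<open>\<not> cmod L > 1\<close> show False by simp
  qed
qed

lemma norm_inverse_big_root: "cmod (1 / L) < 1"
proof -
  have "0 < cmod L" using norm_big_root by linarith
  then show ?thesis using norm_big_root by (simp add: norm_divide)
qed

lemma big_root_diff_nonzero: "L - 1 / L \<noteq> 0"
  using big_root_diff trace_nonzero Re_csqrt_pos by auto


lemma lin_rec_closed:
  "lin_rec t y z k = (z - y / L) / (L - 1 / L) * L ^ k + (L * y - z) / (L - 1 / L) * (1 / L) ^ k"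
proof -
  define A where "A = (z - y / L) / (L - 1 / L)"
  define B where "B = (L * y - z) / (L - 1 / L)"
  have "A + B = ((z - y / L) + (L * y - z)) / (L - 1 / L)"
    by (simp only: A_def B_def add_divide_distrib)
  also have "(z - y / L) + (L * y - z) = y * (L - 1 / L)" by (simp add: field_simps)
  finally have y: "y = A + B" using big_root_diff_nonzero by simp
  have "A * L + B * (1 / L) = ((z - y / L) * L + (L * y - z) * (1 / L)) / (L - 1 / L)"
    by (simp only: A_def B_def add_divide_distrib times_divide_eq_left)
  also have "(z - y / L) * L + (L * y - z) * (1 / L) = z * (L - 1 / L)"
    using big_root_nonzero by (simp add: field_simps)
  finally have z: "z = A * L + B * (1 / L)" using big_root_diff_nonzero by simp
  have step: "(L + 1 / L) * (A * L ^ Suc k + B * (1 / L) ^ Suc k) - (A * L ^ k + B * (1 / L) ^ k)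
      = A * L ^ Suc (Suc k) + B * (1 / L) ^ Suc (Suc k)" for k
    using big_root_nonzero by (simp add: field_simps)
  have "lin_rec t y z k = A * L ^ k + B * (1 / L) ^ k \<and>
        lin_rec t y z (Suc k) = A * L ^ Suc k + B * (1 / L) ^ Suc k"
  proof (induction k)
    case 0
    show ?case using y z by simp
  next
    case (Suc k)
    then show ?case
      using step[of k] by (simp add: big_root_sum del: power_Suc)
  qed
  then show ?thesis by (simp add: A_def B_def)
qed

text \<open>The form is invariant under the recurrence, and its zero set consists of the two
  eigenlines: \<open>L * z = y\<close>, where the sequence decays, and \<open>L * y = z\<close>,
  where the reversed one does.\<close>

lemma norm_form_factor: "(L * z - y) * (L * y - z) = - L * (y\<^sup>2 + z\<^sup>2 - t * y * z)"
proof -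
  have "L * t = L\<^sup>2 + 1"
    using big_root_nonzero unfolding big_root_sum[symmetric] by (simp add: field_simps power2_eq_square)
  then have "L * (t * y * z) = (L\<^sup>2 + 1) * y * z" by (metis mult.assoc)
  then have "- L * (y\<^sup>2 + z\<^sup>2 - t * y * z) = (L\<^sup>2 + 1) * y * z - L * (y\<^sup>2 + z\<^sup>2)"
    by (simp add: algebra_simps)
  then show ?thesis by (simp add: algebra_simps power2_eq_square)
qed

lemma lin_rec_decay:
  assumes "L * z = y"
  shows "lin_rec t y z \<longlonglongrightarrow> 0"
proof -
  have "z = y / L" using assms big_root_nonzero by (auto simp: field_simps)
  then have "lin_rec t y z = (\<lambda>k. (L * y - z) / (L - 1 / L) * (1 / L) ^ k)"
    by (simp add: fun_eq_iff lin_rec_closed)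
  moreover have "(\<lambda>k. (1 / L) ^ k) \<longlonglongrightarrow> 0"
    by (rule LIMSEQ_power_zero[OF norm_inverse_big_root])
  ultimately show ?thesis
    using tendsto_mult_right_zero[of "\<lambda>k. (1 / L) ^ k" sequentially "(L * y - z) / (L - 1 / L)"]
    by simp
qed

section \<open>Limits along a ray off the eigenlines\<close>

context
  fixes y z :: complex
  assumes N: "y\<^sup>2 + z\<^sup>2 - t * y * z \<noteq> 0"
    and nz: "\<And>k. lin_rec t y z k \<noteq> 0"
begin

private definition "A = (z - y / L) / (L - 1 / L)"
private definition "B = (L * y - z) / (L - 1 / L)"
text \<open>With the dominant power factored out, what remains has the nonzero limit
  \<open>A\<close>, so ratios and reciprocals pass to the limit.\<close>

private definition "e k = A + B * ((1 / L)\<^sup>2) ^ k"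

lemma A_nonzero: "A \<noteq> 0"
proof
  assume "A = 0"
  then have "L * z - y = 0"
    using big_root_diff_nonzero big_root_nonzero by (auto simp: A_def field_simps)
  with norm_form_factor[of z y] N big_root_nonzero show False by simp
qed

lemma lin_rec_e: "lin_rec t y z k = L ^ k * e k"
proof -
  have "L ^ k * ((1 / L)\<^sup>2) ^ k = (1 / L) ^ k"
    using big_root_nonzero by (simp add: power_divide power_mult_distrib power2_eq_square)
  then have "L ^ k * e k = A * L ^ k + B * (1 / L) ^ k"
    by (simp add: e_def algebra_simps)
  then show ?thesis by (simp add: lin_rec_closed A_def B_def)
qed

lemma power_tendsto_0: "(\<lambda>k. ((1 / L)\<^sup>2) ^ k) \<longlonglongrightarrow> 0"
proof (rule LIMSEQ_power_zero)
  have "cmod (1 / L) ^ 2 < 1 ^ 2"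
    by (intro power_strict_mono norm_inverse_big_root) auto
  then show "norm ((1 / L)\<^sup>2) < 1" by (simp only: norm_power power_one)
qed

lemma e_tendsto: "e \<longlonglongrightarrow> A"
proof -
  have "(\<lambda>k. A + B * ((1 / L)\<^sup>2) ^ k) \<longlonglongrightarrow> A + B * 0"
    by (intro tendsto_intros power_tendsto_0)
  then show ?thesis by (simp add: e_def[abs_def])
qed

lemma e_nonzero: "e k \<noteq> 0"
  using nz[of k] by (simp add: lin_rec_e)

lemma lin_rec_ratio: "(\<lambda>k. lin_rec t y z (Suc k) / lin_rec t y z k) \<longlonglongrightarrow> L"
proof -
  have "(\<lambda>k. L * (e (Suc k) / e k)) \<longlonglongrightarrow> L * (A / A)"
    by (intro tendsto_intros e_tendsto LIMSEQ_Suc A_nonzero)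
  moreover have "lin_rec t y z (Suc k) / lin_rec t y z k = L * (e (Suc k) / e k)" for k
    unfolding lin_rec_e using big_root_nonzero by simp
  ultimately show ?thesis using A_nonzero by simp
qed

lemma lin_rec_flow:
  "(\<lambda>k. lin_rec t y z k / (t * lin_rec t y z (Suc k))) \<longlonglongrightarrow> (1 - s) / 2"
proof -
  have "(\<lambda>k. inverse t * inverse (lin_rec t y z (Suc k) / lin_rec t y z k))
      \<longlonglongrightarrow> inverse t * inverse L"
    by (intro tendsto_intros lin_rec_ratio big_root_nonzero)
  moreover have "inverse t * inverse L = (1 - s) / 2"
    using trace_nonzero unfolding inverse_eq_divide inverse_big_root by simp
  moreover have "inverse t * inverse (b / a) = a / (t * b)" for a b :: complex
    by (simp add: divide_inverse)
  ultimately show ?thesis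
    by simp
qed

text \<open>The quotients \<open>(1 / L) ^ k / lin_rec t y z k\<close> telescope in steps of two: in
  the numerator of the difference between \<open>k\<close> and \<open>k + 2\<close> the parts with
  \<open>B\<close> cancel, which leaves a constant independent of \<open>k\<close>.\<close>

lemma lin_rec_edge_sums:
  "(\<lambda>k. 1 / (lin_rec t y z k * lin_rec t y z (Suc (Suc k)))) sums
     ((L * z + y) / (t * y * z * (L * z - y)))"
proof -
  define \<tau> where "\<tau> k = (1 / L) ^ k / lin_rec t y z k" for k
  define c where "c = A * (L\<^sup>2 - (1 / L)\<^sup>2)"
  have \<tau>: "\<tau> k = ((1 / L)\<^sup>2) ^ k / e k" for k
    using big_root_nonzero e_nonzero[of k]
    by (simp add: \<tau>_def lin_rec_e field_simps power2_eq_square power_mult_distrib)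
  have "(\<lambda>k. ((1 / L)\<^sup>2) ^ k / e k) \<longlonglongrightarrow> 0 / A"
    by (intro tendsto_intros e_tendsto A_nonzero power_tendsto_0)
  then have lim: "\<tau> \<longlonglongrightarrow> 0" by (simp add: \<tau>[abs_def])
  have diff: "\<tau> k - \<tau> (Suc (Suc k)) = c * (1 / (lin_rec t y z k * lin_rec t y z (Suc (Suc k))))" for k
  proof -
    have "(1 / L) ^ k * lin_rec t y z (Suc (Suc k)) - (1 / L) ^ Suc (Suc k) * lin_rec t y z k = c"
      using big_root_nonzero unfolding lin_rec_closed A_def[symmetric] B_def[symmetric] c_def
      by (simp add: field_simps power2_eq_square)
    then show ?thesis
      using nz[of k] nz[of "Suc (Suc k)"] unfolding \<tau>_def by (simp add: field_simps del: lin_rec.simps power_Suc)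
  qed
  have sq: "L\<^sup>2 - (1 / L)\<^sup>2 = (L - 1 / L) * t"
    unfolding big_root_sum[symmetric] by (simp add: algebra_simps power2_eq_square)
  have c: "c = (z - y / L) * t"
    unfolding c_def sq A_def using big_root_diff_nonzero by simp
  have "c \<noteq> 0"
    unfolding c_def sq using A_nonzero big_root_diff_nonzero trace_nonzero by simp
  \<comment> \<open>Adding two consecutive terms turns steps of two into steps of one.\<close>
  have "(\<lambda>k. (\<tau> (Suc k) + \<tau> (Suc (Suc k))) - (\<tau> k + \<tau> (Suc k))) sums (0 + 0 - (\<tau> 0 + \<tau> (Suc 0)))"
    by (intro telescope_sums tendsto_intros lim LIMSEQ_Suc)
  then have "(\<lambda>k. (- inverse c) * ((\<tau> (Suc k) + \<tau> (Suc (Suc k))) - (\<tau> k + \<tau> (Suc k)))) sums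
      ((- inverse c) * (0 + 0 - (\<tau> 0 + \<tau> (Suc 0))))"
    by (rule sums_mult)
  moreover have "(- inverse c) * ((\<tau> (Suc k) + \<tau> (Suc (Suc k))) - (\<tau> k + \<tau> (Suc k)))
      = 1 / (lin_rec t y z k * lin_rec t y z (Suc (Suc k)))" for k
  proof -
    have "(- inverse c) * ((\<tau> (Suc k) + \<tau> (Suc (Suc k))) - (\<tau> k + \<tau> (Suc k)))
        = inverse c * (\<tau> k - \<tau> (Suc (Suc k)))" by (simp add: algebra_simps)
    also have "\<dots> = 1 / (lin_rec t y z k * lin_rec t y z (Suc (Suc k)))"
      unfolding diff using \<open>c \<noteq> 0\<close> by (simp add: field_simps)
    finally show ?thesis .
  qed
  moreover have "(- inverse c) * (0 + 0 - (\<tau> 0 + \<tau> (Suc 0))) = (L * z + y) / (t * y * z * (L * z - y))"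
  proof -
    have yz: "y \<noteq> 0" "z \<noteq> 0" using nz[of 0] nz[of 1] by simp_all
    have "L * z - y \<noteq> 0"
      using \<open>c \<noteq> 0\<close> big_root_nonzero by (auto simp: c field_simps)
    moreover have "c = t * (L * z - y) / L"
      using big_root_nonzero by (simp add: c field_simps)
    moreover have "\<tau> 0 + \<tau> (Suc 0) = (L * z + y) / (L * y * z)"
      using yz big_root_nonzero by (simp add: \<tau>_def field_simps)
    ultimately show ?thesis
      using yz big_root_nonzero trace_nonzero by simp
  qed
  ultimately show ?thesis by simp
qed

end

text \<open>The fractions belong to the two ends of one geodesic, which start from the same two
  coordinates in opposite order. Their denominators combine through \<open>norm_form_factor\<close>,
  and \<open>L\<close> disappears because \<open>L - 1 / L = t * s\<close>.\<close>

lemma edge_sum_both_ends: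
  assumes N: "y\<^sup>2 + z\<^sup>2 - t * y * z \<noteq> 0" and nz: "y \<noteq> 0" "z \<noteq> 0"
  shows "(L * z + y) / (t * y * z * (L * z - y)) + (L * y + z) / (t * z * y * (L * y - z))
    = - 2 * s / (y\<^sup>2 + z\<^sup>2 - t * y * z)"
proof -
  define M where "M = y\<^sup>2 + z\<^sup>2 - t * y * z"
  have f: "(L * z - y) * (L * y - z) = - L * M"
    using norm_form_factor by (simp add: M_def)
  have ne: "L * z - y \<noteq> 0" "L * y - z \<noteq> 0"
    using f N big_root_nonzero by (auto simp: M_def)
  have ts: "t * s * L = L\<^sup>2 - 1"
    using big_root_diff big_root_nonzero by (simp add: field_simps power2_eq_square)
  have frac: "n1 / (d * p) + n2 / (d * q) = (n1 * q + n2 * p) / (d * (p * q))"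
    if "d \<noteq> 0" "p \<noteq> 0" "q \<noteq> 0" for n1 n2 d p q :: complex
    using that by (simp add: field_simps)
  have "t * z * y = t * y * z" by simp
  then have "(L * z + y) / (t * y * z * (L * z - y)) + (L * y + z) / (t * z * y * (L * y - z))
      = ((L * z + y) * (L * y - z) + (L * y + z) * (L * z - y)) / (t * y * z * ((L * z - y) * (L * y - z)))"
    using frac[of "t * y * z" "L * z - y" "L * y - z"] ne nz trace_nonzero
    by (simp only: mult_eq_0_iff) simp
  also have "(L * z + y) * (L * y - z) + (L * y + z) * (L * z - y) = 2 * (L\<^sup>2 - 1) * (y * z)"
    by (simp add: algebra_simps power2_eq_square)
  also have "2 * (L\<^sup>2 - 1) * (y * z) / (t * y * z * ((L * z - y) * (L * y - z))) = - 2 * s / M"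
  proof -
    have "2 * (t * s * L) * (y * z) = - 2 * s * (- (t * L * y * z))"
      and "t * y * z * (- L * M) = M * (- (t * L * y * z))" by (simp_all add: algebra_simps)
    then show ?thesis
      unfolding f ts[symmetric] using nz trace_nonzero big_root_nonzero by simp
  qed
  finally show ?thesis by (simp add: M_def)
qed

end

section \<open>Counting vectors of geodesics\<close>

text \<open>
  The vector of a geodesic in the coordinates given by the heights (see \<open>height\<close> below) of the
  geodesics through the edge with label \<open>c\<close>: crossing the edge \<open>i\<close> keeps the height of \<open>{c, i}\<close>, and
  the height of \<open>{i, k}\<close> becomes at least the sum of those of \<open>{c, i}\<close> and \<open>{c, k}\<close>.
\<close>

fun gvec :: "'n::finite \<Rightarrow> 'n list \<Rightarrow> 'n \<Rightarrow> 'n \<Rightarrow> 'n \<Rightarrow> nat" where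
  "gvec c [] j k = (\<lambda>l. if l = j \<or> l = k then 1 else 0)"
| "gvec c (i # v) j k = (\<lambda>l. if l = i then \<Sum>m\<in>UNIV. gvec i v j k m
      else if l = c then 0 else gvec i v j k l)"

definition gvec_ok :: "'n \<Rightarrow> 'n list \<Rightarrow> 'n \<Rightarrow> 'n \<Rightarrow> bool" where
  "gvec_ok c v j k \<longleftrightarrow> j \<noteq> k \<and> distinct_adj (c # v @ [j]) \<and> distinct_adj (c # v @ [k])"

lemma gvec_ok_Cons: "gvec_ok c (i # v) j k \<longleftrightarrow> c \<noteq> i \<and> gvec_ok i v j k"
  by (auto simp: gvec_ok_def)

lemma gvec_start: "gvec_ok c v j k \<Longrightarrow> gvec c v j k c = 0"
  by (cases v) (auto simp: gvec_ok_def)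

text \<open>Of two positive entries at most one sits at \<open>c\<close> and is erased, while the
  entry at \<open>i\<close> becomes the total. Two positive entries make each single entry strictly
  smaller than the total, which the decoding in \<open>gvec_inj\<close> depends on.\<close>

lemma gvec_two_positive:
  assumes "gvec_ok c v j k"
  shows "\<exists>p q. p \<noteq> q \<and> gvec c v j k p > 0 \<and> gvec c v j k q > 0"
  using assms
proof (induction v arbitrary: c)
  case Nil
  then have "j \<noteq> k" by (simp add: gvec_ok_def)
  then show ?case by (intro exI[of _ j] exI[of _ k]) simp
next
  case (Cons i v)
  then have ok: "c \<noteq> i" "gvec_ok i v j k" by (simp_all add: gvec_ok_Cons)
  from Cons.IH[OF this(2)] obtain p q where pq: "p \<noteq> q" "gvec i v j k p > 0" "gvec i v j k q > 0"
    by blast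
  have "p \<noteq> i" "q \<noteq> i"
    using pq gvec_start[OF ok(2)] by auto
  moreover have "(\<Sum>m\<in>UNIV. gvec i v j k m) > 0"
    using pq(2) by (metis UNIV_I finite_class.finite_UNIV gr0I less_numeral_extra(3) sum_eq_0_iff)
  moreover have "p \<noteq> c \<or> q \<noteq> c" using pq(1) by blast
  ultimately have "\<exists>p'\<in>{p, q}. p' \<noteq> i \<and> p' \<noteq> c \<and> gvec i v j k p' > 0"
    using pq by blast
  then obtain p' where "p' \<noteq> i" "p' \<noteq> c" "gvec i v j k p' > 0" by blast
  with \<open>(\<Sum>m\<in>UNIV. gvec i v j k m) > 0\<close> show ?case
    by (intro exI[of _ p'] exI[of _ i]) simp
qed

lemma gvec_less_sum:
  assumes "gvec_ok c v j k"
  shows "gvec c v j k l < (\<Sum>m\<in>UNIV. gvec c v j k m)"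
proof -
  obtain p where p: "p \<noteq> l" "gvec c v j k p > 0"
    using gvec_two_positive[OF assms] by metis
  have "gvec c v j k l + gvec c v j k p = (\<Sum>m\<in>{l, p}. gvec c v j k m)"
    using p(1) by simp
  also have "\<dots> \<le> (\<Sum>m\<in>UNIV. gvec c v j k m)"
    by (rule sum_mono2) auto
  finally show ?thesis using p(2) by simp
qed

lemma gvec_Nil_neq_Cons:
  assumes "gvec_ok c [] j k" "gvec_ok c (i # v) j' k'"
  shows "gvec c [] j k \<noteq> gvec c (i # v) j' k'"
proof
  assume eq: "gvec c [] j k = gvec c (i # v) j' k'"
  have ok: "gvec_ok i v j' k'" using assms(2) by (simp add: gvec_ok_Cons)
  obtain p where p: "gvec i v j' k' p > 0"
    using gvec_two_positive[OF ok] by blast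
  then have "1 < (\<Sum>m\<in>UNIV. gvec i v j' k' m)"
    using gvec_less_sum[OF ok, of p] by linarith
  moreover have "gvec c [] j k i = (\<Sum>m\<in>UNIV. gvec i v j' k' m)"
    unfolding eq by simp
  moreover have "gvec c [] j k i \<le> 1" by simp
  ultimately show False by linarith
qed

text \<open>
  The first letter of a nonempty word can be read off from its vector: it is the only coordinate
  that carries at least half of the total.
\<close>

lemma gvec_inj:
  assumes "gvec_ok c v j k" "gvec_ok c v' j' k'" "gvec c v j k = gvec c v' j' k'"
  shows "v = v' \<and> {j, k} = {j', k'}"
  using assms
proof (induction v arbitrary: c v')
  case Nil
  then have "v' = []"
    using gvec_Nil_neq_Cons by (metis neq_Nil_conv)
  moreover have "{j, k} = {l. gvec c [] j k l = 1}" "{j', k'} = {l. gvec c [] j' k' l = 1}"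
    by auto
  ultimately show ?case using Nil by metis
next
  case (Cons i v)
  obtain i' w where v': "v' = i' # w"
    using gvec_Nil_neq_Cons Cons.prems by (metis neq_Nil_conv)
  have ok: "c \<noteq> i" "gvec_ok i v j k" "c \<noteq> i'" "gvec_ok i' w j' k'"
    using Cons.prems by (simp_all add: v' gvec_ok_Cons)
  have eq: "gvec c (i # v) j k l = gvec c (i' # w) j' k' l" for l
    using Cons.prems(3) by (simp add: v')
  \<comment> \<open>Different first letters would make each total equal to an entry of the other
    vector, so each total would be strictly smaller than the other.\<close>
  have "i = i'"
  proof (rule ccontr)
    assume "i \<noteq> i'"
    then have "(\<Sum>m\<in>UNIV. gvec i v j k m) = gvec i' w j' k' i"
      and "(\<Sum>m\<in>UNIV. gvec i' w j' k' m) = gvec i v j k i'"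
      using eq[of i] eq[of i'] ok by simp_all
    then show False
      using gvec_less_sum[OF ok(2), of i'] gvec_less_sum[OF ok(4), of i] by linarith
  qed
  have other: "gvec i v j k l = gvec i w j' k' l" if "l \<noteq> c" for l
  proof (cases "l = i")
    case True
    then show ?thesis using gvec_start[OF ok(2)] gvec_start[OF ok(4)] \<open>i = i'\<close> by simp
  next
    case False
    then show ?thesis using eq[of l] that \<open>i = i'\<close> by simp
  qed
  \<comment> \<open>The crossing has erased the entry at \<open>c\<close>; it is recovered as the
    total, which is kept at place \<open>i\<close>, minus the other entries.\<close>
  moreover have "gvec i v j k c = gvec i w j' k' c"
  proof -
    have "(\<Sum>m\<in>UNIV. gvec i v j k m) = (\<Sum>m\<in>UNIV. gvec i w j' k' m)"
      using eq[of i] \<open>i = i'\<close> by simp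
    moreover have "(\<Sum>m\<in>UNIV - {c}. gvec i v j k m) = (\<Sum>m\<in>UNIV - {c}. gvec i w j' k' m)"
      by (rule sum.cong) (auto intro: other)
    ultimately show ?thesis
      by (simp add: sum.remove[of UNIV c])
  qed
  ultimately have "gvec i v j k = gvec i w j' k'" by (metis ext)
  with Cons.IH[OF ok(2), of w] ok(4) \<open>i = i'\<close> show ?case by (simp add: v')
qed

section \<open>A geometric weight summed over integer vectors\<close>

lemma power_sum_summable:
  fixes r :: real
  assumes r: "0 < r" "r < 1"
  shows "(\<lambda>a :: 'n::finite \<Rightarrow> nat. r ^ (\<Sum>l\<in>UNIV. a l)) summable_on UNIV"
proof (rule nonneg_bdd_above_summable_on)
  show "bdd_above (sum (\<lambda>a :: 'n \<Rightarrow> nat. r ^ (\<Sum>l\<in>UNIV. a l)) ` {F. F \<subseteq> UNIV \<and> finite F})"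
  proof (rule bdd_aboveI2)
    fix F :: "('n \<Rightarrow> nat) set"
    assume "F \<in> {F. F \<subseteq> UNIV \<and> finite F}"
    then have fin: "finite F" by simp
    define N where "N = Max (insert 0 ((\<lambda>(a, l). a l) ` (F \<times> UNIV)))"
    have "a l \<le> N" if "a \<in> F" for a l
      unfolding N_def using fin that by (intro Max_ge) (auto intro!: image_eqI[of _ _ "(a, l)"])
    \<comment> \<open>Over a box the sum factors into one geometric sum per coordinate, bounded
      independently of the size of the box.\<close>
    then have sub: "F \<subseteq> PiE (UNIV :: 'n set) (\<lambda>_. {..N})" by auto
    have "(\<Sum>a\<in>F. r ^ (\<Sum>l\<in>UNIV. a l)) \<le> (\<Sum>a\<in>PiE (UNIV :: 'n set) (\<lambda>_. {..N}). r ^ (\<Sum>l\<in>UNIV. a l))"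
      by (intro sum_mono2 finite_PiE sub) (use r in auto)
    also have "\<dots> = (\<Sum>a\<in>PiE (UNIV :: 'n set) (\<lambda>_. {..N}). \<Prod>l\<in>UNIV. r ^ a l)"
      by (simp add: power_sum)
    also have "\<dots> = (\<Prod>l\<in>(UNIV :: 'n set). \<Sum>m\<le>N. r ^ m)"
      by (rule prod_sum_PiE[symmetric]) auto
    also have "\<dots> \<le> (\<Prod>l\<in>(UNIV :: 'n set). 1 / (1 - r))"
    proof (rule prod_mono)
      have "(\<Sum>m\<le>N. r ^ m) \<le> (\<Sum>m. r ^ m)"
        using r by (intro sum_le_suminf summable_geometric) auto
      also have "\<dots> = 1 / (1 - r)" using r by (intro suminf_geometric) auto
      finally show "0 \<le> (\<Sum>m\<le>N. r ^ m) \<and> (\<Sum>m\<le>N. r ^ m) \<le> 1 / (1 - r)" for l :: 'n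
        using r by (auto intro: sum_nonneg)
    qed
    finally show "(\<Sum>a\<in>F. r ^ (\<Sum>l\<in>UNIV. a l)) \<le> (\<Prod>l\<in>(UNIV :: 'n set). 1 / (1 - r))" .
  qed
qed (use r in auto)

section \<open>Reduced words and alternating words\<close>

definition alt_word :: "'n \<Rightarrow> 'n \<Rightarrow> nat \<Rightarrow> 'n list" where
  "alt_word i j k = map (\<lambda>s. if even s then i else j) [0..<k]"

lemma alt_word_0 [simp]: "alt_word i j 0 = []"
  by (simp add: alt_word_def)

lemma alt_word_Suc: "alt_word i j (Suc k) = alt_word i j k @ [if even k then i else j]"
  by (simp add: alt_word_def)

lemma length_alt_word [simp]: "length (alt_word i j k) = k"
  by (simp add: alt_word_def)

lemma set_alt_word: "set (alt_word i j k) \<subseteq> {i, j}"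
  by (auto simp: alt_word_def)

lemma hd_alt_word [simp]: "hd (alt_word i j (Suc k)) = i"
  by (simp add: alt_word_def upt_conv_Cons del: upt_Suc)

lemma distinct_adj_alt_word: "i \<noteq> j \<Longrightarrow> distinct_adj (alt_word i j k)"
  by (simp add: distinct_adj_conv_nth alt_word_def)

lemma distinct_adj_append_alt_word:
  assumes "i \<noteq> j" "distinct_adj (u @ [i])"
  shows "distinct_adj (u @ alt_word i j k)"
  using assms distinct_adj_alt_word[OF assms(1), of k]
  by (cases k) (auto simp: distinct_adj_append_iff)

lemma alt_word_unique:
  assumes "i \<noteq> j" "distinct_adj v" "set v \<subseteq> {i, j}" "v = [] \<or> hd v = i"
  shows "v = alt_word i j (length v)"
  using assms(2-)
proof (induction v rule: rev_induct)
  case (snoc x v)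
  have v: "v = alt_word i j (length v)"
  proof (rule snoc.IH)
    show "distinct_adj v" "set v \<subseteq> {i, j}"
      using snoc.prems by auto
    show "v = [] \<or> hd v = i"
      using snoc.prems(3) by (cases v) auto
  qed
  show ?case
  proof (cases "length v")
    case 0
    then show ?thesis using snoc.prems by (simp add: alt_word_Suc)
  next
    case (Suc n)
    have "last (alt_word i j (length v)) = (if even n then i else j)"
      by (simp add: Suc alt_word_Suc)
    then have "last v = (if even n then i else j)"
      using v by metis
    moreover have "last v \<noteq> x" "x \<in> {i, j}"
      using snoc.prems Suc by (auto simp: distinct_adj_append_iff)
    ultimately have "x = (if even (length v) then i else j)"
      using Suc by auto
    then have "alt_word i j (length (v @ [x])) = v @ [x]"
      by (simp add: alt_word_Suc flip: v)
    then show ?thesis by (rule sym)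
  qed
qed simp

text \<open>For reduced \<open>w\<close> and \<open>S = {i, j}\<close> this is the vertex nearest
  the root on the geodesic with labels \<open>i\<close>, \<open>j\<close> through
  \<open>w\<close>.\<close>

definition strip :: "'n set \<Rightarrow> 'n list \<Rightarrow> 'n list" where
  "strip S w = rev (dropWhile (\<lambda>x. x \<in> S) (rev w))"

lemma strip_Nil [simp]: "strip S [] = []"
  by (simp add: strip_def)

lemma strip_snoc [simp]: "strip S (w @ [i]) = (if i \<in> S then strip S w else w @ [i])"
  by (simp add: strip_def)

lemma strip_append: "set v \<subseteq> S \<Longrightarrow> strip S (w @ v) = strip S w"
  by (induction v rule: rev_induct) (auto simp flip: append_assoc)

lemma strip_id: "w = [] \<or> last w \<notin> S \<Longrightarrow> strip S w = w"
  by (cases w rule: rev_cases) auto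

lemma strip_decomp: "\<exists>v. w = strip S w @ v \<and> set v \<subseteq> S"
proof (induction w rule: rev_induct)
  case (snoc x w)
  then obtain v where v: "w = strip S w @ v" "set v \<subseteq> S" by blast
  show ?case
  proof (cases "x \<in> S")
    case True
    have "w @ [x] = strip S w @ (v @ [x])"
      using v(1) by (metis append_assoc)
    then show ?thesis
      using True v(2) by (intro exI[of _ "v @ [x]"]) simp
  qed simp
qed simp

lemma last_strip: "strip S w = [] \<or> last (strip S w) \<notin> S"
  by (induction w rule: rev_induct) auto

text \<open>
  A branch \<open>(u, i, j)\<close> is the end \<open>u, ui, uij, uiji, \<dots>\<close> of the alternating geodesic with labels
  \<open>i, j\<close> whose vertex closest to the root is \<open>u\<close>; every geodesic has two of them.
\<close>

definition branches :: "('n list \<times> 'n \<times> 'n) set" where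
  "branches = {(u, i, j). i \<noteq> j \<and> distinct_adj (u @ [i]) \<and> distinct_adj (u @ [j])}"

lemma branchesD:
  assumes "(u, i, j) \<in> branches"
  shows "i \<noteq> j" "distinct_adj u" "distinct_adj (u @ [i])" "distinct_adj (u @ [j])"
    "distinct_adj (u @ alt_word i j k)" "strip {i, j} u = u"
    "strip {i, j} (u @ alt_word i j k) = u"
proof -
  show *: "i \<noteq> j" "distinct_adj u" "distinct_adj (u @ [i])" "distinct_adj (u @ [j])"
    using assms by (auto simp: branches_def)
  then show "distinct_adj (u @ alt_word i j k)"
    by (intro distinct_adj_append_alt_word)
  show "strip {i, j} u = u"
    using * by (intro strip_id) (auto simp: distinct_adj_append_iff)
  then show "strip {i, j} (u @ alt_word i j k) = u"
    by (simp add: strip_append[OF set_alt_word])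
qed

lemma branches_swap: "(u, i, j) \<in> branches \<Longrightarrow> (u, j, i) \<in> branches"
  by (auto simp: branches_def)

lemma branches_strip:
  assumes "distinct_adj w" "i \<noteq> j"
  shows "(strip {i, j} w, i, j) \<in> branches"
proof -
  obtain v where "w = strip {i, j} w @ v"
    using strip_decomp by metis
  then have "distinct_adj (strip {i, j} w)"
    using assms(1) by (metis distinct_adj_appendD1)
  then show ?thesis
    using last_strip[of "{i, j}" w] assms(2) by (auto simp: branches_def distinct_adj_append_iff)
qed

lemma finite_short_words: "finite {w :: 'n::finite list. length w \<le> m}"
  using finite_lists_length_le[of "UNIV :: 'n set" m] by simp

lemma finite_short_branches: "finite {(u, i, j) \<in> branches. length (u :: 'n::finite list) < m}"
  by (rule finite_subset[of _ "{u. length u \<le> m} \<times> UNIV \<times> UNIV"])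
    (auto simp: finite_short_words)

section \<open>Edges together with a geodesic through them\<close>

definition branch_edge :: "('n list \<times> 'n \<times> 'n) \<times> nat \<Rightarrow> 'n list \<times> 'n" where
  "branch_edge = (\<lambda>((u, i, j), k). (u @ alt_word i j (Suc k), (if even k then j else i)))"

text \<open>The edge ends at \<open>w\<close> and has label \<open>last w\<close>; the mark
  \<open>l\<close> is the other label of a geodesic through it, so there are
  \<open>CARD('n) - 1\<close> marks per edge.\<close>

definition marked_edges :: "('n list \<times> 'n) set" where
  "marked_edges = {(w, l). w \<noteq> [] \<and> distinct_adj w \<and> l \<noteq> last w}"

lemma branch_edge_surj:
  assumes "w \<noteq> []" "distinct_adj w" "l \<noteq> last w"
  shows "\<exists>u i j k. (u, i, j) \<in> branches \<and> {i, j} = {last w, l} \<and> u = strip {last w, l} w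
    \<and> w = u @ alt_word i j (Suc k) \<and> l = (if even k then j else i)"
proof -
  define S where "S = {last w, l}"
  define u where "u = strip S w"
  obtain v where v: "w = u @ v" "set v \<subseteq> S"
    using strip_decomp u_def by metis
  have "v \<noteq> []"
  proof
    assume "v = []"
    then have "strip S w = w" using v u_def by simp
    then show False using last_strip[of S w] assms(1) by (simp add: S_def)
  qed
  define i where "i = hd v"
  have "i \<in> S" using v \<open>v \<noteq> []\<close> hd_in_set i_def by blast
  have "\<exists>j. S = {i, j} \<and> i \<noteq> j"
    using \<open>i \<in> S\<close> assms(3) unfolding S_def by (metis insertE insert_commute singletonD)
  then obtain j where j: "S = {i, j}" "i \<noteq> j" by blast
  obtain k where k: "length v = Suc k" using \<open>v \<noteq> []\<close> by (cases v) auto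
  have "distinct_adj v"
    using assms(2) v(1) distinct_adj_appendD2 by metis
  moreover have "set v \<subseteq> {i, j}"
    using v(2) j(1) by metis
  moreover have "v = [] \<or> hd v = i"
    by (simp add: i_def)
  ultimately have valt: "v = alt_word i j (Suc k)"
    using alt_word_unique[OF j(2)] k by metis
  have "last v = (if even k then i else j)"
    by (subst valt) (simp add: alt_word_Suc)
  then have last: "last w = (if even k then i else j)"
    using v(1) \<open>v \<noteq> []\<close> by simp
  have br: "(u, i, j) \<in> branches"
    using branches_strip[OF assms(2) j(2)] unfolding u_def j(1) .
  have "l \<in> {i, j}"
    unfolding j(1)[symmetric] S_def by simp
  then have l: "l = (if even k then j else i)"
    using last assms(3) by (auto split: if_splits)
  have w: "w = u @ alt_word i j (Suc k)" using v(1) valt by metis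
  have S: "{i, j} = {last w, l}" "u = strip {last w, l} w"
    unfolding u_def S_def[symmetric] by (rule j(1)[symmetric] refl)+
  show ?thesis
    by (rule exI[of _ u], rule exI[of _ i], rule exI[of _ j], rule exI[of _ k], intro conjI br S w l)
qed

text \<open>An edge and a second label determine a geodesic; as edges point away from the root, the
  edge lies on one definite end of it, at one position. Both the double count of edges and the
  passage from words to branches rest on this.\<close>

lemma branch_edge_bij: "bij_betw branch_edge (branches \<times> UNIV) marked_edges"
proof (rule bij_betwI')
  fix x y :: "('a list \<times> 'a \<times> 'a) \<times> nat"
  assume xy: "x \<in> branches \<times> UNIV" "y \<in> branches \<times> UNIV"
  obtain u i j k u' i' j' k' where x: "x = ((u, i, j), k)" and y: "y = ((u', i', j'), k')"
    by (metis surj_pair)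
  show "branch_edge x = branch_edge y \<longleftrightarrow> x = y"
  proof
    assume "branch_edge x = branch_edge y"
    then have w: "u @ alt_word i j (Suc k) = u' @ alt_word i' j' (Suc k')"
      and l: "(if even k then j else i) = (if even k' then j' else i')"
      by (auto simp: branch_edge_def x y)
    have "last (u @ alt_word i j (Suc k)) = last (u' @ alt_word i' j' (Suc k'))"
      using w by simp
    then have "(if even k then i else j) = (if even k' then i' else j')"
      by (simp add: alt_word_Suc)
    with l have S: "{i, j} = {i', j'}" by (auto split: if_splits)
    have u: "u = u'"
    proof -
      have "strip {i, j} (u @ alt_word i j (Suc k)) = u"
        "strip {i', j'} (u' @ alt_word i' j' (Suc k')) = u'"
        using xy x y by (auto intro: branchesD(7))
      then show ?thesis unfolding w S by simp
    qed
    then have alt: "alt_word i j (Suc k) = alt_word i' j' (Suc k')" using w by simp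
    then have "k = k'" by (metis length_alt_word nat.inject)
    moreover have "i = i'" using alt by (metis hd_alt_word)
    moreover have "j = j'"
      using l \<open>k = k'\<close> \<open>i = i'\<close> S by (auto split: if_splits simp: doubleton_eq_iff)
    ultimately show "x = y" using u x y by simp
  qed simp
next
  fix x :: "('a list \<times> 'a \<times> 'a) \<times> nat"
  assume "x \<in> branches \<times> UNIV"
  then obtain u i j k where x: "x = ((u, i, j), k)" "(u, i, j) \<in> branches" by auto
  show "branch_edge x \<in> marked_edges"
    using branchesD(1)[OF x(2)] branchesD(5)[OF x(2), of "Suc k"]
    by (auto simp: x branch_edge_def marked_edges_def alt_word_Suc)
next
  fix y :: "'a list \<times> 'a"
  assume "y \<in> marked_edges"
  then obtain w l where y: "y = (w, l)" "w \<noteq> []" "distinct_adj w" "l \<noteq> last w"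
    by (cases y) (auto simp: marked_edges_def)
  from branch_edge_surj[OF y(2-4)] obtain u i j k where *:
    "(u, i, j) \<in> branches" "w = u @ alt_word i j (Suc k)" "l = (if even k then j else i)"
    by metis
  have "y = branch_edge ((u, i, j), k)"
    unfolding y(1) by (simp add: branch_edge_def flip: *(2,3))
  then show "\<exists>x\<in>branches \<times> UNIV. y = branch_edge x"
    using *(1) by blast
qed

section \<open>The action along words\<close>

definition qprod :: "'n::finite \<Rightarrow> complex ^ 'n \<Rightarrow> complex" where
  "qprod i x = (\<Prod>k\<in>UNIV - {i}. x $ k)"

definition phi_at :: "'n::finite \<Rightarrow> 'n \<Rightarrow> complex ^ 'n \<Rightarrow> complex" where
  "phi_at i j x = (\<Prod>k\<in>UNIV - {i, j}. x $ k)"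

definition sigma_at :: "'n::finite \<Rightarrow> 'n \<Rightarrow> complex ^ 'n \<Rightarrow> complex" where
  "sigma_at i j x = (\<Sum>k\<in>UNIV - {i, j}. (x $ k)\<^sup>2)"

definition markoff :: "complex ^ 'n::finite \<Rightarrow> complex" where
  "markoff x = (\<Sum>k\<in>UNIV. (x $ k)\<^sup>2) - (\<Prod>k\<in>UNIV. x $ k)"

lemma phi_at_commute: "phi_at i j x = phi_at j i x"
  by (simp add: phi_at_def insert_commute)

lemma qprod_eq: "i \<noteq> j \<Longrightarrow> qprod i x = x $ j * phi_at i j x"
proof -
  assume "i \<noteq> j"
  moreover have "UNIV - {i, j} = (UNIV - {i}) - {j}" by auto
  ultimately show ?thesis
    unfolding qprod_def phi_at_def by (simp add: prod.remove[of _ j])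
qed

lemma prod_eq_qprod: "(\<Prod>k\<in>UNIV. x $ k) = x $ i * qprod i x"
  unfolding qprod_def by (simp add: prod.remove[of _ i])

lemma phi_at_eq_rest:
  "distinct [i, j, k] \<Longrightarrow> phi_at i k x = x $ j * (\<Prod>l\<in>UNIV - {i, j, k}. x $ l)"
proof -
  assume d: "distinct [i, j, k]"
  have "UNIV - {i, j, k} = (UNIV - {i, k}) - {j}" by auto
  then show ?thesis
    using d prod.remove[of "UNIV - {i, k}" j "($) x"] unfolding phi_at_def by auto
qed

lemma vieta_same: "vieta i x $ i = qprod i x - x $ i"
  by (simp add: vieta_def qprod_def)

lemma vieta_other: "k \<noteq> i \<Longrightarrow> vieta i x $ k = x $ k"
  by (simp add: vieta_def)

lemma qprod_vieta [simp]: "qprod i (vieta i x) = qprod i x"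
  unfolding qprod_def by (rule prod.cong) (auto simp: vieta_other)

lemma phi_at_vieta: "l \<in> {i, j} \<Longrightarrow> phi_at i j (vieta l x) = phi_at i j x"
  unfolding phi_at_def by (rule prod.cong) (auto simp: vieta_other)

lemma sigma_at_vieta: "l \<in> {i, j} \<Longrightarrow> sigma_at i j (vieta l x) = sigma_at i j x"
  unfolding sigma_at_def by (rule sum.cong) (auto simp: vieta_other)

lemma markoff_eq: "markoff x = (x $ i)\<^sup>2 - x $ i * qprod i x + (\<Sum>k\<in>UNIV - {i}. (x $ k)\<^sup>2)"
  unfolding markoff_def prod_eq_qprod[of _ i] by (simp add: sum.remove[of _ i])

lemma markoff_vieta: "markoff (vieta i x) = markoff x"
proof -
  have "(\<Sum>k\<in>UNIV - {i}. (vieta i x $ k)\<^sup>2) = (\<Sum>k\<in>UNIV - {i}. (x $ k)\<^sup>2)"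
    by (rule sum.cong) (auto simp: vieta_other)
  then show ?thesis
    unfolding markoff_eq[of _ i] by (simp add: vieta_same algebra_simps power2_eq_square)
qed

text \<open>With all but two coordinates fixed, the level equation becomes the invariant form of the
  recurrence with trace \<phi>. This is how \<sigma> - \<mu> enters the summand.\<close>

lemma markoff_binary_form:
  assumes "i \<noteq> j"
  shows "(x $ i)\<^sup>2 + (x $ j)\<^sup>2 - phi_at i j x * x $ i * x $ j = markoff x - sigma_at i j x"
proof -
  have "UNIV - {i, j} = (UNIV - {i}) - {j}" by auto
  then have "(\<Sum>k\<in>UNIV - {i}. (x $ k)\<^sup>2) = (x $ j)\<^sup>2 + sigma_at i j x"
    using assms unfolding sigma_at_def by (simp add: sum.remove[of _ j])
  then show ?thesis
    unfolding markoff_eq[of _ i] using qprod_eq[OF assms, of x] by (simp add: algebra_simps)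
qed

text \<open>Letters act from left to right, so that appending a letter, which crosses an edge,
  applies one more move last; \<open>Phi_eq_walk\<close> identifies the result with
  \<open>Phi\<close>.\<close>

definition walk :: "complex ^ 'n::finite \<Rightarrow> 'n list \<Rightarrow> complex ^ 'n" where
  "walk a w = foldl (\<lambda>x i. vieta i x) a w"

lemma walk_Nil [simp]: "walk a [] = a"
  by (simp add: walk_def)

lemma walk_snoc: "walk a (w @ [i]) = vieta i (walk a w)"
  by (simp add: walk_def)

lemma markoff_walk: "markoff (walk a w) = markoff a"
  by (induction w rule: rev_induct) (simp_all add: walk_snoc markoff_vieta)

lemma walk_append_pair:
  assumes "set v \<subseteq> {i, j}"
  shows "phi_at i j (walk a (u @ v)) = phi_at i j (walk a u)"
    and "sigma_at i j (walk a (u @ v)) = sigma_at i j (walk a u)"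
    and "k \<notin> {i, j} \<Longrightarrow> walk a (u @ v) $ k = walk a u $ k"
  using assms
  by (induction v rule: rev_induct)
    (auto simp: walk_snoc phi_at_vieta sigma_at_vieta vieta_other simp flip: append_assoc)

lemma phi_at_strip: "phi_at i j (walk a (strip {i, j} w)) = phi_at i j (walk a w)"
  using strip_decomp[of w "{i, j}"] walk_append_pair(1)[of _ i j a "strip {i, j} w"] by metis

text \<open>Each crossing replaces the older of the two moving coordinates by the next term of the
  recurrence; the parity of \<open>k\<close> tells which one is the older.\<close>

lemma walk_alt_word:
  fixes a :: "complex ^ 'n::finite" and u :: "'n list"
  assumes "i \<noteq> j"
  defines "y \<equiv> lin_rec (phi_at i j (walk a u)) (walk a u $ i) (walk a u $ j)"
  shows "walk a (u @ alt_word i j k) $ (if even k then i else j) = y k"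
    and "walk a (u @ alt_word i j k) $ (if even k then j else i) = y (Suc k)"
proof (induction k)
  case 0
  case 1
  show ?case by (simp add: y_def)
  case 2
  show ?case by (simp add: y_def)
next
  case (Suc k)
  let ?x = "walk a (u @ alt_word i j k)"
  let ?p = "if even k then i else j" and ?q = "if even k then j else i"
  have pq: "?p \<noteq> ?q" using assms(1) by simp
  have new: "walk a (u @ alt_word i j (Suc k)) = vieta ?p ?x"
    by (simp only: alt_word_Suc append_assoc[symmetric] walk_snoc)
  have phi: "phi_at i j ?x = phi_at i j (walk a u)"
    by (rule walk_append_pair(1)[OF set_alt_word])
  have "qprod ?p ?x = ?x $ ?q * phi_at ?p ?q ?x"
    by (rule qprod_eq[OF pq])
  also have "phi_at ?p ?q ?x = phi_at i j (walk a u)"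
    using phi by (simp add: phi_at_commute)
  finally have q: "qprod ?p ?x = ?x $ ?q * phi_at i j (walk a u)" .
  case 1
  have "vieta ?p ?x $ ?q = ?x $ ?q" using pq by (intro vieta_other) auto
  then show ?case using Suc(2) new by auto
  case 2
  have "vieta ?p ?x $ ?p = y (Suc (Suc k))"
    unfolding vieta_same q Suc by (simp add: y_def)
  then show ?case using new by auto
qed

section \<open>Growth away from the root\<close>

definition ray :: "complex ^ 'n::finite \<Rightarrow> 'n \<Rightarrow> 'n \<Rightarrow> nat \<Rightarrow> complex" where
  "ray x i j = lin_rec (phi_at i j x) (x $ i) (x $ j)"

definition grows :: "complex ^ 'n::finite \<Rightarrow> 'n list \<Rightarrow> bool" where
  "grows a w \<longleftrightarrow> cmod (walk a (butlast w) $ last w) \<le> cmod (walk a w $ last w)"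

lemma grows_snoc: "grows a (w @ [i]) \<longleftrightarrow> cmod (walk a w $ i) \<le> cmod (walk a (w @ [i]) $ i)"
  by (simp add: grows_def)

lemma norm_qprod_le: "cmod (qprod i (walk a w)) \<le> cmod (walk a w $ i) + cmod (walk a (w @ [i]) $ i)"
proof -
  have "qprod i (walk a w) = walk a w $ i + walk a (w @ [i]) $ i"
    by (simp add: walk_snoc vieta_same)
  then show ?thesis by (metis norm_triangle_ineq)
qed

text \<open>The domain enters the estimates only through these bounds. Read contrapositively, the
  last one says that every geodesic with |\<phi>| \<le> K has its vertex nearest the root at depth
  below \<open>m0\<close>.\<close>

locale hurwitz_walk =
  fixes a :: "complex ^ 'n::finite" and \<mu> :: complex and K \<epsilon> :: real and m0 :: nat
  assumes card: "CARD('n) \<ge> 3"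
    and markoff_a: "markoff a = \<mu>"
    and K: "K > 2" and eps: "\<epsilon> > 0"
    and phi_notin: "distinct_adj w \<Longrightarrow> i \<noteq> j \<Longrightarrow> phi_at i j (walk a w) \<notin> complex_of_real ` {-2..2}"
    and phi_ge: "distinct_adj w \<Longrightarrow> i \<noteq> j \<Longrightarrow> \<epsilon> \<le> cmod (phi_at i j (walk a w))"
    and phi_gt: "(u, i, j) \<in> branches \<Longrightarrow> m0 \<le> length u \<Longrightarrow> K < cmod (phi_at i j (walk a u))"
begin

abbreviation X :: "'n list \<Rightarrow> complex ^ 'n" where "X \<equiv> walk a"

lemma third_letter: "\<exists>k :: 'n. k \<noteq> i \<and> k \<noteq> j"
proof -
  have "card {i, j} < card (UNIV :: 'n set)"
    using card card_insert_le_m1[of 2 "{j}" i] by (simp add: card_insert_if split: if_splits)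
  then have "{i, j} \<noteq> UNIV" by auto
  then show ?thesis by blast
qed

lemma two_other_letters: "\<exists>i j :: 'n. i \<noteq> j \<and> i \<noteq> k \<and> j \<noteq> k"
  using third_letter[of k k] third_letter by metis

lemma walk_nonzero:
  assumes "distinct_adj w"
  shows "X w $ k \<noteq> 0"
proof -
  obtain i j where ij: "i \<noteq> j" "i \<noteq> k" "j \<noteq> k" using two_other_letters by blast
  have "phi_at i j (X w) \<noteq> 0"
    using phi_ge[OF assms ij(1)] eps by auto
  then show ?thesis
    using ij by (auto simp: phi_at_def)
qed

lemma
  assumes "(u, i, j) \<in> branches"
  shows ray_next: "X (u @ alt_word i j k) $ (if even k then i else j) = ray (X u) i j k"
    and ray_other: "X (u @ alt_word i j k) $ (if even k then j else i) = ray (X u) i j (Suc k)"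
    and ray_nonzero: "ray (X u) i j k \<noteq> 0"
proof -
  note br = branchesD(1,5)[OF assms]
  show 1: "X (u @ alt_word i j k) $ (if even k then i else j) = ray (X u) i j k"
    and "X (u @ alt_word i j k) $ (if even k then j else i) = ray (X u) i j (Suc k)"
    using walk_alt_word[OF br(1), of a u k] by (simp_all only: ray_def)
  show "ray (X u) i j k \<noteq> 0"
    unfolding 1[symmetric] by (rule walk_nonzero[OF br(2)])
qed

text \<open>For a third label \<open>l\<close>, each vertex of the ray lies on a geodesic whose
  \<phi> is the newer moving coordinate times the constant \<open>C\<close>. A decaying ray would
  push these values below \<epsilon>.\<close>

lemma no_decaying_ray:
  assumes br: "(u, i, j) \<in> branches"
  shows "\<not> ray (X u) i j \<longlonglongrightarrow> 0"
proof
  assume lim: "ray (X u) i j \<longlonglongrightarrow> 0"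
  obtain l where l: "l \<noteq> i" "l \<noteq> j" using third_letter by blast
  define C where "C = (\<Prod>m\<in>UNIV - {i, j, l}. X u $ m)"
  have "\<epsilon> \<le> cmod (ray (X u) i j (Suc k) * C)" for k
  proof -
    let ?w = "u @ alt_word i j k"
    let ?p = "if even k then i else j" and ?q = "if even k then j else i"
    have d: "distinct [?p, ?q, l]" using branchesD(1)[OF br] l by auto
    have "{?p, ?q, l} = {i, j, l}" by auto
    moreover have "(\<Prod>m\<in>UNIV - {i, j, l}. X ?w $ m) = C"
      unfolding C_def using set_alt_word[of i j k]
      by (intro prod.cong) (auto intro!: walk_append_pair(3)[of _ i j])
    ultimately have "phi_at ?p l (X ?w) = ray (X u) i j (Suc k) * C"
      using phi_at_eq_rest[OF d, of "X ?w"] ray_other[OF br, of k] by simp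
    then show ?thesis
      using phi_ge[OF branchesD(5)[OF br], of ?p l k] d by auto
  qed
  moreover have "(\<lambda>k. cmod (ray (X u) i j (Suc k) * C)) \<longlonglongrightarrow> cmod (0 * C)"
    by (intro tendsto_intros LIMSEQ_Suc lim)
  ultimately have "\<epsilon> \<le> cmod (0 * C)"
    by (intro LIMSEQ_le_const) auto
  then show False using eps by simp
qed

text \<open>If the form vanished, one of the two ends would start on the contracting eigenline and
  decay. Together the claims give \<sigma> \<noteq> \<mu>, so the denominator in the summand is
  nonzero.\<close>

lemma
  assumes br: "(u, i, j) \<in> branches"
  shows form_nonzero: "(X u $ i)\<^sup>2 + (X u $ j)\<^sup>2 - phi_at i j (X u) * X u $ i * X u $ j \<noteq> 0"
    and form_eq: "(X u $ i)\<^sup>2 + (X u $ j)\<^sup>2 - phi_at i j (X u) * X u $ i * X u $ j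
      = \<mu> - sigma_at i j (X u)"
proof -
  define t where "t = phi_at i j (X u)"
  define L where "L = big_root t"
  note ij = branchesD(1,2)[OF br]
  have t: "t \<notin> complex_of_real ` {-2..2}"
    unfolding t_def using phi_notin ij by blast
  note roots = norm_form_factor[OF t refl refl] big_root_nonzero[OF t refl refl]
    lin_rec_decay[OF t refl refl]
  have no: "L * z \<noteq> y" if "z = X u $ j \<and> y = X u $ i \<or> z = X u $ i \<and> y = X u $ j" for y z
  proof
    assume "L * z = y"
    then have "lin_rec t y z \<longlonglongrightarrow> 0"
      using roots(3) L_def by blast
    then have "ray (X u) i j \<longlonglongrightarrow> 0 \<or> ray (X u) j i \<longlonglongrightarrow> 0"
      using that unfolding ray_def t_def by (auto simp: phi_at_commute)
    then show False
      using no_decaying_ray[OF br] no_decaying_ray[OF branches_swap[OF br]] by blast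
  qed
  show "(X u $ i)\<^sup>2 + (X u $ j)\<^sup>2 - phi_at i j (X u) * X u $ i * X u $ j \<noteq> 0"
  proof
    assume zero: "(X u $ i)\<^sup>2 + (X u $ j)\<^sup>2 - phi_at i j (X u) * X u $ i * X u $ j = 0"
    have "(L * X u $ j - X u $ i) * (L * X u $ i - X u $ j) = 0"
      using roots(1)[of "X u $ j" "X u $ i"] unfolding t_def zero L_def by simp
    then show False using no by simp
  qed
  show "(X u $ i)\<^sup>2 + (X u $ j)\<^sup>2 - phi_at i j (X u) * X u $ i * X u $ j = \<mu> - sigma_at i j (X u)"
    using markoff_binary_form[OF ij(1), of "X u"] by (simp add: markoff_walk markoff_a)
qed

lemma ray_eventually_grows:
  assumes br: "(u, i, j) \<in> branches"
  shows "\<exists>k0 \<delta>. \<delta> > 0 \<and> (\<forall>k\<ge>k0. exp \<delta> * cmod (ray (X u) i j k) \<le> cmod (ray (X u) i j (Suc k)))"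
proof -
  define t where "t = phi_at i j (X u)"
  define L where "L = big_root t"
  have t: "t \<notin> complex_of_real ` {-2..2}"
    unfolding t_def using phi_notin branchesD(1,2)[OF br] by blast
  have "(\<lambda>k. ray (X u) i j (Suc k) / ray (X u) i j k) \<longlonglongrightarrow> L"
    using lin_rec_ratio[OF t refl L_def, of "X u $ i" "X u $ j"] form_nonzero[OF br] ray_nonzero[OF br]
    by (simp add: ray_def t_def)
  then have lim: "(\<lambda>k. cmod (ray (X u) i j (Suc k) / ray (X u) i j k)) \<longlonglongrightarrow> cmod L"
    by (rule tendsto_norm)
  \<comment> \<open>The growth factor \<open>exp \<delta>\<close> is put midway between 1 and the
    limit of the ratios.\<close>
  define \<delta> where "\<delta> = ln ((1 + cmod L) / 2)"
  have L: "cmod L > 1" unfolding L_def by (rule norm_big_root[OF t refl refl])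
  then have "\<delta> > 0" "exp \<delta> < cmod L" by (auto simp: \<delta>_def)
  from order_tendstoD(1)[OF lim this(2)]
  obtain k0 where k0: "\<And>k. k \<ge> k0 \<Longrightarrow> exp \<delta> < cmod (ray (X u) i j (Suc k) / ray (X u) i j k)"
    by (auto simp: eventually_sequentially)
  have "exp \<delta> * cmod (ray (X u) i j k) \<le> cmod (ray (X u) i j (Suc k))" if "k \<ge> k0" for k
    using k0[OF that] ray_nonzero[OF br, of k] by (simp add: norm_divide field_simps)
  then show ?thesis using \<open>\<delta> > 0\<close> by blast
qed

lemma short_rays_grow:
  "\<exists>k0 \<delta>. \<delta> > 0 \<and> (\<forall>u i j. (u, i, j) \<in> branches \<longrightarrow> length u < m0 \<longrightarrow>
     (\<forall>k\<ge>k0. exp \<delta> * cmod (ray (X u) i j k) \<le> cmod (ray (X u) i j (Suc k))))"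
proof -
  define B :: "('n list \<times> 'n \<times> 'n) set" where "B = {(u, i, j) \<in> branches. length u < m0}"
  have fin: "finite B" unfolding B_def by (rule finite_short_branches)
  have "\<forall>b\<in>B. \<exists>k0 \<delta>. \<delta> > 0 \<and> (\<forall>k\<ge>k0. exp \<delta> * cmod (ray (X (fst b)) (fst (snd b)) (snd (snd b)) k)
      \<le> cmod (ray (X (fst b)) (fst (snd b)) (snd (snd b)) (Suc k)))"
    using ray_eventually_grows by (fastforce simp: B_def)
  then obtain kf df where f: "\<forall>b\<in>B. df b > (0 :: real) \<and>
      (\<forall>k\<ge>kf b. exp (df b) * cmod (ray (X (fst b)) (fst (snd b)) (snd (snd b)) k)
      \<le> cmod (ray (X (fst b)) (fst (snd b)) (snd (snd b)) (Suc k)))"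
    by metis
  define k0 where "k0 = Max (insert 0 (kf ` B))"
  define \<delta> where "\<delta> = Min (insert 1 (df ` B))"
  have "\<delta> > 0" using fin f by (auto simp: \<delta>_def)
  moreover have "exp \<delta> * cmod (ray (X u) i j k) \<le> cmod (ray (X u) i j (Suc k))"
    if "(u, i, j) \<in> branches" "length u < m0" "k \<ge> k0" for u i j k
  proof -
    have b: "(u, i, j) \<in> B" using that by (auto simp: B_def)
    then have "kf (u, i, j) \<le> k0" "\<delta> \<le> df (u, i, j)"
      using fin by (auto simp: k0_def \<delta>_def)
    then have "exp \<delta> * cmod (ray (X u) i j k) \<le> exp (df (u, i, j)) * cmod (ray (X u) i j k)"
      by (intro mult_right_mono) auto
    also have "\<dots> \<le> cmod (ray (X u) i j (Suc k))"
      using f b that(3) \<open>kf (u, i, j) \<le> k0\<close> by fastforce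
    finally show ?thesis .
  qed
  ultimately show ?thesis by blast
qed

text \<open>This concerns the far parts of geodesics based near the root, the only ones where
  |\<phi>| \<le> K can happen. The three moduli compared are consecutive terms of the
  recurrence.\<close>

definition tail_growth :: "nat \<Rightarrow> real \<Rightarrow> bool" where
  "tail_growth k0 \<delta> \<longleftrightarrow> \<delta> > 0 \<and> (\<forall>w c i. distinct_adj (w @ [c, i]) \<longrightarrow> k0 \<le> length w \<longrightarrow>
     length (strip {c, i} w) < m0 \<longrightarrow>
       exp \<delta> * cmod (X (w @ [c]) $ i) \<le> cmod (X (w @ [c]) $ c) \<and>
       exp \<delta> * cmod (X (w @ [c]) $ c) \<le> cmod (X (w @ [c, i]) $ i))"

lemma tail_growthI: "\<exists>k0 \<delta>. tail_growth k0 \<delta>"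
proof -
  obtain k1 \<delta> where \<delta>: "\<delta> > 0" and g: "\<And>u i j k. (u, i, j) \<in> branches \<Longrightarrow> length u < m0 \<Longrightarrow>
     k \<ge> k1 \<Longrightarrow> exp \<delta> * cmod (ray (X u) i j k) \<le> cmod (ray (X u) i j (Suc k))"
    using short_rays_grow by blast
  have "exp \<delta> * cmod (X (w @ [c]) $ i) \<le> cmod (X (w @ [c]) $ c) \<and>
       exp \<delta> * cmod (X (w @ [c]) $ c) \<le> cmod (X (w @ [c, i]) $ i)"
    if d: "distinct_adj (w @ [c, i])" and len: "m0 + k1 \<le> length w"
      and short: "length (strip {c, i} w) < m0" for w c i
  proof -
    have "c \<noteq> i" using d by (auto simp: distinct_adj_append_iff)
    have "strip {i, c} (w @ [c, i]) = strip {c, i} w"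
      using strip_append[of "[c, i]" "{c, i}" w] by (simp add: insert_commute)
    then obtain u p q k where *: "(u, p, q) \<in> branches" "{p, q} = {i, c}" "u = strip {c, i} w"
        "w @ [c, i] = u @ alt_word p q (Suc k)" "c = (if even k then q else p)"
      using branch_edge_surj[of "w @ [c, i]" c] d \<open>c \<noteq> i\<close> by auto
    have "(w @ [c]) @ [i] = (u @ alt_word p q k) @ [if even k then p else q]"
      using *(4) by (simp add: alt_word_Suc)
    then have w: "w @ [c] = u @ alt_word p q k" and i: "i = (if even k then p else q)"
      by (metis append1_eq_conv)+
    \<comment> \<open>The branch starts at depth below \<open>m0\<close>, so a word longer than
      \<open>m0 + k1\<close> is at least \<open>k1\<close> steps along it.\<close>
    have "Suc (length w) = length u + k"
      using arg_cong[OF w, of length] by simp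
    moreover have u: "length u < m0" using short *(3) by simp
    ultimately have k: "k \<ge> k1" using len by linarith
    have "X (w @ [c]) $ i = ray (X u) p q k" "X (w @ [c]) $ c = ray (X u) p q (Suc k)"
      unfolding w using ray_next[OF *(1), of k] ray_other[OF *(1), of k] i *(5) by simp_all
    moreover have "X (w @ [c, i]) $ i = ray (X u) p q (Suc (Suc k))"
      unfolding *(4) using ray_other[OF *(1), of "Suc k"] i by (cases "even k") simp_all
    ultimately show ?thesis
      using g[OF *(1) u, of k] g[OF *(1) u, of "Suc k"] k by simp
  qed
  then show ?thesis using \<delta> unfolding tail_growth_def by blast
qed

section \<open>Forks and uniform growth\<close>

lemma phi_gt_strip:
  assumes "distinct_adj (w @ [c, i])" "m0 \<le> length (strip {c, i} w)"
  shows "K < cmod (phi_at c i (X (w @ [c])))"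
proof -
  have d: "distinct_adj (w @ [c])" "c \<noteq> i"
    using assms(1) by (auto simp: distinct_adj_append_iff)
  have "strip {c, i} (w @ [c]) = strip {c, i} w" by simp
  then show ?thesis
    using phi_gt[OF branches_strip[OF d]] assms(2) phi_at_strip[of c i a "w @ [c]"] by simp
qed

text \<open>On an edge, the old and the new value of the changing coordinate add up to \<phi> times
  the other moving coordinate. At \<open>w @ [c]\<close> this is used for the edge of arrival and
  for the edge of departure, both on the same geodesic.\<close>

lemma
  assumes "c \<noteq> i"
  shows fork_arrive: "cmod (phi_at c i (X (w @ [c]))) * cmod (X (w @ [c]) $ i)
      \<le> cmod (X w $ c) + cmod (X (w @ [c]) $ c)"
    and fork_leave: "cmod (phi_at c i (X (w @ [c]))) * cmod (X (w @ [c]) $ c)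
      \<le> cmod (X (w @ [c]) $ i) + cmod (X (w @ [c, i]) $ i)"
proof -
  have "qprod c (X w) = X (w @ [c]) $ i * phi_at c i (X (w @ [c]))"
    using qprod_eq[OF assms, of "X (w @ [c])"] by (simp add: walk_snoc)
  then show "cmod (phi_at c i (X (w @ [c]))) * cmod (X (w @ [c]) $ i)
      \<le> cmod (X w $ c) + cmod (X (w @ [c]) $ c)"
    using norm_qprod_le[of c a w] by (simp add: norm_mult mult.commute)
  have "qprod i (X (w @ [c])) = X (w @ [c]) $ c * phi_at c i (X (w @ [c]))"
    using qprod_eq[OF assms[symmetric], of "X (w @ [c])"] by (simp add: phi_at_commute)
  then show "cmod (phi_at c i (X (w @ [c]))) * cmod (X (w @ [c]) $ c)
      \<le> cmod (X (w @ [c]) $ i) + cmod (X (w @ [c, i]) $ i)"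
    using norm_qprod_le[of i a "w @ [c]"] by (simp add: norm_mult mult.commute)
qed

text \<open>A shrinking edge this far out cannot lie on a geodesic based near the root, because
  those already grow there; on all others |\<phi>| exceeds \<open>K\<close>.\<close>

lemma shrinking_imp_phi_gt:
  assumes tg: "tail_growth k0 \<delta>" and d: "distinct_adj (w @ [c, i])" and k0: "k0 \<le> length w"
    and shrink: "\<not> grows a (w @ [c, i])"
  shows "K < cmod (phi_at c i (X (w @ [c])))"
proof (rule phi_gt_strip[OF d], rule ccontr)
  assume "\<not> m0 \<le> length (strip {c, i} w)"
  then have g: "exp \<delta> * cmod (X (w @ [c]) $ i) \<le> cmod (X (w @ [c]) $ c)"
    "exp \<delta> * cmod (X (w @ [c]) $ c) \<le> cmod (X (w @ [c, i]) $ i)" and "\<delta> > 0"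
    using tg d k0 unfolding tail_growth_def by auto
  have le: "x \<le> exp \<delta> * x" if "x \<ge> 0" for x
    using \<open>\<delta> > 0\<close> that mult_right_mono[of 1 "exp \<delta>" x] by simp
  have "cmod (X (w @ [c]) $ i) \<le> cmod (X (w @ [c, i]) $ i)"
    using g le[OF norm_ge_zero] by (meson order_trans)
  then show False
    using shrink grows_snoc[of a "w @ [c]" i] by simp
qed

text \<open>Growing into a vertex and shrinking out of it would bound each moving coordinate by
  \<open>2 / |\<phi>|\<close> times the other, which is impossible for |\<phi>| > 2.\<close>

lemma grows_step:
  assumes tg: "tail_growth k0 \<delta>" and d: "distinct_adj (w @ [c, i])" and k0: "k0 \<le> length w"
    and g: "grows a (w @ [c])"
  shows "grows a (w @ [c, i])"
proof (rule ccontr)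
  assume neg: "\<not> grows a (w @ [c, i])"
  let ?f = "cmod (phi_at c i (X (w @ [c])))"
  let ?c = "cmod (X (w @ [c]) $ c)" and ?i = "cmod (X (w @ [c]) $ i)"
  have "c \<noteq> i" "distinct_adj (w @ [c])" using d by (auto simp: distinct_adj_append_iff)
  then have pos: "?c > 0" "?i > 0" using walk_nonzero by auto
  have f: "?f > 2"
    using shrinking_imp_phi_gt[OF tg d k0 neg] K by linarith
  have "?f * ?i \<le> 2 * ?c"
    using fork_arrive[OF \<open>c \<noteq> i\<close>, of w] g by (simp add: grows_snoc)
  moreover have "?f * ?c \<le> 2 * ?i"
    using fork_leave[OF \<open>c \<noteq> i\<close>, of w] neg grows_snoc[of a "w @ [c]" i] by simp
  moreover have "2 * ?i < ?f * ?i" "2 * ?c < ?f * ?c"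
    using f pos by simp_all
  ultimately show False by linarith
qed

text \<open>By \<open>grows_step\<close> a shrinking edge is preceded by shrinking edges all the way
  back to depth \<open>k0\<close>. Along such a path every coordinate stays below its bound
  \<open>C\<close> at depth \<open>k0\<close>, and the sum \<open>S\<close> of the moduli drops by
  at least \<kappa> per edge, so the path cannot be long.\<close>

lemma all_grow:
  assumes tg: "tail_growth k0 \<delta>"
  shows "\<exists>M. \<forall>w i. M \<le> length w \<longrightarrow> distinct_adj (w @ [i]) \<longrightarrow> grows a (w @ [i])"
proof -
  define C where "C = Max (insert 1 ((\<lambda>(w, k). cmod (X w $ k)) ` ({w. length w \<le> k0} \<times> UNIV)))"
  have fin: "finite ((\<lambda>(w, k). cmod (X w $ k)) ` ({w. length w \<le> k0} \<times> (UNIV :: 'n set)))"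
    by (intro finite_imageI finite_cartesian_product finite_short_words) simp
  have "C \<ge> 1" unfolding C_def using fin by (intro Max_ge) auto
  have C: "cmod (X w $ k) \<le> C" if "length w = k0" for w k
    unfolding C_def using fin that by (intro Max_ge) (auto intro!: image_eqI[of _ _ "(w, k)"])
  define n where "n = CARD('n)"
  define \<eta> where "\<eta> = \<epsilon> / C ^ n"
  have "\<eta> > 0" using eps \<open>C \<ge> 1\<close> by (simp add: \<eta>_def)
  \<comment> \<open>Some \<phi> is this coordinate times at most \<open>n\<close> factors of modulus
    at most \<open>C\<close>, and |\<phi>| is at least \<epsilon>.\<close>
  have \<eta>: "\<eta> \<le> cmod (X w $ k)" if d: "distinct_adj w" and le: "\<And>l. cmod (X w $ l) \<le> C" for w k
  proof -
    obtain i j where ij: "i \<noteq> j" "i \<noteq> k" "j \<noteq> k" using two_other_letters by blast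
    have "phi_at i j (X w) = X w $ k * (\<Prod>l\<in>UNIV - {i, k, j}. X w $ l)"
      using ij by (intro phi_at_eq_rest) auto
    then have "cmod (phi_at i j (X w)) = cmod (X w $ k) * (\<Prod>l\<in>UNIV - {i, k, j}. cmod (X w $ l))"
      by (simp add: norm_mult prod_norm)
    also have "(\<Prod>l\<in>UNIV - {i, k, j}. cmod (X w $ l)) \<le> (\<Prod>l\<in>UNIV - {i, k, j}. C)"
      using le by (intro prod_mono) auto
    also have "\<dots> \<le> C ^ n"
      using \<open>C \<ge> 1\<close> by (auto simp: n_def intro!: power_increasing card_mono)
    finally have "\<epsilon> \<le> cmod (X w $ k) * C ^ n"
      using phi_ge[OF d ij(1)] by (simp add: mult_left_mono)
    then show ?thesis using \<open>C \<ge> 1\<close> by (simp add: \<eta>_def divide_le_eq)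
  qed
  define \<kappa> where "\<kappa> = \<eta> * (K\<^sup>2 - 4) / 2"
  have "K\<^sup>2 > 2\<^sup>2" using K by (intro power_strict_mono) auto
  then have "\<kappa> > 0" using \<open>\<eta> > 0\<close> by (simp add: \<kappa>_def)
  define S where "S w = (\<Sum>k\<in>UNIV. cmod (X w $ k))" for w
  have S_drop: "S w - S (w @ [c]) = cmod (X w $ c) - cmod (X (w @ [c]) $ c)" for w c
  proof -
    have "(\<Sum>k\<in>UNIV - {c}. cmod (X (w @ [c]) $ k)) = (\<Sum>k\<in>UNIV - {c}. cmod (X w $ k))"
      by (rule sum.cong) (auto simp: walk_snoc vieta_other)
    then show ?thesis
      by (simp add: S_def sum.remove[of UNIV c])
  qed
  have main: "(\<forall>k. cmod (X w $ k) \<le> C) \<and> S w + \<kappa> * real (length w - k0) \<le> n * C"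
    if "distinct_adj (w @ [i])" "k0 \<le> length w" "\<not> grows a (w @ [i])" for w i
    using that
  proof (induction w arbitrary: i rule: rev_induct)
    case Nil
    then have "k0 = 0" by simp
    then have "cmod (X [] $ k) \<le> C" for k using C[of "[]"] by simp
    moreover from this have "S [] \<le> n * C"
      unfolding S_def n_def by (rule sum_bounded_above)
    ultimately show ?case by simp
  next
    case (snoc c w)
    show ?case
    proof (cases "length (w @ [c]) = k0")
      case True
      then have le: "cmod (X (w @ [c]) $ k) \<le> C" for k using C by blast
      then have "S (w @ [c]) \<le> n * C"
        unfolding S_def n_def by (rule sum_bounded_above)
      with le True show ?thesis by simp
    next
      case False
      then have len: "k0 \<le> length w" using snoc.prems(2) by simp
      have d: "distinct_adj (w @ [c, i])" and d': "distinct_adj (w @ [c])"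
        using snoc.prems(1) by (auto simp: distinct_adj_append_iff)
      have "c \<noteq> i" using d by (auto simp: distinct_adj_append_iff)
      have shrink: "\<not> grows a (w @ [c, i])" using snoc.prems(3) by simp
      have shrink': "\<not> grows a (w @ [c])"
        using grows_step[OF tg d len] shrink by blast
      note IH = snoc.IH[OF d' len shrink']
      have le: "cmod (X (w @ [c]) $ k) \<le> C" for k
      proof (cases "k = c")
        case True
        then show ?thesis using shrink' IH by (auto simp: grows_snoc intro: order_trans less_imp_le)
      next
        case False
        then show ?thesis using IH by (simp add: walk_snoc vieta_other)
      qed
      let ?f = "cmod (phi_at c i (X (w @ [c])))"
      let ?c = "cmod (X (w @ [c]) $ c)" and ?i = "cmod (X (w @ [c]) $ i)"
      let ?D = "S w - S (w @ [c])"
      have pos: "?c \<ge> \<eta>" "?i > 0" "?D \<ge> 0"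
        using \<eta>[OF d' le] walk_nonzero[OF d'] shrink' by (auto simp: S_drop grows_snoc)
      \<comment> \<open>Eliminating \<open>?i\<close> between the two fork inequalities gives
        \<open>?f\<^sup>2 * ?c \<le> 4 * ?c + 2 * ?D\<close>. With \<open>?f > K\<close> and
        \<open>?c \<ge> \<eta>\<close> the drop \<open>?D\<close> is at least \<kappa>, which
        explains the choice of \<kappa>.\<close>
      have "?f * ?c \<le> 2 * ?i"
        using fork_leave[OF \<open>c \<noteq> i\<close>, of w] shrink grows_snoc[of a "w @ [c]" i] by simp
      then have "?f * (?f * ?c) \<le> ?f * (2 * ?i)"
        by (rule mult_left_mono) simp
      also have "\<dots> = 2 * (?f * ?i)" by simp
      also have "\<dots> \<le> 2 * (2 * ?c + ?D)"
        using fork_arrive[OF \<open>c \<noteq> i\<close>, of w] by (simp add: S_drop)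
      finally have "(?f\<^sup>2 - 4) * ?c \<le> 2 * ?D"
        by (simp add: algebra_simps power2_eq_square)
      moreover have "K\<^sup>2 - 4 < ?f\<^sup>2 - 4"
        using shrinking_imp_phi_gt[OF tg d len shrink] K by (simp add: power_strict_mono)
      then have "(K\<^sup>2 - 4) * \<eta> \<le> (?f\<^sup>2 - 4) * ?c"
        using pos(1) \<open>\<eta> > 0\<close> \<open>K\<^sup>2 > 2\<^sup>2\<close> by (intro mult_mono) auto
      ultimately have "\<kappa> \<le> ?D" by (simp add: \<kappa>_def mult.commute)
      moreover have "real (length (w @ [c]) - k0) = real (length w - k0) + 1"
        using len by (simp add: Suc_diff_le)
      ultimately show ?thesis
        using IH le by (simp add: algebra_simps)
    qed
  qed
  obtain N :: nat where N: "n * C / \<kappa> < N" using reals_Archimedean2 by blast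
  have "grows a (w @ [i])" if "k0 + N \<le> length w" "distinct_adj (w @ [i])" for w i
  proof (rule ccontr)
    assume "\<not> grows a (w @ [i])"
    then have "S w + \<kappa> * real (length w - k0) \<le> n * C"
      using main[OF that(2)] that(1) by simp
    moreover have "S w \<ge> 0" by (simp add: S_def sum_nonneg)
    moreover have "\<kappa> * N \<le> \<kappa> * real (length w - k0)"
      using that(1) \<open>\<kappa> > 0\<close> by (intro mult_left_mono) auto
    moreover have "n * C < \<kappa> * N"
      using N \<open>\<kappa> > 0\<close> by (simp add: field_simps)
    ultimately show False by linarith
  qed
  then show ?thesis by blast
qed

end

section \<open>Superadditivity and summability\<close>

text \<open>\<open>delta_le\<close> makes \<open>ln (|\<phi>| / 2)\<close> at least \<delta>
  wherever |\<phi>| > K. \<open>M_gt\<close> ensures that a geodesic based at depth \<open>M\<close>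
  or more does not count as based near the root.\<close>

locale hurwitz_tail = hurwitz_walk a \<mu> K \<epsilon> m0
  for a :: "complex ^ 'n::finite" and \<mu> K \<epsilon> m0 +
  fixes M :: nat and \<delta> :: real
  assumes tail: "tail_growth M \<delta>"
    and grow: "M \<le> length w \<Longrightarrow> distinct_adj (w @ [i]) \<Longrightarrow> grows a (w @ [i])"
    and delta_le: "exp \<delta> \<le> K / 2"
    and M_gt: "m0 < M"

context hurwitz_walk begin

lemma tail_growth_mono:
  assumes "tail_growth k0 \<delta>" "k0 \<le> k1" "0 < \<delta>'" "\<delta>' \<le> \<delta>"
  shows "tail_growth k1 \<delta>'"
proof -
  have le: "exp \<delta>' * x \<le> y" if "exp \<delta> * x \<le> y" "x \<ge> 0" for x y :: real
    using assms(4) that by (meson exp_le_cancel_iff mult_right_mono order_trans)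
  show ?thesis
    using assms unfolding tail_growth_def by (auto intro!: le)
qed

lemma ex_hurwitz_tail: "\<exists>M \<delta>. hurwitz_tail a \<mu> K \<epsilon> m0 M \<delta>"
proof -
  obtain k0 \<delta> where tg: "tail_growth k0 \<delta>" using tail_growthI by blast
  obtain M where M: "\<And>w i. M \<le> length w \<Longrightarrow> distinct_adj (w @ [i]) \<Longrightarrow> grows a (w @ [i])"
    using all_grow[OF tg] by blast
  define \<delta>' where "\<delta>' = min \<delta> (ln (K / 2))"
  have "\<delta>' > 0" using tg K by (simp add: \<delta>'_def tail_growth_def)
  moreover have "exp \<delta>' \<le> exp (ln (K / 2))" by (simp add: \<delta>'_def)
  ultimately have "hurwitz_tail a \<mu> K \<epsilon> m0 (k0 + M + m0 + 1) \<delta>'"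
    using K M by unfold_locales (auto intro!: tail_growth_mono[OF tg] simp: \<delta>'_def)
  then show ?thesis by blast
qed

end

context hurwitz_tail begin

lemma delta_pos: "\<delta> > 0"
  using tail by (simp add: tail_growth_def)

text \<open>
  Geodesics on which \<open>\<phi>\<close> may be small are all based near the root; on them \<open>ln (\<bar>\<phi>\<bar> / 2)\<close> is
  replaced by \<open>\<delta>\<close>, which preserves superadditivity because the coordinates grow along them.
\<close>

definition height :: "'n list \<Rightarrow> 'n \<Rightarrow> real" where
  "height w k = (if length (strip {last w, k} w) < m0 then \<delta>
     else ln (cmod (phi_at (last w) k (X w)) / 2))"

lemma height_ge:
  assumes "distinct_adj (w @ [c])" "k \<noteq> c"
  shows "\<delta> \<le> height (w @ [c]) k"
proof (cases "length (strip {c, k} (w @ [c])) < m0")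
  case False
  have d: "distinct_adj (w @ [c, k])"
    using assms by (auto simp: distinct_adj_append_iff)
  have "K < cmod (phi_at c k (X (w @ [c])))"
    using False by (intro phi_gt_strip[OF d]) simp
  then have "exp \<delta> \<le> cmod (phi_at c k (X (w @ [c]))) / 2"
    using delta_le by linarith
  then have "\<delta> \<le> ln (cmod (phi_at c k (X (w @ [c]))) / 2)"
    by (subst ln_ge_iff) (auto intro: less_le_trans[OF exp_gt_zero])
  then show ?thesis using False by (simp add: height_def)
qed (simp add: height_def)

text \<open>With \<open>R\<close> the product over the remaining labels, the three values |\<phi>|
  at the vertex are \<open>?x c * R\<close>, \<open>?x k * R\<close> and \<open>?x i * R\<close>.
  Growth on arrival gives \<open>?x i * ?x k * R \<le> 2 * ?x c\<close>; multiplied by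
  \<open>R / 4\<close> and after taking logarithms this is the claim, and the 2 explains why heights
  use |\<phi>| / 2.\<close>

lemma height_new:
  assumes d: "distinct_adj (v @ [c])" and M: "M \<le> length v" and ne: "i \<noteq> c" "k \<noteq> c" "i \<noteq> k"
  shows "height (v @ [c]) i + height (v @ [c]) k \<le> ln (cmod (phi_at i k (X (v @ [c]))) / 2)"
proof -
  let ?w = "v @ [c]"
  let ?x = "\<lambda>l. cmod (X ?w $ l)"
  have di: "distinct_adj (v @ [c, i])" and dk: "distinct_adj (v @ [c, k])"
    using d ne by (auto simp: distinct_adj_append_iff)
  define R where "R = (\<Prod>l\<in>UNIV - {i, c, k}. ?x l)"
  have R: "cmod (phi_at i k (X ?w)) = ?x c * R" "cmod (phi_at c i (X ?w)) = ?x k * R"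
      "cmod (phi_at c k (X ?w)) = ?x i * R"
    using phi_at_eq_rest[of i c k "X ?w"] phi_at_eq_rest[of c k i "X ?w"] phi_at_eq_rest[of c i k "X ?w"] ne
    by (auto simp: R_def norm_mult prod_norm insert_commute)
  have pos: "?x l > 0" for l using walk_nonzero[OF d] by simp
  have "R > 0" unfolding R_def using pos by (intro prod_pos) auto
  have grows: "?x i * ?x k * R \<le> 2 * ?x c"
    using fork_arrive[OF ne(1)[symmetric], of v] grow[OF M d] by (simp add: R grows_snoc mult_ac)
  have short_i: "exp \<delta> * ?x i \<le> ?x c" if "length (strip {c, i} v) < m0"
    using tail di M that unfolding tail_growth_def by blast
  have short_k: "exp \<delta> * ?x k \<le> ?x c" if "length (strip {c, k} v) < m0"
    using tail dk M that unfolding tail_growth_def by blast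
  \<comment> \<open>As \<open>last v \<noteq> c\<close>, one of the two label sets misses
    \<open>last v\<close>; the geodesic with these labels is based at \<open>v\<close> itself,
    beyond depth \<open>m0\<close>.\<close>
  have not_both: "\<not> (length (strip {c, i} v) < m0 \<and> length (strip {c, k} v) < m0)"
  proof -
    have "v \<noteq> []" using M M_gt by auto
    then have "last v \<noteq> c" using d by (simp add: distinct_adj_append_iff)
    then have "last v \<notin> {c, i} \<or> last v \<notin> {c, k}" using ne by blast
    then have "strip {c, i} v = v \<or> strip {c, k} v = v" by (auto intro: strip_id)
    then show ?thesis using M M_gt by auto
  qed
  have h: "height ?w l = (if length (strip {c, l} v) < m0 then \<delta> else ln (cmod (phi_at c l (X ?w)) / 2))" for l
    by (simp add: height_def)
  \<comment> \<open>If the geodesic with labels \<open>c\<close>, \<open>m\<close> is based near the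
    root, its height is only \<delta>, and this is paid for by the factor
    \<open>exp \<delta>\<close> by which \<open>?x c\<close> exceeds \<open>?x m\<close>.\<close>
  have swap: "height ?w l \<le> ln (cmod (phi_at i k (X ?w)) / 2) - \<delta>"
    if l: "l = i \<and> m = k \<or> l = k \<and> m = i" and short: "length (strip {c, m} v) < m0" for l m
  proof -
    have "\<not> length (strip {c, l} v) < m0" using not_both l short by blast
    then have "height ?w l = ln (?x m * R / 2)"
      using l by (auto simp: h R)
    moreover have "?x m * R / 2 > 0" using pos \<open>R > 0\<close> by simp
    then have "ln (exp \<delta> * (?x m * R / 2)) = \<delta> + ln (?x m * R / 2)"
      by (subst ln_mult) auto
    ultimately have "\<delta> + height ?w l = ln (exp \<delta> * (?x m * R / 2))"
      by simp
    also have "\<dots> \<le> ln (?x c * R / 2)"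
    proof (rule ln_mono)
      show "exp \<delta> * (?x m * R / 2) \<le> ?x c * R / 2"
        using short_i short_k l short \<open>R > 0\<close> by (auto simp: mult.assoc[symmetric])
      show "0 < exp \<delta> * (?x m * R / 2)"
        using pos \<open>R > 0\<close> by simp
    qed
    finally show ?thesis by (simp add: R)
  qed
  consider "length (strip {c, i} v) < m0" | "length (strip {c, k} v) < m0"
    | "\<not> length (strip {c, i} v) < m0" "\<not> length (strip {c, k} v) < m0" by blast
  then show ?thesis
  proof cases
    case 1
    then show ?thesis using swap[of k i] by (simp add: h)
  next
    case 2
    then show ?thesis using swap[of i k] by (simp add: h)
  next
    case 3
    have "height ?w i + height ?w k = ln ((?x k * R / 2) * (?x i * R / 2))"
    proof -
      have "?x k * R / 2 > 0" "?x i * R / 2 > 0" using pos \<open>R > 0\<close> by simp_all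
      then have "ln ((?x k * R / 2) * (?x i * R / 2)) = ln (?x k * R / 2) + ln (?x i * R / 2)"
        by (subst ln_mult) auto
      then show ?thesis using 3 by (simp add: h R)
    qed
    also have "\<dots> \<le> ln (?x c * R / 2)"
    proof (rule ln_mono)
      have "(?x k * R / 2) * (?x i * R / 2) = (?x i * ?x k * R) * (R / 4)" by simp
      also have "\<dots> \<le> (2 * ?x c) * (R / 4)"
        using grows \<open>R > 0\<close> by (intro mult_right_mono) auto
      finally show "(?x k * R / 2) * (?x i * R / 2) \<le> ?x c * R / 2" by (simp add: mult_ac)
      show "0 < (?x k * R / 2) * (?x i * R / 2)"
        using pos \<open>R > 0\<close> by simp
    qed
    finally show ?thesis by (simp add: R)
  qed
qed

lemma height_snoc_same:
  assumes "i \<noteq> c"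
  shows "height (v @ [c, i]) c = height (v @ [c]) i"
proof -
  have "strip {i, c} (v @ [c, i]) = strip {c, i} (v @ [c])"
    using strip_snoc[of "{i, c}" "v @ [c]" i] by (simp add: insert_commute)
  moreover have "phi_at i c (X (v @ [c, i])) = phi_at c i (X (v @ [c]))"
    using phi_at_vieta[of i i c "X (v @ [c])"] walk_snoc[of a "v @ [c]" i]
    by (simp add: phi_at_commute[of c i])
  ultimately show ?thesis by (simp add: height_def)
qed

lemma height_snoc_other:
  assumes d: "distinct_adj (v @ [c])" and M: "M \<le> length v" and ne: "i \<noteq> c" "k \<noteq> c" "i \<noteq> k"
  shows "height (v @ [c]) i + height (v @ [c]) k \<le> height (v @ [c, i]) k"
proof -
  have "strip {i, k} (v @ [c, i]) = v @ [c]"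
    using strip_snoc[of "{i, k}" "v @ [c]" i] ne by simp
  moreover have "phi_at i k (X (v @ [c, i])) = phi_at i k (X (v @ [c]))"
    using phi_at_vieta[of i i k "X (v @ [c])"] walk_snoc[of a "v @ [c]" i] by simp
  moreover have "\<not> length (v @ [c]) < m0" using M M_gt by simp
  ultimately show ?thesis
    using height_new[OF assms] by (simp add: height_def)
qed

text \<open>\<open>height_snoc_same\<close> and \<open>height_snoc_other\<close> bound the heights
  at the next edge below by linear forms in those at the present one, and \<open>gvec\<close> is the
  transposed rule for coefficients. Hence the linear form remains a lower bound when moved back
  across each edge.\<close>

lemma gvec_height:
  assumes "distinct_adj (v @ [c])" "M \<le> length v" "gvec_ok c u j k"
  shows "(\<Sum>l\<in>UNIV. real (gvec c u j k l) * height (v @ [c]) l)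
    \<le> ln (cmod (phi_at j k (X (v @ [c] @ u))) / 2)"
  using assms
proof (induction u arbitrary: v c)
  case Nil
  then have ne: "j \<noteq> c" "k \<noteq> c" "j \<noteq> k" by (auto simp: gvec_ok_def)
  have "(\<Sum>l\<in>UNIV. real (gvec c [] j k l) * height (v @ [c]) l)
      = (\<Sum>l\<in>{j, k}. height (v @ [c]) l)"
    by (rule sum.mono_neutral_cong_right) auto
  then show ?case
    using height_new[OF Nil.prems(1,2) ne] ne by simp
next
  case (Cons i u)
  have ok: "i \<noteq> c" "gvec_ok i u j k" using Cons.prems(3) by (auto simp: gvec_ok_Cons)
  have d: "distinct_adj ((v @ [c]) @ [i])"
    using Cons.prems(1) ok(1) by (auto simp: distinct_adj_append_iff)
  define b where "b = gvec i u j k"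
  have bi: "b i = 0" unfolding b_def by (rule gvec_start[OF ok(2)])
  have split: "sum f UNIV = f i + f c + sum f (UNIV - {i, c})" for f :: "'n \<Rightarrow> real"
  proof -
    have "UNIV - {i, c} = (UNIV - {i}) - {c}" by auto
    then show ?thesis
      using ok(1) sum.remove[of UNIV i f] sum.remove[of "UNIV - {i}" c f] by simp
  qed
  have "(\<Sum>l\<in>UNIV. real (gvec c (i # u) j k l) * height (v @ [c]) l)
      = real (\<Sum>l\<in>UNIV. b l) * height (v @ [c]) i
        + (\<Sum>l\<in>UNIV - {i, c}. real (b l) * height (v @ [c]) l)"
    unfolding split using ok(1) by (simp add: b_def)
  \<comment> \<open>The total standing at \<open>i\<close> is shared out: every unit of every entry
    of \<open>b\<close> receives one copy of the height at \<open>i\<close>.\<close>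
  also have "\<dots> = real (b c) * height (v @ [c]) i
      + (\<Sum>l\<in>UNIV - {i, c}. real (b l) * (height (v @ [c]) i + height (v @ [c]) l))"
    unfolding of_nat_sum split
    by (simp add: bi algebra_simps sum.distrib sum_distrib_left)
  also have "\<dots> \<le> real (b c) * height (v @ [c, i]) c
      + (\<Sum>l\<in>UNIV - {i, c}. real (b l) * height (v @ [c, i]) l)"
    using height_snoc_same[OF ok(1)] height_snoc_other[OF Cons.prems(1,2) ok(1)]
    by (intro add_mono sum_mono mult_left_mono) auto
  also have "\<dots> = (\<Sum>l\<in>UNIV. real (b l) * height ((v @ [c]) @ [i]) l)"
    unfolding split by (simp add: bi)
  also have "\<dots> \<le> ln (cmod (phi_at j k (X ((v @ [c]) @ [i] @ u))) / 2)"
    unfolding b_def using Cons.prems(2) by (intro Cons.IH d ok) simp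
  finally show ?case by simp
qed

lemma inverse_phi_le:
  assumes d: "distinct_adj (v @ [c])" and M: "M \<le> length v" and ok: "gvec_ok c u j k"
  shows "1 / cmod (phi_at j k (X (v @ [c] @ u))) \<le> exp (- \<delta>) ^ (\<Sum>l\<in>UNIV. gvec c u j k l)"
proof -
  let ?s = "\<Sum>l\<in>UNIV. gvec c u j k l" and ?p = "cmod (phi_at j k (X (v @ [c] @ u)))"
  have "\<delta> * ?s = (\<Sum>l\<in>UNIV. real (gvec c u j k l) * \<delta>)"
    by (simp add: sum_distrib_right[symmetric])
  also have "\<dots> \<le> (\<Sum>l\<in>UNIV. real (gvec c u j k l) * height (v @ [c]) l)"
  proof (rule sum_mono)
    fix l
    show "real (gvec c u j k l) * \<delta> \<le> real (gvec c u j k l) * height (v @ [c]) l"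
      using gvec_start[OF ok] height_ge[OF d, of l] by (cases "l = c") (auto intro: mult_left_mono)
  qed
  also have "\<dots> \<le> ln (?p / 2)" by (rule gvec_height[OF assms])
  finally have le: "\<delta> * ?s \<le> ln (?p / 2)" .
  have "distinct_adj (c # u @ [j])" "j \<noteq> k" using ok by (auto simp: gvec_ok_def)
  then have "distinct_adj (c # u)" by (metis append_Cons distinct_adj_appendD1)
  then have "distinct_adj (v @ [c] @ u)"
    using d by (auto simp: distinct_adj_append_iff)
  then have "?p > 0" using phi_ge[OF _ \<open>j \<noteq> k\<close>] eps by fastforce
  then have "exp (\<delta> * ?s) \<le> ?p / 2" using le by (simp add: ln_ge_iff)
  then have "exp (\<delta> * ?s) \<le> ?p" using \<open>?p > 0\<close> by linarith
  then have "1 / ?p \<le> 1 / exp (\<delta> * ?s)" using \<open>?p > 0\<close> by (intro divide_left_mono) auto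
  also have "\<dots> = exp (- \<delta>) ^ ?s"
    by (simp add: exp_minus field_simps flip: exp_of_nat_mult)
  finally show ?thesis .
qed

text \<open>Beyond finitely many short ones, the branches fall into finitely many families, given by
  the first \<open>M\<close> letters, the next letter and the two labels. Within a family the rest
  of the word is determined by its vector, so \<open>inverse_phi_le\<close> compares with the
  geometric sum over all vectors.\<close>

lemma inverse_phi_summable:
  "(\<lambda>(u, i, j). 1 / cmod (phi_at i j (X u))) summable_on (branches :: ('n list \<times> 'n \<times> 'n) set)"
proof -
  let ?f = "\<lambda>(u, i, j). 1 / cmod (phi_at i j (X u))"
  define I :: "('n list \<times> 'n \<times> 'n \<times> 'n) set" where
    "I = {(v, c, j, k). length v = M \<and> distinct_adj (v @ [c])}"
  define B :: "'n list \<times> 'n \<times> 'n \<times> 'n \<Rightarrow> ('n list \<times> 'n \<times> 'n) set" where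
    "B = (\<lambda>(v, c, j, k). (\<lambda>u. (v @ [c] @ u, j, k)) ` {u. gvec_ok c u j k})"
  have "finite I"
    by (rule finite_subset[of _ "{v. length v \<le> M} \<times> UNIV"]) (auto simp: I_def finite_short_words)
  have "?f summable_on B b" if "b \<in> I" for b
  proof -
    obtain v c j k where b: "b = (v, c, j, k)" "length v = M" "distinct_adj (v @ [c])"
      using \<open>b \<in> I\<close> by (auto simp: I_def)
    let ?U = "{u. gvec_ok c u j k}"
    have inj: "inj_on (\<lambda>u. gvec c u j k) ?U"
      by (rule inj_onI) (use gvec_inj in blast)
    have "(\<lambda>g :: 'n \<Rightarrow> nat. exp (- \<delta>) ^ (\<Sum>l\<in>UNIV. g l)) summable_on ((\<lambda>u. gvec c u j k) ` ?U)"
      using delta_pos by (intro summable_on_subset_banach[OF power_sum_summable]) auto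
    then have "(\<lambda>u. exp (- \<delta>) ^ (\<Sum>l\<in>UNIV. gvec c u j k l)) summable_on ?U"
      unfolding summable_on_reindex[OF inj] by (simp add: o_def)
    then have "(\<lambda>u. ?f (v @ [c] @ u, j, k)) summable_on ?U"
    proof (rule summable_on_comparison_test)
      fix u
      assume "u \<in> ?U"
      then show "?f (v @ [c] @ u, j, k) \<le> exp (- \<delta>) ^ (\<Sum>l\<in>UNIV. gvec c u j k l)"
        using inverse_phi_le[OF b(3), where j = j and k = k and u = u] b(2) by simp
    qed auto
    moreover have "inj_on (\<lambda>u. (v @ [c] @ u, j, k)) ?U"
      by (rule inj_onI) simp
    ultimately show ?thesis
      unfolding B_def b(1) by (simp add: summable_on_reindex o_def)
  qed
  moreover have "B b \<inter> B b' = {}" if "b \<in> I" "b' \<in> I" "b \<noteq> b'" for b b'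
  proof -
    obtain v c j k v' c' j' k' where b: "b = (v, c, j, k)" "b' = (v', c', j', k')"
      by (metis surj_pair)
    have len: "length v = length v'" using that(1,2) by (simp add: I_def b)
    show ?thesis
      using that(3) len unfolding b B_def by auto
  qed
  ultimately have "?f summable_on (\<Union>b\<in>I. B b)"
    using \<open>finite I\<close> by (intro summable_on_finite_union_disjoint)
  moreover have "?f summable_on {(u, i, j) \<in> branches. length u < M + 1}"
    by (intro summable_on_finite finite_short_branches)
  ultimately have "?f summable_on (\<Union>b\<in>I. B b) \<union> {(u, i, j) \<in> branches. length u < M + 1}"
    by (rule summable_on_union)
  moreover have "branches \<subseteq> (\<Union>b\<in>I. B b) \<union> {(u, i, j) \<in> branches. length u < M + 1}"
  proof
    fix b :: "'n list \<times> 'n \<times> 'n"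
    assume "b \<in> branches"
    then obtain w j k where b: "b = (w, j, k)" "(w, j, k) \<in> branches" by (metis surj_pair)
    show "b \<in> (\<Union>b\<in>I. B b) \<union> {(u, i, j) \<in> branches. length u < M + 1}"
    proof (cases "length w < M + 1")
      case False
      define v c u where "v = take M w" and "c = w ! M" and "u = drop (Suc M) w"
      have w: "w = v @ [c] @ u"
        using False by (simp add: v_def c_def u_def id_take_nth_drop)
      have "distinct_adj (v @ c # u @ [j])" "distinct_adj (v @ c # u @ [k])" "j \<noteq> k"
        using branchesD(1,3,4)[OF b(2)] by (simp_all add: w)
      then have "distinct_adj (v @ [c])" "gvec_ok c u j k"
        by (auto simp: gvec_ok_def distinct_adj_append_iff)
      moreover have "length v = M" using False by (simp add: v_def)
      ultimately have "(v, c, j, k) \<in> I" "b \<in> B (v, c, j, k)"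
        by (auto simp: I_def B_def b(1) w)
      then show ?thesis by blast
    qed (use b in auto)
  qed
  ultimately show ?thesis by (rule summable_on_subset_banach)
qed

text \<open>Beyond depth \<open>M\<close> a crossing changes a single coordinate and does not
  decrease its modulus, so the minimum over a ball serves everywhere.\<close>

lemma walk_bounded_below: "\<exists>\<eta>>0. \<forall>w k. distinct_adj w \<longrightarrow> \<eta> \<le> cmod (X w $ k)"
proof -
  define T where "T = (\<lambda>(w, k). cmod (X w $ k)) ` ({w. length w \<le> M \<and> distinct_adj w} \<times> UNIV)"
  have "finite T"
    unfolding T_def
    by (intro finite_imageI finite_cartesian_product finite_subset[OF _ finite_short_words[of M]]) auto
  define \<eta> where "\<eta> = Min (insert 1 T)"
  have "\<eta> > 0"
    using \<open>finite T\<close> walk_nonzero by (auto simp: \<eta>_def T_def)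
  have short: "\<eta> \<le> cmod (X w $ k)" if "length w \<le> M" "distinct_adj w" for w k
    unfolding \<eta>_def using \<open>finite T\<close> that
    by (intro Min_le) (auto simp: T_def intro!: image_eqI[of _ _ "(w, k)"])
  have "\<eta> \<le> cmod (X w $ k)" if "distinct_adj w" for w k
    using that
  proof (induction w arbitrary: k rule: rev_induct)
    case Nil
    then show ?case by (intro short) auto
  next
    case (snoc i w)
    have d: "distinct_adj w" using snoc.prems by auto
    show ?case
    proof (cases "length w < M")
      case True
      then show ?thesis using snoc.prems by (intro short) auto
    next
      case False
      then have "grows a (w @ [i])" using snoc.prems by (intro grow) auto
      then show ?thesis
        using snoc.IH[OF d, of k]
        by (cases "k = i") (auto simp: grows_snoc walk_snoc vieta_other)
    qed
  qed
  then show ?thesis using \<open>\<eta> > 0\<close> by blast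
qed

end

section \<open>The identity over branches\<close>

text \<open>Tannery's theorem: \<open>D\<close> makes the tails outside a finite set uniformly
  small, and on the finite set the limit is taken termwise.\<close>

lemma tendsto_infsum_dominated:
  fixes f :: "nat \<Rightarrow> 'a \<Rightarrow> complex" and g :: "'a \<Rightarrow> complex" and D :: "'a \<Rightarrow> real"
  assumes D: "D summable_on A" and le: "\<And>m x. x \<in> A \<Longrightarrow> norm (f m x) \<le> D x"
    and lim: "\<And>x. x \<in> A \<Longrightarrow> (\<lambda>m. f m x) \<longlonglongrightarrow> g x"
  shows "g summable_on A" and "(\<lambda>m. infsum (f m) A) \<longlonglongrightarrow> infsum g A"
proof -
  have g_le: "norm (g x) \<le> D x" if "x \<in> A" for x
    using LIMSEQ_le_const2[OF tendsto_norm[OF lim[OF that]]] le[OF that] by blast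
  show g: "g summable_on A"
    by (rule abs_summable_summable, rule Infinite_Sum.abs_summable_on_comparison_test'[OF D g_le])
  have f: "f m summable_on A" for m
    by (rule abs_summable_summable, rule Infinite_Sum.abs_summable_on_comparison_test'[OF D le])
  show "(\<lambda>m. infsum (f m) A) \<longlonglongrightarrow> infsum g A"
  proof (rule LIMSEQ_I)
    fix e :: real
    assume "e > 0"
    obtain F where F: "finite F" "F \<subseteq> A" "dist (sum D F) (infsum D A) \<le> e / 8"
      using infsum_finite_approximation[OF D, of "e / 8"] \<open>e > 0\<close> by auto
    have sub: "h summable_on (A - F)" if "h summable_on A" for h :: "'a \<Rightarrow> 'c :: banach"
      using that by (rule summable_on_subset_banach) auto
    have split: "infsum h A = sum h F + infsum h (A - F)" if "h summable_on A" for h :: "'a \<Rightarrow> 'c :: banach"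
      using infsum_Un_disjoint[of h F "A - F"] F sub[OF that] by (simp add: Un_absorb1)
    have "infsum D (A - F) \<le> e / 8"
      using F(3) split[OF D] by (simp add: dist_real_def)
    have tail: "norm (infsum h (A - F)) \<le> e / 8"
      if "\<And>x. x \<in> A \<Longrightarrow> norm (h x) \<le> D x" "h summable_on A" for h :: "'a \<Rightarrow> complex"
    proof -
      have "norm (infsum h (A - F)) \<le> infsum D (A - F)"
        using that(1) by (intro norm_infsum_le[OF has_sum_infsum[OF sub[OF that(2)]] has_sum_infsum[OF sub[OF D]]]) auto
      with \<open>infsum D (A - F) \<le> e / 8\<close> show ?thesis by simp
    qed
    have "(\<lambda>m. sum (f m) F) \<longlonglongrightarrow> sum g F"
      using F lim by (intro tendsto_sum) auto
    then obtain N where N: "\<And>m. m \<ge> N \<Longrightarrow> norm (sum (f m) F - sum g F) < e / 2"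
      using \<open>e > 0\<close> by (meson LIMSEQ_D half_gt_zero)
    have "norm (infsum (f m) A - infsum g A) < e" if "m \<ge> N" for m
    proof -
      have "infsum (f m) A - infsum g A
          = (sum (f m) F - sum g F) + (infsum (f m) (A - F) - infsum g (A - F))"
        by (simp add: split[OF f] split[OF g])
      also have "norm \<dots> \<le> norm (sum (f m) F - sum g F)
          + (norm (infsum (f m) (A - F)) + norm (infsum g (A - F)))"
        by (intro order_trans[OF norm_triangle_ineq] add_left_mono norm_triangle_ineq4)
      also have "\<dots> < e / 2 + (e / 8 + e / 8)"
        by (intro add_less_le_mono add_mono N that tail le g_le f g)
      finally show ?thesis using \<open>e > 0\<close> by simp
    qed
    then show "\<exists>N. \<forall>m\<ge>N. norm (infsum (f m) A - infsum g A) < e" by blast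
  qed
qed

lemma finite_union_summable:
  fixes f :: "'a \<Rightarrow> real"
  assumes "finite I" "\<And>i. i \<in> I \<Longrightarrow> f summable_on B i"
  shows "f summable_on (\<Union>i\<in>I. B i)"
  using assms
proof (induction I rule: finite_induct)
  case (insert i I)
  then have "f summable_on (B i \<union> (\<Union>i\<in>I. B i))"
    using summable_on_union[of f "B i" "\<Union>i\<in>I. B i"] by simp
  then show ?case by simp
qed simp

lemma summable_up_to_finite:
  fixes f :: "'a \<Rightarrow> 'b :: real_normed_vector" and g :: "'a \<Rightarrow> real"
  assumes "g summable_on A" "finite F" "\<And>x. x \<in> A - F \<Longrightarrow> norm (f x) \<le> g x"
  shows "(\<lambda>x. norm (f x)) summable_on A"
proof -
  have "(\<lambda>x. norm (f x)) summable_on (A - F)"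
    using summable_on_subset_banach[OF assms(1), of "A - F"] assms(3)
    by (auto intro: Infinite_Sum.abs_summable_on_comparison_test'[of g])
  moreover have "(\<lambda>x. norm (f x)) summable_on F"
    using assms(2) by simp
  ultimately have "(\<lambda>x. norm (f x)) summable_on ((A - F) \<union> F)"
    by (rule summable_on_union)
  then show ?thesis by (rule summable_on_subset_banach) auto
qed

section \<open>Spheres in the tree and the weight crossing them\<close>

definition words :: "nat \<Rightarrow> 'n list set" where
  "words m = {w. distinct_adj w \<and> length w = m}"

text \<open>An edge is named by its endpoint farther from the root.\<close>

definition edge_words :: "'n list set" where
  "edge_words = {w. distinct_adj w \<and> w \<noteq> []}"

lemma finite_words: "finite (words m :: 'n::finite list set)"
  by (rule finite_subset[OF _ finite_short_words[of m]]) (auto simp: words_def)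

lemma sum_words_Suc:
  fixes f :: "'n::finite list \<Rightarrow> complex"
  assumes "m > 0"
  shows "(\<Sum>W\<in>words (Suc m). f W) = (\<Sum>w\<in>words m. \<Sum>j\<in>UNIV - {last w}. f (w @ [j]))"
proof -
  have "(\<Sum>w\<in>words m. \<Sum>j\<in>UNIV - {last w}. f (w @ [j]))
      = (\<Sum>(w, j)\<in>Sigma (words m) (\<lambda>w. UNIV - {last w}). f (w @ [j]))"
    by (rule sum.Sigma) (auto simp: finite_words)
  also have "\<dots> = (\<Sum>W\<in>words (Suc m). f W)"
  proof (rule sum.reindex_bij_witness[of _ "\<lambda>W. (butlast W, last W)" "\<lambda>(w, j). w @ [j]"])
    fix W :: "'n list"
    assume "W \<in> words (Suc m)"
    then obtain w j where "W = w @ [j]" "length w = m" "distinct_adj (w @ [j])"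
      by (cases W rule: rev_cases) (auto simp: words_def)
    then show "(butlast W, last W) \<in> Sigma (words m) (\<lambda>w. UNIV - {last w})"
      and "(case (butlast W, last W) of (w, j) \<Rightarrow> w @ [j]) = W"
      using assms by (auto simp: words_def distinct_adj_append_iff)
  qed (use assms in \<open>auto simp: words_def distinct_adj_append_iff\<close>)
  finally show ?thesis by simp
qed

context hurwitz_walk begin

definition flow :: "'n list \<Rightarrow> complex" where
  "flow W = X (butlast W) $ last W / qprod (last W) (X (butlast W))"

definition edge_term :: "'n list \<Rightarrow> complex" where
  "edge_term W = 1 / (X (butlast W) $ last W * X W $ last W)"

definition vertex_term :: "'n list \<Rightarrow> complex" where
  "vertex_term w = 1 / (\<Prod>k\<in>UNIV. X w $ k)"

definition total_flow :: "'n list \<Rightarrow> complex" where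
  "total_flow W = flow W - \<mu> / of_nat CARD('n) * vertex_term (butlast W)"

lemma card_nonzero: "of_nat CARD('n) \<noteq> (0 :: complex)" "of_nat CARD('n) - 1 \<noteq> (0 :: complex)"
  using card by auto

lemma qprod_nonzero: "distinct_adj w \<Longrightarrow> qprod i (X w) \<noteq> 0"
  using walk_nonzero by (simp add: qprod_def)

lemma sum_total_flow:
  assumes "distinct_adj w"
  shows "(\<Sum>i\<in>UNIV. total_flow (w @ [i])) = 1"
proof -
  let ?P = "\<Prod>k\<in>UNIV. X w $ k"
  have P: "?P \<noteq> 0" using walk_nonzero[OF assms] by simp
  have "flow (w @ [i]) = (X w $ i)\<^sup>2 / ?P" for i
    using qprod_nonzero[OF assms, of i] walk_nonzero[OF assms, of i]
    unfolding prod_eq_qprod[of _ i] by (simp add: flow_def power2_eq_square)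
  then have "(\<Sum>i\<in>UNIV. total_flow (w @ [i])) = (\<Sum>i\<in>UNIV. (X w $ i)\<^sup>2) / ?P - \<mu> / ?P"
    using card_nonzero by (simp add: total_flow_def sum_subtractf sum_divide_distrib vertex_term_def)
  also have "(\<Sum>i\<in>UNIV. (X w $ i)\<^sup>2) = ?P + \<mu>"
    using markoff_walk[of a w, unfolded markoff_a] unfolding markoff_def
    by (simp add: diff_eq_eq add.commute)
  finally show ?thesis using P by (simp add: add_divide_distrib)
qed

lemma total_flow_step:
  assumes d: "distinct_adj (w @ [i])"
  shows "(\<Sum>j\<in>UNIV - {i}. total_flow (w @ [i] @ [j]))
    = total_flow (w @ [i]) + \<mu> / of_nat CARD('n) * edge_term (w @ [i])"
proof -
  have dw: "distinct_adj w" using d by auto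
  define x y Q where "x = X w $ i" and "y = X (w @ [i]) $ i" and "Q = qprod i (X w)"
  have nz: "x \<noteq> 0" "y \<noteq> 0" "Q \<noteq> 0"
    using walk_nonzero[OF d] walk_nonzero[OF dw] qprod_nonzero[OF dw] by (auto simp: x_def y_def Q_def)
  have xy: "x + y = Q"
    by (simp add: x_def y_def Q_def walk_snoc vieta_same)
  have Q': "qprod i (X (w @ [i])) = Q" by (simp add: Q_def walk_snoc)
  have P: "vertex_term w = 1 / (x * Q)" "vertex_term (w @ [i]) = 1 / (y * Q)"
    unfolding vertex_term_def prod_eq_qprod[of _ i] Q' by (simp_all add: x_def y_def Q_def)
  have f: "total_flow (w @ [i]) = x / Q - \<mu> / of_nat CARD('n) * (1 / (x * Q))"
    by (simp add: total_flow_def flow_def P x_def Q_def)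
  \<comment> \<open>The word \<open>(w @ [i]) @ [i]\<close> is not reduced; it encodes the same edge
    traversed backwards. The definition applies to it because it only looks at
    \<open>butlast\<close> and \<open>last\<close>.\<close>
  have f': "total_flow ((w @ [i]) @ [i]) = y / Q - \<mu> / of_nat CARD('n) * (1 / (y * Q))"
    unfolding total_flow_def flow_def butlast_snoc last_snoc P Q' y_def by simp
  have "1 = total_flow ((w @ [i]) @ [i]) + (\<Sum>j\<in>UNIV - {i}. total_flow ((w @ [i]) @ [j]))"
    using sum_total_flow[OF d] by (subst sum.remove[of UNIV i, symmetric]) auto
  then have "(\<Sum>j\<in>UNIV - {i}. total_flow (w @ [i] @ [j]))
      = 1 - y / Q + \<mu> / of_nat CARD('n) * (1 / (y * Q))"
    unfolding f' by (simp add: algebra_simps)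
  also have "1 - y / Q = x / Q"
    using nz(3) unfolding xy[symmetric] by (simp add: field_simps)
  also have "1 / (y * Q) = 1 / (x * y) - 1 / (x * Q)"
  proof -
    have "1 / (x * Q) + 1 / (y * Q) = (x + y) / (x * y * Q)"
      using nz by (simp add: field_simps)
    also have "\<dots> = 1 / (x * y)" using nz by (simp add: xy)
    finally show ?thesis by (simp add: algebra_simps)
  qed
  finally show ?thesis
    unfolding f by (simp add: edge_term_def x_def y_def algebra_simps)
qed

lemma level_identity:
  "(\<Sum>W\<in>words (Suc m). total_flow W)
    = 1 + \<mu> / of_nat CARD('n) * (\<Sum>l<m. \<Sum>W\<in>words (Suc l). edge_term W)"
proof (induction m)
  case 0
  have "words (Suc 0) = range (\<lambda>i :: 'n. [i])"
    by (auto simp: words_def length_Suc_conv)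
  then have "(\<Sum>W\<in>words (Suc 0). total_flow W) = (\<Sum>i\<in>UNIV. total_flow ([] @ [i]))"
    by (simp add: sum.reindex inj_on_def)
  then show ?case using sum_total_flow[of "[]"] by simp
next
  case (Suc m)
  have "(\<Sum>j\<in>UNIV - {last w}. total_flow (w @ [j])) = total_flow w + \<mu> / of_nat CARD('n) * edge_term w"
    if w: "w \<in> words (Suc m)" for w
  proof -
    obtain v i where "w = v @ [i]" "distinct_adj (v @ [i])"
      using w by (cases w rule: rev_cases) (auto simp: words_def)
    then show ?thesis using total_flow_step[of v i] by simp
  qed
  then have "(\<Sum>W\<in>words (Suc (Suc m)). total_flow W)
      = (\<Sum>w\<in>words (Suc m). total_flow w + \<mu> / of_nat CARD('n) * edge_term w)"
    by (simp add: sum_words_Suc)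
  then show ?case
    using Suc by (simp add: sum.distrib sum_distrib_left algebra_simps)
qed

end

section \<open>Absolute summability of vertex and edge terms\<close>

context hurwitz_tail begin

text \<open>At each vertex, two labels different from the last letter give a branch based there, so
  distinct vertices get distinct branches. The product of all coordinates is \<phi> of that branch
  times two coordinates, which are bounded below.\<close>

lemma vertex_term_summable: "(\<lambda>w. norm (vertex_term w)) summable_on {w. distinct_adj w}"
proof -
  obtain \<eta> where \<eta>: "\<eta> > 0" "\<And>w k. distinct_adj w \<Longrightarrow> \<eta> \<le> cmod (X w $ k)"
    using walk_bounded_below by blast
  have "\<exists>p. fst p \<noteq> snd p \<and> fst p \<noteq> last w \<and> snd p \<noteq> last w" for w :: "'n list"
    using two_other_letters[of "last w"] by (metis fst_conv snd_conv)
  then obtain p :: "'n list \<Rightarrow> 'n \<times> 'n"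
    where p: "\<And>w. fst (p w) \<noteq> snd (p w)" "\<And>w. fst (p w) \<noteq> last w" "\<And>w. snd (p w) \<noteq> last w"
    by metis
  define h where "h w = (w, fst (p w), snd (p w))" for w
  have inj: "inj_on h {w. distinct_adj w}" by (auto simp: inj_on_def h_def)
  have sub: "h ` {w. distinct_adj w} \<subseteq> branches"
  proof
    fix b
    assume "b \<in> h ` {w. distinct_adj w}"
    then obtain w where "b = h w" "distinct_adj w" by blast
    then show "b \<in> branches"
      using p[of w] by (auto simp: h_def branches_def distinct_adj_append_iff)
  qed
  have "(\<lambda>(u, i, j). 1 / cmod (phi_at i j (X u))) summable_on (h ` {w. distinct_adj w})"
    by (rule summable_on_subset_banach[OF inverse_phi_summable sub])
  then have "(\<lambda>w. 1 / cmod (phi_at (fst (p w)) (snd (p w)) (X w))) summable_on {w. distinct_adj w}"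
    unfolding summable_on_reindex[OF inj] by (simp add: o_def h_def case_prod_beta)
  then have "(\<lambda>w. (1 / \<eta>\<^sup>2) * (1 / cmod (phi_at (fst (p w)) (snd (p w)) (X w))))
      summable_on {w. distinct_adj w}"
    by (rule summable_on_cmult_right)
  then show ?thesis
  proof (rule Infinite_Sum.abs_summable_on_comparison_test')
    fix w :: "'n list"
    assume "w \<in> {w. distinct_adj w}"
    then have d: "distinct_adj w" by simp
    define i j f where "i = fst (p w)" and "j = snd (p w)" and "f = cmod (phi_at i j (X w))"
    have "i \<noteq> j" using p by (simp add: i_def j_def)
    then have "f > 0" using phi_ge[OF d, of i j] eps unfolding f_def by linarith
    have "cmod (\<Prod>k\<in>UNIV. X w $ k) = cmod (X w $ i) * cmod (X w $ j) * f"
      unfolding prod_eq_qprod[of _ i] qprod_eq[OF \<open>i \<noteq> j\<close>] by (simp add: norm_mult f_def)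
    moreover have "\<eta>\<^sup>2 * f \<le> cmod (X w $ i) * cmod (X w $ j) * f"
      unfolding power2_eq_square using \<eta> d \<open>f > 0\<close> by (intro mult_right_mono mult_mono) auto
    ultimately have "norm (vertex_term w) \<le> 1 / (\<eta>\<^sup>2 * f)"
      unfolding vertex_term_def norm_divide using \<eta>(1) \<open>f > 0\<close>
      by (auto intro!: divide_left_mono mult_pos_pos)
    then show "norm (vertex_term w) \<le> 1 / \<eta>\<^sup>2 * (1 / cmod (phi_at (fst (p w)) (snd (p w)) (X w)))"
      by (simp add: f_def i_def j_def)
  qed
qed

lemma vertex_term_edges_summable:
  "(\<lambda>W. norm (vertex_term (butlast W))) summable_on edge_words"
proof -
  have "(\<lambda>W. norm (vertex_term (butlast W))) summable_on ((\<lambda>w. w @ [i]) ` {w. distinct_adj w})" for i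
    using vertex_term_summable by (subst summable_on_reindex) (auto simp: inj_on_def o_def)
  then have "(\<lambda>W. norm (vertex_term (butlast W))) summable_on
      (\<Union>i\<in>UNIV. (\<lambda>w. w @ [i]) ` {w. distinct_adj w})"
    by (intro finite_union_summable) auto
  then show ?thesis
  proof (rule summable_on_subset_banach)
    show "edge_words \<subseteq> (\<Union>i\<in>UNIV. (\<lambda>w. w @ [i]) ` {w :: 'n list. distinct_adj w})"
    proof
      fix W :: "'n list"
      assume "W \<in> edge_words"
      then have "W = butlast W @ [last W]" "distinct_adj (butlast W)"
        by (auto simp: edge_words_def) (metis append_butlast_last_id distinct_adj_appendD1)
      then show "W \<in> (\<Union>i\<in>UNIV. (\<lambda>w. w @ [i]) ` {w. distinct_adj w})" by blast
    qed
  qed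
qed

text \<open>Beyond depth \<open>M\<close> the outer coordinate has at least half the modulus of
  \<open>qprod\<close>, so replacing it by \<open>qprod\<close> turns the edge term into a vertex
  term at the cost of a factor 2.\<close>

lemma edge_term_summable: "(\<lambda>W. norm (edge_term W)) summable_on edge_words"
proof (rule summable_up_to_finite)
  show "(\<lambda>W. 2 * norm (vertex_term (butlast W))) summable_on edge_words"
    by (intro summable_on_cmult_right vertex_term_edges_summable)
  show "finite {w :: 'n list. length w \<le> M}" by (rule finite_short_words)
  fix W :: "'n list"
  assume "W \<in> edge_words - {w. length w \<le> M}"
  then obtain w i where W: "W = w @ [i]" "distinct_adj (w @ [i])" "M \<le> length w"
    by (cases W rule: rev_cases) (auto simp: edge_words_def)
  have d: "distinct_adj w" using W(2) by auto
  let ?x = "cmod (X w $ i)" and ?y = "cmod (X (w @ [i]) $ i)" and ?Q = "cmod (qprod i (X w))"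
  have pos: "?x > 0" "?y > 0" "?Q > 0"
    using walk_nonzero[OF d] walk_nonzero[OF W(2)] qprod_nonzero[OF d] by auto
  have "?Q \<le> 2 * ?y"
    using norm_qprod_le[of i a w] grow[OF W(3,2)] by (simp add: grows_snoc)
  then have "1 / ?y \<le> 2 / ?Q" using pos by (simp add: field_simps)
  then have "1 / ?x * (1 / ?y) \<le> 1 / ?x * (2 / ?Q)" using pos by (intro mult_left_mono) auto
  then show "norm (edge_term W) \<le> 2 * norm (vertex_term (butlast W))"
    unfolding W(1) vertex_term_def edge_term_def prod_eq_qprod[of _ i]
    by (simp add: norm_mult norm_divide)
qed

end

section \<open>From spheres to branches\<close>

lemma words_length_less: "{W \<in> edge_words. length W < Suc m} = (\<Union>l<m. words (Suc l))"
  by (auto simp: edge_words_def words_def less_Suc_eq_0_disj)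

lemma sum_words_less:
  fixes f :: "'n::finite list \<Rightarrow> complex"
  shows "(\<Sum>l<m. \<Sum>W\<in>words (Suc l). f W) = infsum (\<lambda>W. if length W < Suc m then f W else 0) edge_words"
proof -
  have "(\<Sum>l<m. \<Sum>W\<in>words (Suc l). f W) = (\<Sum>W\<in>(\<Union>l<m. words (Suc l)). f W)"
  proof (rule sum.UNION_disjoint[symmetric])
    show "\<forall>l\<in>{..<m}. finite (words (Suc l) :: 'n list set)"
      by (simp add: finite_words)
  qed (auto simp: words_def)
  also have "\<dots> = (\<Sum>W\<in>{W \<in> edge_words. length W < Suc m}. f W)"
    by (simp only: words_length_less)
  also have "\<dots> = infsum f {W \<in> edge_words. length W < Suc m}"
    unfolding words_length_less by (rule infsum_finite[symmetric]) (auto simp: finite_words)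
  also have "\<dots> = infsum (\<lambda>W. if length W < Suc m then f W else 0) edge_words"
    by (rule infsum_cong_neutral) auto
  finally show ?thesis .
qed

lemma sum_words:
  fixes f :: "'n::finite list \<Rightarrow> complex"
  shows "(\<Sum>W\<in>words (Suc m). f W) = infsum (\<lambda>W. if length W = Suc m then f W else 0) edge_words"
proof -
  have "(\<Sum>W\<in>words (Suc m). f W) = infsum f (words (Suc m))"
    by (rule infsum_finite[symmetric, OF finite_words])
  also have "\<dots> = infsum (\<lambda>W. if length W = Suc m then f W else 0) edge_words"
    by (rule infsum_cong_neutral) (auto simp: words_def edge_words_def)
  finally show ?thesis .
qed

definition branch_word :: "nat \<Rightarrow> 'n list \<times> 'n \<times> 'n \<Rightarrow> 'n list" where
  "branch_word m = (\<lambda>(u, i, j). u @ alt_word i j (m - length u))"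

text \<open>The last two letters of a word are the labels of the geodesic it continues. Removing at
  least these two letters leads to the base, hence the two extra letters in the length.\<close>

lemma branch_word_bij:
  "bij_betw (branch_word (Suc (Suc m))) {(u, i, j) \<in> branches. length u \<le> m} (words (Suc (Suc m)))"
proof (rule bij_betwI')
  \<comment> \<open>Marking the edge with the last letter but one reduces injectivity to that of
    \<open>branch_edge\<close>.\<close>
  have mark: "branch_edge ((u, i, j), Suc (m - length u)) =
      (branch_word (Suc (Suc m)) (u, i, j), last (butlast (branch_word (Suc (Suc m)) (u, i, j))))"
    if "length u \<le> m" for u :: "'a list" and i j
    using that by (simp add: branch_edge_def branch_word_def Suc_diff_le alt_word_Suc
        flip: append_assoc)
  fix x y :: "'a list \<times> 'a \<times> 'a"
  assume xy: "x \<in> {(u, i, j) \<in> branches. length u \<le> m}" "y \<in> {(u, i, j) \<in> branches. length u \<le> m}"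
  show "branch_word (Suc (Suc m)) x = branch_word (Suc (Suc m)) y \<longleftrightarrow> x = y"
  proof
    assume eq: "branch_word (Suc (Suc m)) x = branch_word (Suc (Suc m)) y"
    obtain u i j u' i' j' where x: "x = (u, i, j)" and y: "y = (u', i', j')"
      by (metis surj_pair)
    have "branch_edge (x, Suc (m - length u)) = branch_edge (y, Suc (m - length u'))"
      using mark[of u i j] mark[of u' i' j'] xy eq unfolding x y by simp
    then have "(x, Suc (m - length u)) = (y, Suc (m - length u'))"
      using xy bij_betw_imp_inj_on[OF branch_edge_bij]
      by (auto simp: x y dest!: inj_onD)
    then show "x = y" by simp
  qed simp
next
  fix x :: "'a list \<times> 'a \<times> 'a"
  assume "x \<in> {(u, i, j) \<in> branches. length u \<le> m}"
  then show "branch_word (Suc (Suc m)) x \<in> words (Suc (Suc m))"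
    by (auto simp: branch_word_def words_def intro: branchesD(5))
next
  fix W :: "'a list"
  assume W: "W \<in> words (Suc (Suc m))"
  then obtain v d c where v: "W = v @ [d] @ [c]" "length v = m" "distinct_adj (v @ [d] @ [c])"
    by (cases W rule: rev_cases; cases "butlast W" rule: rev_cases) (auto simp: words_def)
  then have "d \<noteq> c" by (auto simp: distinct_adj_append_iff)
  then obtain u i j k where *: "(u, i, j) \<in> branches" "{i, j} = {c, d}" "u = strip {c, d} W"
      "W = u @ alt_word i j (Suc k)"
    using branch_edge_surj[of W d] v by auto
  have "u = strip {c, d} v"
    unfolding *(3) v(1) using strip_append[of "[d] @ [c]" "{c, d}" v] by simp
  moreover have "length (strip {c, d} v) \<le> length v"
    using strip_decomp[of v "{c, d}"] by (metis le_add1 length_append)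
  ultimately have len: "length u \<le> m" using v(2) by simp
  have "length W = length u + Suc k" using *(4) by (metis length_alt_word length_append)
  then have "Suc k = Suc (Suc m) - length u" using W unfolding words_def by simp arith
  then have "W = branch_word (Suc (Suc m)) (u, i, j)" using *(4) by (simp add: branch_word_def)
  then show "\<exists>x\<in>{(u, i, j) \<in> branches. length u \<le> m}. W = branch_word (Suc (Suc m)) x"
    using *(1) len by blast
qed

section \<open>Weights and edge terms along one branch\<close>

context hurwitz_walk begin

definition branch_flow :: "'n list \<times> 'n \<times> 'n \<Rightarrow> complex" where
  "branch_flow = (\<lambda>(u, i, j). (1 - csqrt (1 - 4 / (phi_at i j (X u))\<^sup>2)) / 2)"

definition branch_edges :: "'n list \<times> 'n \<times> 'n \<Rightarrow> complex" where
  "branch_edges = (\<lambda>(u, i, j). (big_root (phi_at i j (X u)) * X u $ j + X u $ i) /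
     (phi_at i j (X u) * X u $ i * X u $ j * (big_root (phi_at i j (X u)) * X u $ j - X u $ i)))"

lemma
  assumes br: "(u, i, j) \<in> branches"
  shows flow_ray: "flow (u @ alt_word i j (Suc k)) = ray (X u) i j k / (phi_at i j (X u) * ray (X u) i j (Suc k))"
    and edge_term_ray: "edge_term (u @ alt_word i j (Suc k)) = 1 / (ray (X u) i j k * ray (X u) i j (Suc (Suc k)))"
proof -
  let ?x = "X (u @ alt_word i j k)"
  let ?p = "if even k then i else j" and ?q = "if even k then j else i"
  have w: "u @ alt_word i j (Suc k) = (u @ alt_word i j k) @ [?p]" by (simp add: alt_word_Suc)
  have pq: "?p \<noteq> ?q" using branchesD(1)[OF br] by simp
  have phi: "phi_at ?p ?q ?x = phi_at i j (X u)"
    using walk_append_pair(1)[OF set_alt_word, of i j a u k] by (simp add: phi_at_commute)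
  have "X (u @ alt_word i j (Suc k)) $ ?p = ray (X u) i j (Suc (Suc k))"
    using ray_other[OF br, of "Suc k"] by (cases "even k") simp_all
  note x = ray_next[OF br, of k] ray_other[OF br, of k] this
  have "qprod ?p ?x = ray (X u) i j (Suc k) * phi_at i j (X u)"
    by (simp only: qprod_eq[OF pq] phi x)
  then show "flow (u @ alt_word i j (Suc k)) = ray (X u) i j k / (phi_at i j (X u) * ray (X u) i j (Suc k))"
    unfolding flow_def w butlast_snoc last_snoc x(1) by (simp only: mult.commute)
  show "edge_term (u @ alt_word i j (Suc k)) = 1 / (ray (X u) i j k * ray (X u) i j (Suc (Suc k)))"
    unfolding edge_term_def x(3)[symmetric] unfolding w butlast_snoc last_snoc x(1) ..
qed

lemma
  assumes br: "(u, i, j) \<in> branches"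
  shows flow_tendsto: "(\<lambda>k. flow (u @ alt_word i j (Suc k))) \<longlonglongrightarrow> branch_flow (u, i, j)"
    and edge_term_sums: "(\<lambda>k. edge_term (u @ alt_word i j (Suc k))) sums branch_edges (u, i, j)"
proof -
  have t: "phi_at i j (X u) \<notin> complex_of_real ` {-2..2}"
    using phi_notin branchesD(1,2)[OF br] by blast
  show "(\<lambda>k. flow (u @ alt_word i j (Suc k))) \<longlonglongrightarrow> branch_flow (u, i, j)"
    using lin_rec_flow[OF t refl refl form_nonzero[OF br] ray_nonzero[OF br, unfolded ray_def]]
    by (simp only: flow_ray[OF br] branch_flow_def ray_def prod.case)
  show "(\<lambda>k. edge_term (u @ alt_word i j (Suc k))) sums branch_edges (u, i, j)"
    using lin_rec_edge_sums[OF t refl refl form_nonzero[OF br] ray_nonzero[OF br, unfolded ray_def]]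
    by (simp only: edge_term_ray[OF br] branch_edges_def ray_def prod.case)
qed

end

section \<open>Passage to the limit\<close>

context hurwitz_tail begin

lemma sum_flow_tendsto:
  "(\<lambda>m. \<Sum>W\<in>words (Suc m). flow W) \<longlonglongrightarrow> 1 + \<mu> / of_nat CARD('n) * infsum edge_term edge_words"
proof -
  have "(\<lambda>m. \<Sum>l<m. \<Sum>W\<in>words (Suc l). edge_term W) \<longlonglongrightarrow> infsum edge_term edge_words"
    unfolding sum_words_less
  proof (rule tendsto_infsum_dominated(2)[OF edge_term_summable])
    show "(\<lambda>m. if length W < Suc m then edge_term W else 0) \<longlonglongrightarrow> edge_term W" for W
      by (rule tendsto_eventually, rule eventually_sequentiallyI[of "length W"]) simp
  qed simp
  \<comment> \<open>The sums over single spheres of a family that is summable over all edges tend to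
    0.\<close>
  moreover have "(\<lambda>m. \<Sum>W\<in>words (Suc m). vertex_term (butlast W)) \<longlonglongrightarrow>
      infsum (\<lambda>W. 0) (edge_words :: 'n list set)"
    unfolding sum_words
  proof (rule tendsto_infsum_dominated(2)[OF vertex_term_edges_summable])
    show "(\<lambda>m. if length W = Suc m then vertex_term (butlast W) else 0) \<longlonglongrightarrow> 0" for W
      by (rule tendsto_eventually, rule eventually_sequentiallyI[of "length W"]) simp
  qed simp
  ultimately have "(\<lambda>m. (1 + \<mu> / of_nat CARD('n) * (\<Sum>l<m. \<Sum>W\<in>words (Suc l). edge_term W))
        + \<mu> / of_nat CARD('n) * (\<Sum>W\<in>words (Suc m). vertex_term (butlast W)))
      \<longlonglongrightarrow> (1 + \<mu> / of_nat CARD('n) * infsum edge_term edge_words)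
        + \<mu> / of_nat CARD('n) * infsum (\<lambda>W. 0) (edge_words :: 'n list set)"
    by (intro tendsto_intros)
  moreover have "(\<Sum>W\<in>words (Suc m). flow W)
      = (1 + \<mu> / of_nat CARD('n) * (\<Sum>l<m. \<Sum>W\<in>words (Suc l). edge_term W))
        + \<mu> / of_nat CARD('n) * (\<Sum>W\<in>words (Suc m). vertex_term (butlast W))" for m
    unfolding level_identity[symmetric] total_flow_def
    by (simp add: sum_subtractf sum_distrib_left)
  ultimately show ?thesis by simp
qed

text \<open>Growth bounds |\<phi>| times one term of the ray by twice the next term. The bound on
  the weight does not depend on the position along the branch, so it can serve as a
  majorant.\<close>

lemma flow_le:
  assumes br: "(u, i, j) \<in> branches" and M: "M \<le> length u + k"
  shows "norm (flow (u @ alt_word i j (Suc (Suc k)))) \<le> 2 / (cmod (phi_at i j (X u)))\<^sup>2"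
proof -
  let ?w = "u @ alt_word i j k"
  let ?p = "if even k then i else j" and ?q = "if even k then j else i"
  have w: "u @ alt_word i j (Suc k) = ?w @ [?p]" by (simp add: alt_word_Suc)
  have pq: "?p \<noteq> ?q" using branchesD(1)[OF br] by simp
  have "phi_at ?p ?q (X (?w @ [?p])) = phi_at i j (X u)"
    unfolding w[symmetric] using walk_append_pair(1)[OF set_alt_word, of i j a u "Suc k"]
    by (simp add: phi_at_commute)
  moreover have "X (?w @ [?p]) $ ?q = ray (X u) i j (Suc k)"
    unfolding w[symmetric] using ray_next[OF br, of "Suc k"] by (cases "even k") simp_all
  moreover have "X (?w @ [?p]) $ ?p = ray (X u) i j (Suc (Suc k))"
    unfolding w[symmetric] using ray_other[OF br, of "Suc k"] by (cases "even k") simp_all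
  moreover have "grows a (?w @ [?p])"
    using M branchesD(5)[OF br, of "Suc k"] unfolding w by (intro grow) auto
  ultimately have le: "cmod (phi_at i j (X u)) * cmod (ray (X u) i j (Suc k))
      \<le> 2 * cmod (ray (X u) i j (Suc (Suc k)))"
    using fork_arrive[OF pq, of ?w] unfolding grows_snoc by simp
  have pos: "cmod (phi_at i j (X u)) > 0" "cmod (ray (X u) i j (Suc (Suc k))) > 0"
    using phi_ge[OF branchesD(2,1)[OF br]] eps ray_nonzero[OF br, of "Suc (Suc k)"] by auto
  show ?thesis
    unfolding flow_ray[OF br] norm_divide norm_mult
    using le pos by (simp add: field_simps power2_eq_square)
qed

lemma branch_flow_has_sum:
  "(branch_flow has_sum (1 + \<mu> / of_nat CARD('n) * infsum edge_term edge_words)) branches"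
proof -
  define f where "f m b = (if length (fst b) \<le> m then flow (branch_word (Suc (Suc m)) b) else 0)"
    for m and b :: "'n list \<times> 'n \<times> 'n"
  have sum_f: "infsum (f m) branches = (\<Sum>W\<in>words (Suc (Suc m)). flow W)" for m
  proof -
    let ?B = "{(u, i, j) \<in> branches. length (u :: 'n list) \<le> m}"
    have eq: "?B = {(u, i, j) \<in> branches. length (u :: 'n list) < Suc m}" by auto
    have fin: "finite ?B" unfolding eq by (rule finite_short_branches)
    have "infsum (f m) branches = infsum (\<lambda>b. flow (branch_word (Suc (Suc m)) b)) ?B"
      by (rule infsum_cong_neutral) (auto simp: f_def)
    also have "\<dots> = (\<Sum>b\<in>?B. flow (branch_word (Suc (Suc m)) b))"
      by (rule infsum_finite[OF fin])
    also have "\<dots> = (\<Sum>W\<in>words (Suc (Suc m)). flow W)"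
      by (rule sum.reindex_bij_betw[OF branch_word_bij])
    finally show ?thesis .
  qed
  have f_eq: "f m (u, i, j) = (if length u \<le> m then flow (u @ alt_word i j (Suc (Suc (m - length u)))) else 0)"
    for m u i j by (simp add: f_def branch_word_def Suc_diff_le)
  have lim: "(\<lambda>m. f m b) \<longlonglongrightarrow> branch_flow b" if "b \<in> branches" for b
  proof -
    obtain u i j where b: "b = (u, i, j)" by (metis surj_pair)
    have "(\<lambda>k. flow (u @ alt_word i j (Suc (Suc k)))) \<longlonglongrightarrow> branch_flow b"
      unfolding b by (rule LIMSEQ_Suc[OF flow_tendsto[OF \<open>b \<in> branches\<close>[unfolded b]]])
    then have "(\<lambda>m. flow (u @ alt_word i j (Suc (Suc (m + length u - length u))))) \<longlonglongrightarrow> branch_flow b"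
      by simp
    then have "(\<lambda>m. flow (u @ alt_word i j (Suc (Suc (m - length u))))) \<longlonglongrightarrow> branch_flow b"
      by (rule LIMSEQ_offset)
    then show ?thesis
      unfolding b f_eq
      by (rule Lim_transform_eventually) (rule eventually_sequentiallyI[of "length u"], simp)
  qed
  \<comment> \<open>The branches based at depth at most \<open>M\<close> are finitely many, so any
    finite bound will do; the supremum is finite because the sequence converges.\<close>
  define D where "D b = (if length (fst b) \<le> M then (SUP m. norm (f m b))
      else 2 / (cmod (phi_at (fst (snd b)) (snd (snd b)) (X (fst b))))\<^sup>2)" for b
  have D_le: "norm (f m b) \<le> D b" if b: "b \<in> branches" for m b
  proof (cases "length (fst b) \<le> M")
    case True
    have "bounded (range (\<lambda>m. f m b))"
      using lim[OF b] by (rule convergent_imp_bounded)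
    then have "bdd_above (range (\<lambda>m. norm (f m b)))"
      by (auto simp: bounded_iff bdd_above_def)
    then have "norm (f m b) \<le> (SUP m. norm (f m b))"
      by (rule cSUP_upper[OF UNIV_I])
    then show ?thesis using True by (simp add: D_def)
  next
    case False
    obtain u i j where "b = (u, i, j)" by (metis surj_pair)
    then show ?thesis
      using flow_le[of u i j] False b by (auto simp: D_def f_eq)
  qed
  have "(\<lambda>b. norm (D b)) summable_on branches"
  proof (rule summable_up_to_finite)
    show "(\<lambda>b. 2 / \<epsilon> * (case b of (u, i, j) \<Rightarrow> 1 / cmod (phi_at i j (X u)))) summable_on branches"
      by (intro summable_on_cmult_right inverse_phi_summable)
    show "finite {(u, i, j) \<in> branches. length (u :: 'n list) < Suc M}"
      by (rule finite_short_branches)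
    fix b :: "'n list \<times> 'n \<times> 'n"
    assume b: "b \<in> branches - {(u, i, j) \<in> branches. length u < Suc M}"
    obtain u i j where uij: "b = (u, i, j)" by (metis surj_pair)
    have br: "(u, i, j) \<in> branches" and len: "\<not> length u \<le> M" using b uij by auto
    let ?f = "cmod (phi_at i j (X u))"
    have "?f \<ge> \<epsilon>" using phi_ge[OF branchesD(2,1)[OF br]] .
    then have "2 / ?f\<^sup>2 \<le> 2 / (\<epsilon> * ?f)"
      using eps unfolding power2_eq_square
      by (intro divide_left_mono mult_right_mono mult_pos_pos) auto
    then show "norm (D b) \<le> 2 / \<epsilon> * (case b of (u, i, j) \<Rightarrow> 1 / cmod (phi_at i j (X u)))"
      using len by (simp add: D_def uij)
  qed
  then have "D summable_on branches"
    by (rule abs_summable_summable)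
  note * = tendsto_infsum_dominated[OF this D_le lim]
  have "infsum branch_flow branches = 1 + \<mu> / of_nat CARD('n) * infsum edge_term edge_words"
    using *(2) LIMSEQ_Suc[OF sum_flow_tendsto] unfolding sum_f by (rule LIMSEQ_unique)
  then show ?thesis
    using has_sum_infsum[OF *(1)] by simp
qed

text \<open>The edge terms are summed over the marked edges in two ways: every edge has
  \<open>CARD('n) - 1\<close> marks, and \<open>branch_edge_bij\<close> distributes the marked edges
  over the branches.\<close>

lemma branch_edges_has_sum:
  "(branch_edges has_sum ((of_nat CARD('n) - 1) * infsum edge_term edge_words)) branches"
proof -
  have marked: "marked_edges = Sigma edge_words (\<lambda>W. UNIV - {last W :: 'n})"
    by (auto simp: marked_edges_def edge_words_def)
  have card_other: "card (UNIV - {l :: 'n}) = CARD('n) - 1" for l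
    by (simp add: card_Diff_singleton)
  have n1: "of_nat (CARD('n) - 1) = (of_nat CARD('n) - 1 :: complex)"
    using card by (simp add: of_nat_diff)
  let ?f = "\<lambda>(W, l :: 'n). edge_term W"
  let ?S = "(of_nat CARD('n) - 1) * infsum edge_term edge_words"
  have "(\<lambda>p. norm (?f p)) summable_on marked_edges"
    unfolding marked
  proof (rule summable_on_SigmaI)
    show "((\<lambda>l. norm (?f (W, l))) has_sum real (CARD('n) - 1) * norm (edge_term W)) (UNIV - {last W})" for W
      by (rule has_sum_finiteI) (simp_all add: card_other)
    show "(\<lambda>W. real (CARD('n) - 1) * norm (edge_term W)) summable_on edge_words"
      by (intro summable_on_cmult_right edge_term_summable)
  qed simp
  then have summable: "?f summable_on marked_edges"
    by (rule abs_summable_summable)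
  have "(?f has_sum ?S) marked_edges"
    unfolding marked
  proof (rule has_sum_SigmaI)
    show "((\<lambda>l. ?f (W, l)) has_sum (of_nat CARD('n) - 1) * edge_term W) (UNIV - {last W})" for W
      by (rule has_sum_finiteI) (simp_all add: card_other n1)
    show "((\<lambda>W. (of_nat CARD('n) - 1) * edge_term W) has_sum ?S) edge_words"
      by (rule has_sum_cmult_right[OF has_sum_infsum[OF abs_summable_summable[OF edge_term_summable]]])
  qed (use summable marked in simp)
  then have total: "((\<lambda>p. ?f (branch_edge p)) has_sum ?S) (Sigma branches (\<lambda>_. UNIV))"
    by (subst has_sum_reindex_bij_betw[OF branch_edge_bij])
  show ?thesis
  proof (rule has_sum_SigmaD[OF total])
    fix b :: "'n list \<times> 'n \<times> 'n"
    assume "b \<in> branches"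
    obtain u i j where b: "b = (u, i, j)" by (metis surj_pair)
    have eq: "?f (branch_edge (b, k)) = edge_term (u @ alt_word i j (Suc k))" for k
      by (simp add: branch_edge_def b)
    have "(\<lambda>(b, k). ?f (branch_edge (b, k))) summable_on Sigma branches (\<lambda>_. UNIV)"
      using has_sum_imp_summable[OF total] by (simp add: case_prod_unfold)
    then have "(\<lambda>k. ?f (branch_edge (b, k))) summable_on UNIV"
      using \<open>b \<in> branches\<close> by (rule summable_on_SigmaD1)
    then have hs: "((\<lambda>k. ?f (branch_edge (b, k))) has_sum (\<Sum>\<^sub>\<infinity>k. ?f (branch_edge (b, k)))) UNIV"
      by (rule has_sum_infsum)
    then have "(\<lambda>k. ?f (branch_edge (b, k))) sums (\<Sum>\<^sub>\<infinity>k. ?f (branch_edge (b, k)))"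
      by (rule has_sum_imp_sums)
    moreover have "(\<lambda>k. ?f (branch_edge (b, k))) sums branch_edges b"
      unfolding eq using edge_term_sums \<open>b \<in> branches\<close> b by blast
    ultimately have "(\<Sum>\<^sub>\<infinity>k. ?f (branch_edge (b, k))) = branch_edges b"
      by (rule sums_unique2)
    then show "((\<lambda>k. ?f (branch_edge (b, k))) has_sum branch_edges b) UNIV"
      using hs by metis
  qed
qed

definition summand :: "'n list \<times> 'n \<times> 'n \<Rightarrow> complex" where
  "summand = (\<lambda>(u, i, j). 1 - (1 + 2 * \<mu> / (of_nat CARD('n) * (of_nat CARD('n) - 1)
     * (sigma_at i j (X u) - \<mu>))) * csqrt (1 - 4 / (phi_at i j (X u))\<^sup>2))"

text \<open>Taking both ends of a geodesic together removes the root \<open>L\<close> and leaves the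
  value \<mu> - \<sigma> of the form in the denominator.\<close>

lemma summand_eq:
  assumes br: "(u, i, j) \<in> branches"
  defines "c \<equiv> \<mu> / (of_nat CARD('n) * (of_nat CARD('n) - 1))"
  shows "summand (u, i, j) = (branch_flow (u, i, j) - c * branch_edges (u, i, j))
    + (branch_flow (u, j, i) - c * branch_edges (u, j, i))"
proof -
  define t where "t = phi_at i j (X u)"
  define s where "s = csqrt (1 - 4 / t\<^sup>2)"
  define \<sigma> where "\<sigma> = sigma_at i j (X u)"
  have t: "t \<notin> complex_of_real ` {-2..2}"
    unfolding t_def using phi_notin branchesD(1,2)[OF br] by blast
  have N: "(X u $ i)\<^sup>2 + (X u $ j)\<^sup>2 - t * X u $ i * X u $ j = \<mu> - \<sigma>"
    "(X u $ i)\<^sup>2 + (X u $ j)\<^sup>2 - t * X u $ i * X u $ j \<noteq> 0"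
    using form_eq[OF br] form_nonzero[OF br] by (simp_all add: t_def \<sigma>_def)
  have nz: "X u $ i \<noteq> 0" "X u $ j \<noteq> 0"
    using walk_nonzero[OF branchesD(2)[OF br]] by auto
  have ne: "\<mu> \<noteq> \<sigma>" using N by auto
  have "branch_edges (u, i, j) + branch_edges (u, j, i) = - 2 * s / (\<mu> - \<sigma>)"
    using edge_sum_both_ends[OF t s_def refl N(2) nz] unfolding N(1)
    by (simp add: branch_edges_def t_def phi_at_commute[of j i] mult.assoc)
  also have "\<dots> = 2 * s / (\<sigma> - \<mu>)"
    using ne by (simp add: field_simps)
  finally have edges: "branch_edges (u, i, j) + branch_edges (u, j, i) = 2 * s / (\<sigma> - \<mu>)" .
  have flow: "branch_flow (u, i, j) + branch_flow (u, j, i) = 1 - s"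
    by (simp add: branch_flow_def s_def t_def phi_at_commute[of j i])
  have "summand (u, i, j) = 1 - (1 + 2 * c / (\<sigma> - \<mu>)) * s"
    by (simp add: summand_def s_def t_def \<sigma>_def c_def)
  also have "\<dots> = (1 - s) - c * (2 * s / (\<sigma> - \<mu>))"
    by (simp add: algebra_simps)
  finally show ?thesis
    unfolding flow[symmetric] edges[symmetric] by (simp add: algebra_simps)
qed

lemma summand_has_sum: "(summand has_sum 2) branches"
proof -
  define c where "c = \<mu> / (of_nat CARD('n) * (of_nat CARD('n) - 1))"
  let ?F = "\<lambda>b. branch_flow b - c * branch_edges b"
  let ?sw = "\<lambda>(u :: 'n list, i :: 'n, j :: 'n). (u, j, i)"
  let ?\<Xi> = "infsum edge_term edge_words"
  \<comment> \<open>The choice of \<open>c\<close> makes the edge total, whose value is unknown,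
    cancel between the two sums.\<close>
  have "c * ((of_nat CARD('n) - 1) * ?\<Xi>) = \<mu> / of_nat CARD('n) * ?\<Xi>"
    using card_nonzero by (simp add: c_def)
  moreover have "((\<lambda>b. branch_flow b + - (c * branch_edges b)) has_sum
      ((1 + \<mu> / of_nat CARD('n) * ?\<Xi>) + - (c * ((of_nat CARD('n) - 1) * ?\<Xi>)))) branches"
    by (intro has_sum_add has_sum_uminusI has_sum_cmult_right branch_flow_has_sum branch_edges_has_sum)
  ultimately have F: "(?F has_sum 1) branches" by simp
  have bij: "bij_betw ?sw branches branches"
    by (rule bij_betwI[of _ _ _ ?sw]) (auto intro: branches_swap)
  have "((\<lambda>b. ?F (?sw b)) has_sum 1) branches"
    using F by (subst has_sum_reindex_bij_betw[OF bij])
  with F have "((\<lambda>b. ?F b + ?F (?sw b)) has_sum (1 + 1)) branches"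
    by (rule has_sum_add)
  moreover have "?F b + ?F (?sw b) = summand b" if "b \<in> branches" for b
    using that summand_eq by (cases b) (auto simp: c_def)
  ultimately show ?thesis
    using has_sum_cong[of branches "\<lambda>b. ?F b + ?F (?sw b)" summand] by simp
qed

end

section \<open>Alternating geodesics\<close>

lemma carrier_Gam: "w \<in> carrier Gam \<longleftrightarrow> distinct_adj w"
  by (simp add: Gam_def)

lemma mult_reduced: "distinct_adj (u @ v) \<Longrightarrow> u \<otimes>\<^bsub>Gam\<^esub> v = u @ v"
proof (induction u)
  case (Cons i u)
  then have "foldr cancel_Cons u v = u @ v"
    using distinct_adj_ConsD[of i "u @ v"] by (simp add: Gam_def)
  then show ?case
    using Cons.prems cancel_Cons_reduced[of i "u @ v"] by (simp add: Gam_def)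
qed (simp add: Gam_def)

lemma inv_Gam:
  assumes "distinct_adj w"
  shows "inv\<^bsub>Gam\<^esub> w = rev w"
proof (rule Gam.inv_equality)
  have "foldr cancel_Cons (rev w) (foldr cancel_Cons w []) = []"
    by (rule foldr_rev_cancel[of distinct_adj]) (auto simp: cancel_Cons_closed cancel_Cons_twice)
  then show "rev w \<otimes>\<^bsub>Gam\<^esub> w = \<one>\<^bsub>Gam\<^esub>"
    using assms by (simp add: Gam_def foldr_cancel_Cons_Nil)
qed (use assms in \<open>simp_all add: carrier_Gam\<close>)

lemma mult_gen:
  assumes "distinct_adj w"
  shows "w \<otimes>\<^bsub>Gam\<^esub> gen i = (if w \<noteq> [] \<and> last w = i then butlast w else w @ [i])"
proof (cases "w \<noteq> [] \<and> last w = i")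
  case True
  then obtain v where w: "w = v @ [i]" by (metis append_butlast_last_id)
  then have v: "v \<in> carrier Gam" using assms by (auto simp: carrier_Gam)
  have "w = v \<otimes>\<^bsub>Gam\<^esub> gen i"
    using mult_reduced[of v "[i]"] assms w by (simp add: gen_def)
  then have "w \<otimes>\<^bsub>Gam\<^esub> gen i = v"
    using v by (simp add: Gam.m_assoc)
  then show ?thesis using w by simp
next
  case False
  then have "distinct_adj (w @ [i])" using assms by (auto simp: distinct_adj_append_iff)
  then show ?thesis using False mult_reduced[of w "[i]"] by (simp only: gen_def if_False)
qed

lemma cayley_edge_iff:
  "cayley_edge i g h \<longleftrightarrow> distinct_adj g \<and> distinct_adj h \<and> (g = h @ [i] \<or> h = g @ [i])"
proof
  assume e: "cayley_edge i g h"
  then have "distinct_adj g" "distinct_adj h" "g = h \<otimes>\<^bsub>Gam\<^esub> gen i"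
    by (auto simp: cayley_edge_def carrier_Gam)
  then show "distinct_adj g \<and> distinct_adj h \<and> (g = h @ [i] \<or> h = g @ [i])"
    using mult_gen[of h i] by (metis append_butlast_last_id)
next
  assume *: "distinct_adj g \<and> distinct_adj h \<and> (g = h @ [i] \<or> h = g @ [i])"
  then have "g = h \<otimes>\<^bsub>Gam\<^esub> gen i"
    using mult_gen[of h i] by (auto simp: distinct_adj_append_iff)
  then show "cayley_edge i g h" using * by (simp add: cayley_edge_def carrier_Gam)
qed

lemma cayley_edge_step:
  assumes "cayley_edge i g h"
  shows "h = g \<otimes>\<^bsub>Gam\<^esub> gen i"
  using cayley_edge_sym[OF assms] by (simp add: cayley_edge_def)

text \<open>The prefixes of the reduced quotient trace a path of that length; conversely, crossing
  an edge lengthens a reduced word by at most 1.\<close>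

lemma cayley_dist_eq:
  assumes g: "g \<in> carrier Gam" and h: "h \<in> carrier Gam"
  shows "cayley_dist g h = length (inv\<^bsub>Gam\<^esub> g \<otimes>\<^bsub>Gam\<^esub> h)"
  unfolding cayley_dist_def
proof (rule Least_equality)
  define v where "v = inv\<^bsub>Gam\<^esub> g \<otimes>\<^bsub>Gam\<^esub> h"
  define p where "p k = g \<otimes>\<^bsub>Gam\<^esub> take k v" for k
  have v: "distinct_adj v" "v \<in> carrier Gam" using g h by (simp_all add: v_def flip: carrier_Gam)
  have take: "distinct_adj (take k v)" "take k v \<in> carrier Gam" for k
    using v(1) by (metis append_take_drop_id distinct_adj_appendD1 carrier_Gam)+
  have "p 0 = g" using g by (simp add: p_def Gam_def foldr_cancel_Cons_Nil)
  moreover have "p (length v) = h"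
    using g h by (simp add: p_def v_def Gam.m_assoc[symmetric])
  moreover have "\<exists>i. cayley_edge i (p k) (p (Suc k))" if "k < length v" for k
  proof -
    have "take (Suc k) v = take k v @ [v ! k]" using that by (rule take_Suc_conv_app_nth)
    then have "take (Suc k) v = take k v \<otimes>\<^bsub>Gam\<^esub> gen (v ! k)"
      using mult_reduced[of "take k v" "[v ! k]"] take(1)[of "Suc k"] by (simp add: gen_def)
    then have "p (Suc k) = p k \<otimes>\<^bsub>Gam\<^esub> gen (v ! k)"
      using g take(2) by (simp add: p_def Gam.m_assoc)
    then have "cayley_edge (v ! k) (p (Suc k)) (p k)"
      using g take(2) by (simp add: cayley_edge_def p_def)
    from cayley_edge_sym[OF this] show ?thesis ..
  qed
  ultimately show "\<exists>p. p 0 = g \<and> p (length (inv\<^bsub>Gam\<^esub> g \<otimes>\<^bsub>Gam\<^esub> h)) = h \<and>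
      (\<forall>k<length (inv\<^bsub>Gam\<^esub> g \<otimes>\<^bsub>Gam\<^esub> h). \<exists>i. cayley_edge i (p k) (p (Suc k)))"
    unfolding v_def[symmetric] by blast
next
  fix m
  assume "\<exists>p. p 0 = g \<and> p m = h \<and> (\<forall>k<m. \<exists>i. cayley_edge i (p k) (p (Suc k)))"
  then obtain p where p: "p 0 = g" "p m = h" "\<And>k. k < m \<Longrightarrow> \<exists>i. cayley_edge i (p k) (p (Suc k))"
    by blast
  have "k \<le> m \<Longrightarrow> p k \<in> carrier Gam \<and> length (inv\<^bsub>Gam\<^esub> g \<otimes>\<^bsub>Gam\<^esub> p k) \<le> k" for k
  proof (induction k)
    case 0
    then show ?case using g p(1) by (simp add: Gam_def[THEN arg_cong[of _ _ one]])
  next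
    case (Suc k)
    then have IH: "p k \<in> carrier Gam" "length (inv\<^bsub>Gam\<^esub> g \<otimes>\<^bsub>Gam\<^esub> p k) \<le> k" by auto
    have "k < m" using Suc.prems by simp
    from p(3)[OF this] obtain i where i: "cayley_edge i (p k) (p (Suc k))" by blast
    let ?w = "inv\<^bsub>Gam\<^esub> g \<otimes>\<^bsub>Gam\<^esub> p k"
    have "inv\<^bsub>Gam\<^esub> g \<otimes>\<^bsub>Gam\<^esub> p (Suc k) = ?w \<otimes>\<^bsub>Gam\<^esub> gen i"
      using cayley_edge_step[OF i] g IH(1) by (simp add: Gam.m_assoc)
    moreover have "?w \<in> carrier Gam" using g IH(1) by simp
    then have "length (?w \<otimes>\<^bsub>Gam\<^esub> gen i) \<le> Suc (length ?w)"
      by (auto simp: carrier_Gam mult_gen)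
    moreover have "p (Suc k) \<in> carrier Gam" using i by (simp add: cayley_edge_def)
    ultimately show ?case using IH(2) by simp
  qed
  from this[of m] show "length (inv\<^bsub>Gam\<^esub> g \<otimes>\<^bsub>Gam\<^esub> h) \<le> m" using p(2) by simp
qed

lemma cayley_dist_commute:
  assumes "g \<in> carrier Gam" "h \<in> carrier Gam"
  shows "cayley_dist g h = cayley_dist h g"
proof -
  let ?w = "inv\<^bsub>Gam\<^esub> g \<otimes>\<^bsub>Gam\<^esub> h"
  have "?w \<in> carrier Gam" using assms by simp
  then have "inv\<^bsub>Gam\<^esub> ?w = rev ?w" by (intro inv_Gam) (simp only: carrier_Gam)
  moreover have "inv\<^bsub>Gam\<^esub> ?w = inv\<^bsub>Gam\<^esub> h \<otimes>\<^bsub>Gam\<^esub> g"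
    using assms by (simp add: Gam.inv_mult_group)
  ultimately show ?thesis
    using assms by (metis cayley_dist_eq length_rev)
qed

section \<open>Alternating lines\<close>

abbreviation label :: "'n \<Rightarrow> 'n \<Rightarrow> int \<Rightarrow> 'n" where
  "label i j s \<equiv> (if even s then i else j)"

text \<open>Both ends leave the base \<open>u\<close> at time 0, the one with first letter
  \<open>j\<close> in negative time; this way the parity of \<open>s\<close> gives the label on both
  sides.\<close>

definition zigzag :: "'n list \<Rightarrow> 'n \<Rightarrow> 'n \<Rightarrow> int \<Rightarrow> 'n list" where
  "zigzag u i j s = u @ (if s \<ge> 0 then alt_word i j (nat s) else alt_word j i (nat (- s)))"

lemma zigzag_0 [simp]: "zigzag u i j 0 = u"
  by (simp add: zigzag_def)

lemma zigzag_closed: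
  assumes "(u, i, j) \<in> branches"
  shows "distinct_adj (zigzag u i j s)"
  using branchesD(5)[OF assms] branchesD(5)[OF branches_swap[OF assms]] by (simp add: zigzag_def)

lemma zigzag_edge:
  assumes "(u, i, j) \<in> branches"
  shows "cayley_edge (label i j s) (zigzag u i j s) (zigzag u i j (s + 1))"
proof (cases "s \<ge> 0")
  case True
  then have "nat (s + 1) = Suc (nat s)" "even (nat s) \<longleftrightarrow> even s"
    by (simp_all add: nat_add_distrib even_nat_iff)
  then have "zigzag u i j (s + 1) = zigzag u i j s @ [label i j s]"
    using True by (simp add: zigzag_def alt_word_Suc)
  then show ?thesis unfolding cayley_edge_iff using zigzag_closed[OF assms] by blast
next
  case False
  define m where "m = nat (- s - 1)"
  have s: "s = - int m - 1" using False by (simp add: m_def)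
  have "zigzag u i j s = zigzag u i j (s + 1) @ [label i j s]"
    by (cases "m = 0") (simp_all add: zigzag_def s alt_word_Suc nat_add_distrib)
  then show ?thesis unfolding cayley_edge_iff using zigzag_closed[OF assms] by blast
qed

text \<open>Read from any time on, the labels alternate, so the quotient of two vertices is an
  alternating word. It is already reduced, and its length is the time difference.\<close>

lemma zigzag_dist:
  assumes br: "(u, i, j) \<in> branches"
  shows "cayley_dist (zigzag u i j s) (zigzag u i j t) = nat \<bar>s - t\<bar>"
proof -
  let ?z = "zigzag u i j"
  have z: "?z s \<in> carrier Gam" for s using zigzag_closed[OF br] by (simp add: carrier_Gam)
  have ij: "i \<noteq> j" using branchesD(1)[OF br] .
  have alt: "alt_word (label i j s) (label i j (s + 1)) k \<in> carrier Gam" for s k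
    using ij by (auto simp: carrier_Gam intro!: distinct_adj_alt_word)
  have step: "?z (s + int k) = ?z s \<otimes>\<^bsub>Gam\<^esub> alt_word (label i j s) (label i j (s + 1)) k" for s k
  proof (induction k)
    case 0
    show ?case using Gam.r_one[OF z[of s]] by (simp add: Gam_def)
  next
    case (Suc k)
    have l: "label i j (s + int k) = (if even k then label i j s else label i j (s + 1))" by simp
    have "?z (s + int (Suc k)) = ?z (s + int k) \<otimes>\<^bsub>Gam\<^esub> gen (label i j (s + int k))"
    proof -
      have "s + int (Suc k) = s + int k + 1" by simp
      then show ?thesis
        using cayley_edge_step[OF zigzag_edge[OF br, of "s + int k"]] by (simp only:)
    qed
    also have "\<dots> = ?z s \<otimes>\<^bsub>Gam\<^esub> (alt_word (label i j s) (label i j (s + 1)) k \<otimes>\<^bsub>Gam\<^esub> gen (label i j (s + int k)))"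
      unfolding Suc using z alt by (intro Gam.m_assoc) auto
    also have "alt_word (label i j s) (label i j (s + 1)) k \<otimes>\<^bsub>Gam\<^esub> gen (label i j (s + int k))
        = alt_word (label i j s) (label i j (s + 1)) (Suc k)"
      unfolding alt_word_Suc l gen_def
      using alt[of s "Suc k"] by (intro mult_reduced) (simp only: carrier_Gam alt_word_Suc)
    finally show ?case .
  qed
  have fwd: "cayley_dist (?z s) (?z (s + int k)) = k" for s k
  proof -
    have "inv\<^bsub>Gam\<^esub> g \<otimes>\<^bsub>Gam\<^esub> (g \<otimes>\<^bsub>Gam\<^esub> w) = w" if "g \<in> carrier Gam" "w \<in> carrier Gam"
      for g w :: "'a list"
      using that by (simp add: Gam.m_assoc[symmetric])
    from this[OF z alt] have "inv\<^bsub>Gam\<^esub> (?z s) \<otimes>\<^bsub>Gam\<^esub> ?z (s + int k)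
        = alt_word (label i j s) (label i j (s + 1)) k"
      unfolding step .
    then show ?thesis
      using cayley_dist_eq[OF z z, of s "s + int k"] by (simp only: length_alt_word)
  qed
  show ?thesis
  proof (cases "s \<le> t")
    case True
    then show ?thesis using fwd[of s "nat (t - s)"] by simp
  next
    case False
    then show ?thesis
      using fwd[of t "nat (s - t)"] cayley_dist_commute[OF z z, of s t] by simp
  qed
qed

text \<open>A geodesic is a left coset of the subgroup generated by its two labels, and
  \<open>strip\<close> picks the shortest element of the coset; hence the fibre.\<close>

definition geo :: "'n list \<times> 'n \<times> 'n \<Rightarrow> 'n list set" where
  "geo = (\<lambda>(u, i, j). {w. distinct_adj w \<and> strip {i, j} w = u})"

lemma geo_eq_zigzag:
  assumes br: "(u, i, j) \<in> branches"
  shows "geo (u, i, j) = range (zigzag u i j)"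
proof (intro equalityI subsetI)
  fix w
  assume "w \<in> geo (u, i, j)"
  then have w: "distinct_adj w" "strip {i, j} w = u" by (auto simp: geo_def)
  then obtain v where v: "w = u @ v" "set v \<subseteq> {i, j}" using strip_decomp by metis
  have d: "distinct_adj v" using w(1) v(1) by auto
  have ij: "i \<noteq> j" "j \<noteq> i" using branchesD(1)[OF br] by auto
  have "v = [] \<or> hd v \<in> {i, j}" using v(2) hd_in_set by blast
  then consider "v = [] \<or> hd v = i" | "v = [] \<or> hd v = j" by blast
  then show "w \<in> range (zigzag u i j)"
  proof cases
    case 1
    then have "v = alt_word i j (length v)" using alt_word_unique[OF ij(1) d] v(2) by blast
    then have "w = zigzag u i j (int (length v))" using v(1) by (simp add: zigzag_def)
    then show ?thesis by blast
  next
    case 2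
    then have "v = alt_word j i (length v)" using alt_word_unique[OF ij(2) d] v(2) by blast
    then have "w = zigzag u i j (- int (length v))" using v(1) by (cases "v = []") (simp_all add: zigzag_def)
    then show ?thesis by blast
  qed
next
  fix w
  assume "w \<in> range (zigzag u i j)"
  then obtain s where "w = zigzag u i j s" by blast
  then show "w \<in> geo (u, i, j)"
    using zigzag_closed[OF br, of s] branchesD(7)[OF br] branchesD(7)[OF branches_swap[OF br]]
    by (auto simp: geo_def zigzag_def insert_commute)
qed

lemma line_determined:
  assumes p: "\<And>s. cayley_edge (label i j s) (p s) (p (s + 1))"
    and q: "\<And>s. cayley_edge (label i j s) (q s) (q (s + 1))" and 0: "p 0 = q 0"
  shows "p s = q s"
proof (induction s rule: int_induct[of _ 0])
  case (step1 s)
  then show ?case using cayley_edge_step[OF p[of s]] cayley_edge_step[OF q[of s]] by simp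
next
  case (step2 s)
  then show ?case
    using cayley_edge_step[OF cayley_edge_sym[OF p[of "s - 1"]]]
      cayley_edge_step[OF cayley_edge_sym[OF q[of "s - 1"]]] by simp
qed (rule 0)

lemma geo_in_alt_geodesics_at:
  assumes br: "(u, i, j) \<in> branches"
  shows "geo (u, i, j) \<in> alt_geodesics_at i j"
proof -
  have "geodesic_line (zigzag u i j)"
    using zigzag_dist[OF br] zigzag_closed[OF br] by (auto simp: geodesic_line_def carrier_Gam)
  then show ?thesis
    unfolding alt_geodesics_at_def geo_eq_zigzag[OF br]
    by (intro CollectI exI[of _ "zigzag u i j"] conjI allI refl branchesD(1)[OF br] zigzag_edge[OF br])
qed

lemma alt_geodesics_at_geo:
  assumes "\<gamma> \<in> alt_geodesics_at i j"
  shows "\<exists>u. (u, i, j) \<in> branches \<and> \<gamma> = geo (u, i, j)"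
proof -
  obtain p where p: "\<gamma> = range p" "i \<noteq> j" "geodesic_line p"
    "\<And>s. cayley_edge (label i j s) (p s) (p (s + 1))"
    using assms by (auto simp: alt_geodesics_at_def)
  define u where "u = strip {i, j} (p 0)"
  have d: "distinct_adj (p 0)" using p(4)[of 0] by (simp add: cayley_edge_iff)
  have br: "(u, i, j) \<in> branches" unfolding u_def by (rule branches_strip[OF d p(2)])
  let ?z = "zigzag u i j"
  have "p 0 \<in> geo (u, i, j)" using d by (simp add: geo_def u_def)
  then obtain s0 where s0: "p 0 = ?z s0" unfolding geo_eq_zigzag[OF br] by blast
  \<comment> \<open>For odd \<open>s0\<close> the edge with label \<open>i\<close> at that vertex
    leads to time \<open>s0 - 1\<close>, so the given line runs backwards along the zigzag.\<close>
  define \<epsilon> :: int where "\<epsilon> = (if even s0 then 1 else - 1)"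
  have edge: "cayley_edge (label i j s) (?z (s0 + \<epsilon> * s)) (?z (s0 + \<epsilon> * (s + 1)))" for s
  proof (cases "even s0")
    case True
    then show ?thesis using zigzag_edge[OF br, of "s0 + s"] by (simp add: \<epsilon>_def add.assoc)
  next
    case False
    then show ?thesis
      using cayley_edge_sym[OF zigzag_edge[OF br, of "s0 - s - 1"]] by (simp add: \<epsilon>_def algebra_simps)
  qed
  have eq: "p s = ?z (s0 + \<epsilon> * s)" for s
    by (rule line_determined[OF p(4) edge]) (simp add: s0)
  have "?z t \<in> range p" for t
  proof -
    have "?z t = p (\<epsilon> * (t - s0))" unfolding eq by (simp add: \<epsilon>_def)
    then show ?thesis by simp
  qed
  then have "\<gamma> = range ?z" unfolding p(1) using eq by auto
  then show ?thesis using br geo_eq_zigzag[OF br] by blast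
qed

lemma alt_geodesics_eq: "alt_geodesics = geo ` branches"
proof (intro equalityI subsetI)
  fix \<gamma> :: "'a list set"
  assume "\<gamma> \<in> alt_geodesics"
  then obtain i j where "\<gamma> \<in> alt_geodesics_at i j" by (auto simp: alt_geodesics_def)
  from alt_geodesics_at_geo[OF this] show "\<gamma> \<in> geo ` branches" by blast
next
  fix \<gamma> :: "'a list set"
  assume "\<gamma> \<in> geo ` branches"
  then obtain u i j where "(u, i, j) \<in> branches" "\<gamma> = geo (u, i, j)" by (metis imageE surj_pair)
  then have "\<gamma> \<in> alt_geodesics_at i j" by (simp add: geo_in_alt_geodesics_at)
  then show "\<gamma> \<in> alt_geodesics" by (auto simp: alt_geodesics_def)
qed

lemma base_in_geo: "(u, i, j) \<in> branches \<Longrightarrow> u \<in> geo (u, i, j)"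
  using branchesD(2,6) by (auto simp: geo_def)

lemma geo_eqD:
  assumes "(u, i, j) \<in> branches" "(u', i', j') \<in> branches" "geo (u, i, j) = geo (u', i', j')"
  shows "u = u' \<and> {i, j} = {i', j'}"
proof -
  have S: "{i, j} = {i', j'}"
    using alt_geodesics_at_disjoint[of "geo (u, i, j)"] geo_in_alt_geodesics_at[OF assms(1)]
      geo_in_alt_geodesics_at[OF assms(2)] assms(3) by metis
  moreover have "u \<in> geo (u', i', j')" using base_in_geo[OF assms(1)] assms(3) by simp
  then have "strip {i, j} u = u'" unfolding S by (simp add: geo_def)
  ultimately show ?thesis using branchesD(6)[OF assms(1)] by simp
qed

lemma geo_swap: "geo (u, i, j) = geo (u, j, i)"
  by (simp add: geo_def insert_commute)

lemma geo_fibre: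
  assumes "(u, i, j) \<in> branches"
  shows "{b \<in> branches. geo b = geo (u, i, j)} = {(u, i, j), (u, j, i)}"
proof (intro equalityI subsetI)
  fix b
  assume "b \<in> {b \<in> branches. geo b = geo (u, i, j)}"
  moreover obtain u' i' j' where b: "b = (u', i', j')" by (metis surj_pair)
  ultimately have "u' = u \<and> {i', j'} = {i, j}" using geo_eqD[OF _ assms] by blast
  then show "b \<in> {(u, i, j), (u, j, i)}" by (auto simp: b doubleton_eq_iff)
qed (use assms branches_swap[OF assms] geo_swap[of u i j] in auto)

section \<open>Values on geodesics and the constants of the domain\<close>

lemma Phi_eq_walk: "distinct_adj w \<Longrightarrow> Phi a w = walk a w"
  by (simp add: Phi_def inv_Gam act_def walk_def foldl_conv_foldr)

lemma
  assumes "(u, i, j) \<in> branches"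
  shows phi_geo: "phi a (geo (u, i, j)) = phi_at i j (walk a u)"
    and sigma_geo: "sigma a (geo (u, i, j)) = sigma_at i j (walk a u)"
  unfolding phi_eq[OF geo_in_alt_geodesics_at[OF assms] base_in_geo[OF assms]]
    sigma_eq[OF geo_in_alt_geodesics_at[OF assms] base_in_geo[OF assms]]
    Phi_eq_walk[OF branchesD(2)[OF assms]]
  by (simp_all add: phi_at_def sigma_at_def)

lemma ex_hurwitz_walk:
  fixes a :: "complex ^ 'n::finite"
  assumes card: "CARD('n) \<ge> 3" and a: "a \<in> domD" and \<mu>: "markoff a = \<mu>"
  shows "\<exists>K \<epsilon> m0. hurwitz_walk a \<mu> K \<epsilon> m0"
proof -
  obtain K where K: "K > 2" and fin: "finite {\<gamma> \<in> alt_geodesics. cmod (phi a \<gamma>) \<le> K}"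
    and notin: "\<And>\<gamma>. \<gamma> \<in> alt_geodesics \<Longrightarrow> phi a \<gamma> \<notin> complex_of_real ` {-2..2}"
    using a unfolding domD_def by blast
  define F where "F = {\<gamma> \<in> alt_geodesics. cmod (phi a \<gamma>) \<le> K}"
  have geo_phi: "\<exists>\<gamma>\<in>alt_geodesics. phi a \<gamma> = phi_at i j (walk a w)"
    if "distinct_adj w" "i \<noteq> j" for w i j
  proof -
    let ?u = "strip {i, j} w"
    have br: "(?u, i, j) \<in> branches" by (rule branches_strip[OF that])
    then show ?thesis
      using phi_geo[OF br, of a] phi_at_strip[of i j a w] unfolding alt_geodesics_eq by auto
  qed
  \<comment> \<open>\<open>K\<close> bounds the values outside the finite set \<open>F\<close>;
    those on \<open>F\<close> are nonzero because 0 lies in the excluded segment.\<close>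
  define \<epsilon> where "\<epsilon> = Min (insert K ((\<lambda>\<gamma>. cmod (phi a \<gamma>)) ` F))"
  have finF: "finite ((\<lambda>\<gamma>. cmod (phi a \<gamma>)) ` F)" using fin by (simp add: F_def)
  have "phi a \<gamma> \<noteq> 0" if "\<gamma> \<in> F" for \<gamma>
    using notin[of \<gamma>] that by (auto simp: F_def intro!: image_eqI[of _ _ 0])
  then have "\<epsilon> > 0" using finF K by (auto simp: \<epsilon>_def)
  have \<epsilon>: "\<epsilon> \<le> cmod (phi a \<gamma>)" if "\<gamma> \<in> alt_geodesics" for \<gamma>
  proof (cases "cmod (phi a \<gamma>) \<le> K")
    case True
    then show ?thesis using that finF by (auto simp: \<epsilon>_def F_def intro!: Min_le)
  next
    case False
    moreover have "\<epsilon> \<le> K" using finF by (simp add: \<epsilon>_def)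
    ultimately show ?thesis by simp
  qed
  define base where "base \<gamma> = (SOME u. \<exists>i j. (u, i, j) \<in> branches \<and> \<gamma> = geo (u, i, j))"
    for \<gamma> :: "'n list set"
  have base: "base (geo (u, i, j)) = u" if br: "(u, i, j) \<in> branches" for u i j
    unfolding base_def
  proof (rule some_equality)
    show "\<exists>i' j'. (u, i', j') \<in> branches \<and> geo (u, i, j) = geo (u, i', j')" using br by blast
  next
    fix u'
    assume "\<exists>i' j'. (u', i', j') \<in> branches \<and> geo (u, i, j) = geo (u', i', j')"
    then show "u' = u" using geo_eqD[OF br] by metis
  qed
  \<comment> \<open>One more than the greatest depth at which a geodesic with |\<phi>| \<le> K is
    based.\<close>
  define m0 where "m0 = Suc (Max (insert 0 ((\<lambda>\<gamma>. length (base \<gamma>)) ` F)))"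
  have finB: "finite ((\<lambda>\<gamma>. length (base \<gamma>)) ` F)" using fin by (simp add: F_def)
  have "hurwitz_walk a \<mu> K \<epsilon> m0"
  proof
    show "phi_at i j (walk a w) \<notin> complex_of_real ` {-2..2}" if "distinct_adj w" "i \<noteq> j" for w i j
      using geo_phi[OF that] notin by metis
    show "\<epsilon> \<le> cmod (phi_at i j (walk a w))" if "distinct_adj w" "i \<noteq> j" for w i j
      using geo_phi[OF that] \<epsilon> by metis
    show "K < cmod (phi_at i j (walk a u))" if br: "(u, i, j) \<in> branches" and len: "m0 \<le> length u"
      for u i j
    proof (rule ccontr)
      assume "\<not> K < cmod (phi_at i j (walk a u))"
      then have "geo (u, i, j) \<in> F"
        using phi_geo[OF br, of a] br unfolding F_def alt_geodesics_eq by auto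
      then have "length (base (geo (u, i, j))) \<in> (\<lambda>\<gamma>. length (base \<gamma>)) ` F" by (rule imageI)
      then have "length u \<le> Max (insert 0 ((\<lambda>\<gamma>. length (base \<gamma>)) ` F))"
        using finB base[OF br] by (intro Max_ge) auto
      then show False using len by (simp add: m0_def)
    qed
  qed (use card \<mu> K \<open>\<epsilon> > 0\<close> in auto)
  then show ?thesis by blast
qed

text \<open>Every geodesic comes from two branches, its two ends, so the total 2 over the branches
  is twice the total over the geodesics.\<close>

lemma (in hurwitz_tail) h_mu_has_sum: "(h_mu \<mu> a has_sum 1) alt_geodesics"
proof -
  have eq: "summand b = h_mu \<mu> a (geo b)" if "b \<in> branches" for b
    using that by (cases b) (simp add: summand_def h_mu_def phi_geo sigma_geo)
  have "((\<lambda>b. h_mu \<mu> a (geo b)) has_sum 2) branches"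
    by (rule iffD1[OF has_sum_cong[OF eq] summand_has_sum])
  moreover have "bij_betw (\<lambda>b. (geo b, b)) (branches :: ('n list \<times> 'n \<times> 'n) set)
      (Sigma alt_geodesics (\<lambda>\<gamma>. {b \<in> branches. geo b = \<gamma>}))"
  proof (rule bij_betw_imageI)
    show "inj_on (\<lambda>b. (geo b, b)) (branches :: ('n list \<times> 'n \<times> 'n) set)"
      by (rule inj_onI) simp
  qed (auto simp: alt_geodesics_eq)
  ultimately have "((\<lambda>(\<gamma>, b). h_mu \<mu> a \<gamma>) has_sum 2) (Sigma alt_geodesics (\<lambda>\<gamma>. {b \<in> branches. geo b = \<gamma>}))"
    using has_sum_reindex_bij_betw[of "\<lambda>b. (geo b, b)" branches _ "\<lambda>(\<gamma>, b). h_mu \<mu> a \<gamma>"] by simp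
  then have "((\<lambda>\<gamma>. 2 * h_mu \<mu> a \<gamma>) has_sum 2) alt_geodesics"
  proof (rule has_sum_SigmaD)
    fix \<gamma> :: "'n list set"
    assume "\<gamma> \<in> alt_geodesics"
    then obtain u i j where \<gamma>: "\<gamma> = geo (u, i, j)" "(u, i, j) \<in> branches"
      unfolding alt_geodesics_eq by auto
    then show "((\<lambda>b. case (\<gamma>, b) of (\<gamma>, b) \<Rightarrow> h_mu \<mu> a \<gamma>) has_sum 2 * h_mu \<mu> a \<gamma>) {b \<in> branches. geo b = \<gamma>}"
      using branchesD(1)[OF \<gamma>(2)] by (intro has_sum_finiteI) (simp_all add: geo_fibre)
  qed
  then have "((\<lambda>\<gamma>. (1 / 2) * (2 * h_mu \<mu> a \<gamma>)) has_sum ((1 / 2) * 2)) alt_geodesics"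
    by (rule has_sum_cmult_right)
  then show ?thesis by simp
qed

theorem theorem1p5:
  fixes a :: "complex ^ 'n::finite" and \<mu> :: complex
  assumes "CARD('n) \<ge> 3"
    and "a \<in> domD"
    and "(\<Sum>k\<in>UNIV. (a $ k)\<^sup>2) - (\<Prod>k\<in>UNIV. a $ k) = \<mu>"
  shows "(\<lambda>\<gamma>. norm (h_mu \<mu> a \<gamma>)) summable_on alt_geodesics \<and>
         ((\<lambda>\<gamma>. h_mu \<mu> a \<gamma>) has_sum 1) alt_geodesics \<and>
         (\<mu> = 0 \<longrightarrow>
           (\<lambda>\<gamma>. norm (h_fun (phi a \<gamma>))) summable_on alt_geodesics \<and>
           ((\<lambda>\<gamma>. h_fun (phi a \<gamma>)) has_sum 1) alt_geodesics)"
proof -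
  obtain K \<epsilon> m0 where "hurwitz_walk a \<mu> K \<epsilon> m0"
    using ex_hurwitz_walk[OF assms(1,2)] assms(3) by (auto simp: markoff_def)
  then obtain M \<delta> where "hurwitz_tail a \<mu> K \<epsilon> m0 M \<delta>"
    using hurwitz_walk.ex_hurwitz_tail by blast
  then have sum: "((\<lambda>\<gamma>. h_mu \<mu> a \<gamma>) has_sum 1) alt_geodesics"
    by (rule hurwitz_tail.h_mu_has_sum)
  \<comment> \<open>Summability over a set is unconditional, which for complex families is the same
    as absolute.\<close>
  then have abs: "(\<lambda>\<gamma>. norm (h_mu \<mu> a \<gamma>)) summable_on alt_geodesics"
    by (rule iffD1[OF summable_on_iff_abs_summable_on_complex has_sum_imp_summable])
  have "(\<lambda>\<gamma>. h_fun (phi a \<gamma>)) = (\<lambda>\<gamma>. h_mu \<mu> a \<gamma>)" if "\<mu> = 0"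
    by (simp add: h_fun_def h_mu_def that)
  then have "h_fun (phi a \<gamma>) = h_mu \<mu> a \<gamma>" if "\<mu> = 0" for \<gamma>
    using that by metis
  then show ?thesis
    using sum abs by (cases "\<mu> = 0") simp_all
qed

end
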